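(* Let $(\mathcal{K},\otimes,1)$ be an idempotent complete strongly closed tensor triangulated category, and suppose $\mathrm{Spc}(\mathcal{K})=U_1\cup U_2$ with $U_1,U_2$ quasi-compact open. Let $a_i\in\mathcal{K}(U_i)$ for $i=1,2$ and let $\sigma:a_1\to a_2$ be an isomorphism in $\mathcal{K}(U_1\cap U_2)$ between the restrictions of $a_1$ and $a_2$. Then there exists a gluing of $a_1$ and $a_2$ along $\sigma$, i.e. an object $a\in\mathcal{K}$ with isomorphisms $f_i:\rho_{U_i}(a)\to a_i$ in $\mathcal{K}(U_i)$, $i=1,2$, such that $\sigma\circ f_1=f_2$ in $\mathcal{K}(U_1\cap U_2)$. Moreover this gluing is unique up to (possibly non-unique) isomorphism of gluings: for any two gluings $(a,f_1,f_2)$ and $(a',f_1',f_2')$ there is an isomorphism $f:a\to a'$ in $\mathcal{K}$ with $f_i'\circ\rho_{U_i}(f)=f_i$ in $\mathcal{K}(U_i)$ for $i=1,2$.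
   Context: A tensor triangulated category $(\mathcal{K},\otimes,1)$ is an essentially small triangulated category $\mathcal{K}$ (suspension $T$) with a symmetric monoidal structure $\otimes$ with unit $1$ such that $a\otimes-$ and $-\otimes b$ are exact for all $a,b$ and the two canonical composites $T(a)\otimes T(b)\cong T(T(a)\otimes b)\cong T^2(a\otimes b)$ and $T(a)\otimes T(b)\cong T(a\otimes T(b))\cong T^2(a\otimes b)$ differ by the sign $-1$. It is strongly closed if there is a bi-exact functor $\underline{\hom}:\mathcal{K}^{op}\times\mathcal{K}\to\mathcal{K}$ with natural isomorphisms $\mathrm{Mor}_{\mathcal{K}}(a\otimes b,c)\cong\mathrm{Mor}_{\mathcal{K}}(a,\underline{\hom}(b,c))$ and such that the natural morphism $D(a)\otimes b\to\underline{\hom}(a,b)$ is an isomorphism for all $a,b$, where $D(a)=\underline{\hom}(a,1)$. It is idempotent complete if every idempotent endomorphism of every object splits. A prime ideal is a proper full triangulated subcategory $\mathcal{P}\subsetneq\mathcal{K}$ which is thick ($a\oplus b\in\mathcal{P}\Rightarrow a,b\in\mathcal{P}$), a $\otimes$-ideal ($a\in\mathcal{P},\,b\in\mathcal{K}\Rightarrow a\otimes b\in\mathcal{P}$) and prime ($a\otimes b\in\mathcal{P}\Rightarrow a\in\mathcal{P}$ or $b\in\mathcal{P}$). The spectrum $\mathrm{Spc}(\mathcal{K})$ is the set of prime ideals; $\mathrm{supp}(a)=\{\mathcal{P}\mid a\notin\mathcal{P}\}$; the complements of the sets $\mathrm{supp}(a)$, $a\in\mathcal{K}$, form a basis of the topology.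 For $Y\subset\mathrm{Spc}(\mathcal{K})$, $\mathcal{K}_Y$ is the full subcategory of objects $a$ with $\mathrm{supp}(a)\subset Y$. For $U\subset\mathrm{Spc}(\mathcal{K})$ quasi-compact open with complement $Z$, $\mathcal{L}(U)=\mathcal{K}/\mathcal{K}_Z$ is the Verdier quotient, $\mathcal{K}(U)$ is its idempotent completion (a tensor triangulated category), and $\rho_U:\mathcal{K}\to\mathcal{K}(U)$ is the canonical functor. For $U\subset V$ there is an induced restriction functor $\rho_{V,U}:\mathcal{K}(V)\to\mathcal{K}(U)$; restriction functors are often suppressed from the notation. *)

theory Defs
  imports "HOL-Analysis.Function_Topology" "HOL-Algebra.Group"
begin

no_notation mult (infixl "\<otimes>\<index>" 70)

section \<open>Categories\<close>

text \<open>
  Objects and arrows are elements of HOL types, so every category below is small; essentially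
  small categories are represented by equivalent small ones.
\<close>

record ('o, 'm) cat =
  obj :: "'o set"
  arr :: "'m set"
  src :: "'m \<Rightarrow> 'o"
  tgt :: "'m \<Rightarrow> 'o"
  ident :: "'o \<Rightarrow> 'm"
  comp :: "'m \<Rightarrow> 'm \<Rightarrow> 'm" (infixr "\<cdot>\<index>" 60)

definition Mor :: "('o, 'm, 'x) cat_scheme \<Rightarrow> 'o \<Rightarrow> 'o \<Rightarrow> 'm set" where
  "Mor C a b = {f \<in> arr C. src C f = a \<and> tgt C f = b}"

locale category =
  fixes C :: "('o, 'm, 'x) cat_scheme" (structure)
  assumes src_obj: "f \<in> arr C \<Longrightarrow> src C f \<in> obj C"
    and tgt_obj: "f \<in> arr C \<Longrightarrow> tgt C f \<in> obj C"
    and ident_Mor: "a \<in> obj C \<Longrightarrow> ident C a \<in> Mor C a a"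
    and comp_Mor: "\<lbrakk>f \<in> Mor C a b; g \<in> Mor C b c\<rbrakk> \<Longrightarrow> g \<cdot> f \<in> Mor C a c"
    and comp_ident_right: "f \<in> Mor C a b \<Longrightarrow> f \<cdot> ident C a = f"
    and comp_ident_left: "f \<in> Mor C a b \<Longrightarrow> ident C b \<cdot> f = f"
    and comp_assoc:
      "\<lbrakk>f \<in> Mor C a b; g \<in> Mor C b c; h \<in> Mor C c d\<rbrakk> \<Longrightarrow> (h \<cdot> g) \<cdot> f = h \<cdot> (g \<cdot> f)"

definition Iso :: "('o, 'm, 'x) cat_scheme \<Rightarrow> 'o \<Rightarrow> 'o \<Rightarrow> 'm set" where
  "Iso C a b = {f \<in> Mor C a b. \<exists>g \<in> Mor C b a. g \<cdot>\<^bsub>C\<^esub> f = ident C a \<and> f \<cdot>\<^bsub>C\<^esub> g = ident C b}"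

definition is_functor ::
  "('o, 'm, 'x) cat_scheme \<Rightarrow> ('p, 'n, 'y) cat_scheme \<Rightarrow> ('o \<Rightarrow> 'p) \<Rightarrow> ('m \<Rightarrow> 'n) \<Rightarrow> bool" where
  "is_functor C D Fo Fm \<longleftrightarrow>
     (\<forall>a \<in> obj C. Fo a \<in> obj D \<and> Fm (ident C a) = ident D (Fo a)) \<and>
     (\<forall>a b. \<forall>f \<in> Mor C a b. Fm f \<in> Mor D (Fo a) (Fo b)) \<and>
     (\<forall>a b c. \<forall>f \<in> Mor C a b. \<forall>g \<in> Mor C b c. Fm (g \<cdot>\<^bsub>C\<^esub> f) = Fm g \<cdot>\<^bsub>D\<^esub> Fm f)"

definition is_contravariant_functor ::
  "('o, 'm, 'x) cat_scheme \<Rightarrow> ('p, 'n, 'y) cat_scheme \<Rightarrow> ('o \<Rightarrow> 'p) \<Rightarrow> ('m \<Rightarrow> 'n) \<Rightarrow> bool" where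
  "is_contravariant_functor C D Fo Fm \<longleftrightarrow>
     (\<forall>a \<in> obj C. Fo a \<in> obj D \<and> Fm (ident C a) = ident D (Fo a)) \<and>
     (\<forall>a b. \<forall>f \<in> Mor C a b. Fm f \<in> Mor D (Fo b) (Fo a)) \<and>
     (\<forall>a b c. \<forall>f \<in> Mor C a b. \<forall>g \<in> Mor C b c. Fm (g \<cdot>\<^bsub>C\<^esub> f) = Fm f \<cdot>\<^bsub>D\<^esub> Fm g)"

definition idempotent_complete :: "('o, 'm, 'x) cat_scheme \<Rightarrow> bool" where
  "idempotent_complete C \<longleftrightarrow>
     (\<forall>a \<in> obj C. \<forall>e \<in> Mor C a a. e \<cdot>\<^bsub>C\<^esub> e = e \<longrightarrow>
        (\<exists>b \<in> obj C. \<exists>p \<in> Mor C a b. \<exists>i \<in> Mor C b a.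
           i \<cdot>\<^bsub>C\<^esub> p = e \<and> p \<cdot>\<^bsub>C\<^esub> i = ident C b))"


section \<open>Additive categories\<close>

record ('o, 'm) additive_cat = "('o, 'm) cat" +
  madd :: "'m \<Rightarrow> 'm \<Rightarrow> 'm"
  mzero :: "'o \<Rightarrow> 'o \<Rightarrow> 'm"

definition Mor_group :: "('o, 'm, 'x) additive_cat_scheme \<Rightarrow> 'o \<Rightarrow> 'o \<Rightarrow> 'm monoid" where
  "Mor_group C a b = \<lparr>carrier = Mor C a b, mult = madd C, one = mzero C a b\<rparr>"

definition mneg :: "('o, 'm, 'x) additive_cat_scheme \<Rightarrow> 'm \<Rightarrow> 'm" where
  "mneg C f = inv\<^bsub>Mor_group C (src C f) (tgt C f)\<^esub> f"

definition is_zero_object :: "('o, 'm, 'x) cat_scheme \<Rightarrow> 'o \<Rightarrow> bool" where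
  "is_zero_object C z \<longleftrightarrow>
     z \<in> obj C \<and> (\<forall>a \<in> obj C. (\<exists>!f. f \<in> Mor C a z) \<and> (\<exists>!f. f \<in> Mor C z a))"

definition is_direct_sum ::
  "('o, 'm, 'x) additive_cat_scheme \<Rightarrow> 'o \<Rightarrow> 'o \<Rightarrow> 'o \<Rightarrow> bool" where
  "is_direct_sum C a b c \<longleftrightarrow>
     a \<in> obj C \<and> b \<in> obj C \<and> c \<in> obj C \<and>
     (\<exists>i \<in> Mor C a c. \<exists>j \<in> Mor C b c. \<exists>p \<in> Mor C c a. \<exists>q \<in> Mor C c b.
        p \<cdot>\<^bsub>C\<^esub> i = ident C a \<and> q \<cdot>\<^bsub>C\<^esub> j = ident C b \<and>
        p \<cdot>\<^bsub>C\<^esub> j = mzero C b a \<and> q \<cdot>\<^bsub>C\<^esub> i = mzero C a b \<and>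
        madd C (i \<cdot>\<^bsub>C\<^esub> p) (j \<cdot>\<^bsub>C\<^esub> q) = ident C c)"

locale additive_category = category C
  for C :: "('o, 'm, 'x) additive_cat_scheme" (structure) +
  assumes Mor_comm_group:
      "\<lbrakk>a \<in> obj C; b \<in> obj C\<rbrakk> \<Longrightarrow> comm_group (Mor_group C a b)"
    and comp_madd_left:
      "\<lbrakk>f \<in> Mor C a b; f' \<in> Mor C a b; g \<in> Mor C b c\<rbrakk>
         \<Longrightarrow> g \<cdot> madd C f f' = madd C (g \<cdot> f) (g \<cdot> f')"
    and comp_madd_right:
      "\<lbrakk>f \<in> Mor C a b; g \<in> Mor C b c; g' \<in> Mor C b c\<rbrakk>
         \<Longrightarrow> madd C g g' \<cdot> f = madd C (g \<cdot> f) (g' \<cdot> f)"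
    and ex_zero_object: "\<exists>z. is_zero_object C z"
    and ex_direct_sum: "\<lbrakk>a \<in> obj C; b \<in> obj C\<rbrakk> \<Longrightarrow> \<exists>c. is_direct_sum C a b c"

text \<open>Preservation of sums of parallel arrows; used for functors of either variance.\<close>

definition additive_on_Mor ::
  "('o, 'm, 'x) additive_cat_scheme \<Rightarrow> ('p, 'n, 'y) additive_cat_scheme \<Rightarrow> ('m \<Rightarrow> 'n) \<Rightarrow> bool" where
  "additive_on_Mor C D Fm \<longleftrightarrow>
     (\<forall>a b. \<forall>f \<in> Mor C a b. \<forall>g \<in> Mor C a b. Fm (madd C f g) = madd D (Fm f) (Fm g))"


section \<open>Triangulated categories\<close>

record ('o, 'm) triangulated_cat = "('o, 'm) additive_cat" +
  susp :: "'o \<Rightarrow> 'o"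
  suspm :: "'m \<Rightarrow> 'm"
  dist :: "('m \<times> 'm \<times> 'm) set"

definition is_triangle ::
  "('o, 'm, 'x) triangulated_cat_scheme \<Rightarrow> 'm \<Rightarrow> 'm \<Rightarrow> 'm \<Rightarrow> bool" where
  "is_triangle C f g h \<longleftrightarrow>
     f \<in> arr C \<and> g \<in> Mor C (tgt C f) (tgt C g) \<and> h \<in> Mor C (tgt C g) (susp C (src C f))"

text \<open>The suspension is an additive self-equivalence, not necessarily an automorphism.\<close>

locale triangulated_category = additive_category C
  for C :: "('o, 'm, 'x) triangulated_cat_scheme" (structure) +
  assumes susp_functor: "is_functor C C (susp C) (suspm C)"
    and susp_additive: "additive_on_Mor C C (suspm C)"
    and susp_fully_faithful:
      "\<lbrakk>a \<in> obj C; b \<in> obj C\<rbrakk>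
         \<Longrightarrow> bij_betw (suspm C) (Mor C a b) (Mor C (susp C a) (susp C b))"
    and susp_ess_surj: "b \<in> obj C \<Longrightarrow> \<exists>a \<in> obj C. Iso C (susp C a) b \<noteq> {}"
    and dist_triangle: "(f, g, h) \<in> dist C \<Longrightarrow> is_triangle C f g h"
    and TR1_iso:
      "\<lbrakk>(f, g, h) \<in> dist C; is_triangle C f' g' h';
        u \<in> Iso C (src C f) (src C f'); v \<in> Iso C (tgt C f) (tgt C f');
        w \<in> Iso C (tgt C g) (tgt C g');
        v \<cdot> f = f' \<cdot> u; w \<cdot> g = g' \<cdot> v; suspm C u \<cdot> h = h' \<cdot> w\<rbrakk>
         \<Longrightarrow> (f', g', h') \<in> dist C"
    and TR1_ident:
      "\<lbrakk>a \<in> obj C; is_zero_object C z\<rbrakk>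
         \<Longrightarrow> (ident C a, mzero C a z, mzero C z (susp C a)) \<in> dist C"
    and TR1_cone: "f \<in> arr C \<Longrightarrow> \<exists>g h. (f, g, h) \<in> dist C"
    and TR2:
      "is_triangle C f g h
         \<Longrightarrow> (f, g, h) \<in> dist C \<longleftrightarrow> (g, h, mneg C (suspm C f)) \<in> dist C"
    and TR3:
      "\<lbrakk>(f, g, h) \<in> dist C; (f', g', h') \<in> dist C;
        u \<in> Mor C (src C f) (src C f'); v \<in> Mor C (tgt C f) (tgt C f'); v \<cdot> f = f' \<cdot> u\<rbrakk>
         \<Longrightarrow> \<exists>w \<in> Mor C (tgt C g) (tgt C g'). w \<cdot> g = g' \<cdot> v \<and> suspm C u \<cdot> h = h' \<cdot> w"
    and TR4:
      "\<lbrakk>(f, f1, f2) \<in> dist C; (g, g1, g2) \<in> dist C; tgt C f = src C g;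
        (g \<cdot> f, h1, h2) \<in> dist C\<rbrakk>
         \<Longrightarrow> \<exists>u \<in> Mor C (tgt C f1) (tgt C h1). \<exists>v \<in> Mor C (tgt C h1) (tgt C g1).
               (u, v, suspm C f1 \<cdot> g2) \<in> dist C \<and>
               u \<cdot> f1 = h1 \<cdot> g \<and> h2 \<cdot> u = f2 \<and> v \<cdot> h1 = g1 \<and> g2 \<cdot> v = suspm C f \<cdot> h2"

text \<open>An exact functor together with its isomorphism \<open>\<theta>\<^sub>a : F (T a) \<rightarrow> T (F a)\<close>.\<close>

definition exact_functor ::
  "('o, 'm, 'x) triangulated_cat_scheme \<Rightarrow> ('p, 'n, 'y) triangulated_cat_scheme
    \<Rightarrow> ('o \<Rightarrow> 'p) \<Rightarrow> ('m \<Rightarrow> 'n) \<Rightarrow> ('o \<Rightarrow> 'n) \<Rightarrow> bool" where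
  "exact_functor C D Fo Fm \<theta> \<longleftrightarrow>
     is_functor C D Fo Fm \<and> additive_on_Mor C D Fm \<and>
     (\<forall>a \<in> obj C. \<theta> a \<in> Iso D (Fo (susp C a)) (susp D (Fo a))) \<and>
     (\<forall>a b. \<forall>f \<in> Mor C a b. \<theta> b \<cdot>\<^bsub>D\<^esub> Fm (suspm C f) = suspm D (Fm f) \<cdot>\<^bsub>D\<^esub> \<theta> a) \<and>
     (\<forall>f g h. (f, g, h) \<in> dist C \<longrightarrow> (Fm f, Fm g, \<theta> (src C f) \<cdot>\<^bsub>D\<^esub> Fm h) \<in> dist D)"

text \<open>
  An exact functor on the opposite category, whose suspension is a quasi-inverse of \<open>T\<close>: the
  commutation isomorphism \<open>F a \<cong> T (F (T a))\<close> is written without choosing that quasi-inverse.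
  It is only ever quantified existentially, so the sign convention for triangles in the opposite
  category (which replaces \<open>\<theta>\<close> by \<open>-\<theta>\<close>) is immaterial.
\<close>

definition exact_contravariant_functor ::
  "('o, 'm, 'x) triangulated_cat_scheme \<Rightarrow> ('p, 'n, 'y) triangulated_cat_scheme
    \<Rightarrow> ('o \<Rightarrow> 'p) \<Rightarrow> ('m \<Rightarrow> 'n) \<Rightarrow> ('o \<Rightarrow> 'n) \<Rightarrow> bool" where
  "exact_contravariant_functor C D Fo Fm \<theta> \<longleftrightarrow>
     is_contravariant_functor C D Fo Fm \<and> additive_on_Mor C D Fm \<and>
     (\<forall>a \<in> obj C. \<theta> a \<in> Iso D (Fo a) (susp D (Fo (susp C a)))) \<and>
     (\<forall>a b. \<forall>f \<in> Mor C a b. \<theta> a \<cdot>\<^bsub>D\<^esub> Fm f = suspm D (Fm (suspm C f)) \<cdot>\<^bsub>D\<^esub> \<theta> b) \<and>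
     (\<forall>f g h. (f, g, h) \<in> dist C \<longrightarrow> (Fm h, Fm g, \<theta> (src C f) \<cdot>\<^bsub>D\<^esub> Fm f) \<in> dist D)"


section \<open>Tensor triangulated categories\<close>

text \<open>
  \<open>suspl a b : T a \<otimes> b \<rightarrow> T (a \<otimes> b)\<close> and \<open>suspr a b : a \<otimes> T b \<rightarrow> T (a \<otimes> b)\<close> are the commutation
  isomorphisms belonging to the exact functors \<open>- \<otimes> b\<close> and \<open>a \<otimes> -\<close>. The tensor product of
  arrows is written \<open>\<boxtimes>\<close>.
\<close>

record ('o, 'm) tt_cat = "('o, 'm) triangulated_cat" +
  tensor :: "'o \<Rightarrow> 'o \<Rightarrow> 'o" (infixl "\<otimes>\<index>" 70)
  tensorm :: "'m \<Rightarrow> 'm \<Rightarrow> 'm" (infixl "\<boxtimes>\<index>" 70)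
  tunit :: "'o"
  assoc :: "'o \<Rightarrow> 'o \<Rightarrow> 'o \<Rightarrow> 'm"
  lunit :: "'o \<Rightarrow> 'm"
  runit :: "'o \<Rightarrow> 'm"
  braid :: "'o \<Rightarrow> 'o \<Rightarrow> 'm"
  suspl :: "'o \<Rightarrow> 'o \<Rightarrow> 'm"
  suspr :: "'o \<Rightarrow> 'o \<Rightarrow> 'm"

locale tensor_triangulated_category = triangulated_category K
  for K :: "('o, 'm, 'x) tt_cat_scheme" (structure) +
  assumes tensor_obj: "\<lbrakk>a \<in> obj K; b \<in> obj K\<rbrakk> \<Longrightarrow> a \<otimes> b \<in> obj K"
    and tensorm_Mor: "\<lbrakk>f \<in> Mor K a b; g \<in> Mor K c d\<rbrakk> \<Longrightarrow> f \<boxtimes> g \<in> Mor K (a \<otimes> c) (b \<otimes> d)"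
    and tensorm_ident:
      "\<lbrakk>a \<in> obj K; b \<in> obj K\<rbrakk> \<Longrightarrow> ident K a \<boxtimes> ident K b = ident K (a \<otimes> b)"
    and tensorm_comp:
      "\<lbrakk>f \<in> Mor K a b; f' \<in> Mor K b c; g \<in> Mor K d e; g' \<in> Mor K e k\<rbrakk>
         \<Longrightarrow> (f' \<cdot> f) \<boxtimes> (g' \<cdot> g) = (f' \<boxtimes> g') \<cdot> (f \<boxtimes> g)"
    and tunit_obj: "tunit K \<in> obj K"
    and assoc_Iso:
      "\<lbrakk>a \<in> obj K; b \<in> obj K; c \<in> obj K\<rbrakk>
         \<Longrightarrow> assoc K a b c \<in> Iso K ((a \<otimes> b) \<otimes> c) (a \<otimes> (b \<otimes> c))"
    and assoc_natural:
      "\<lbrakk>f \<in> Mor K a a'; g \<in> Mor K b b'; h \<in> Mor K c c'\<rbrakk>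
         \<Longrightarrow> assoc K a' b' c' \<cdot> ((f \<boxtimes> g) \<boxtimes> h) = (f \<boxtimes> (g \<boxtimes> h)) \<cdot> assoc K a b c"
    and lunit_Iso: "a \<in> obj K \<Longrightarrow> lunit K a \<in> Iso K (tunit K \<otimes> a) a"
    and lunit_natural:
      "f \<in> Mor K a b \<Longrightarrow> lunit K b \<cdot> (ident K (tunit K) \<boxtimes> f) = f \<cdot> lunit K a"
    and runit_Iso: "a \<in> obj K \<Longrightarrow> runit K a \<in> Iso K (a \<otimes> tunit K) a"
    and runit_natural:
      "f \<in> Mor K a b \<Longrightarrow> runit K b \<cdot> (f \<boxtimes> ident K (tunit K)) = f \<cdot> runit K a"
    and braid_Mor: "\<lbrakk>a \<in> obj K; b \<in> obj K\<rbrakk> \<Longrightarrow> braid K a b \<in> Mor K (a \<otimes> b) (b \<otimes> a)"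
    and braid_natural:
      "\<lbrakk>f \<in> Mor K a a'; g \<in> Mor K b b'\<rbrakk>
         \<Longrightarrow> braid K a' b' \<cdot> (f \<boxtimes> g) = (g \<boxtimes> f) \<cdot> braid K a b"
    and braid_symmetry:
      "\<lbrakk>a \<in> obj K; b \<in> obj K\<rbrakk> \<Longrightarrow> braid K b a \<cdot> braid K a b = ident K (a \<otimes> b)"
    and pentagon:
      "\<lbrakk>a \<in> obj K; b \<in> obj K; c \<in> obj K; d \<in> obj K\<rbrakk>
         \<Longrightarrow> (ident K a \<boxtimes> assoc K b c d) \<cdot> assoc K a (b \<otimes> c) d \<cdot> (assoc K a b c \<boxtimes> ident K d)
           = assoc K a b (c \<otimes> d) \<cdot> assoc K (a \<otimes> b) c d"
    and triangle:
      "\<lbrakk>a \<in> obj K; b \<in> obj K\<rbrakk>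
         \<Longrightarrow> (ident K a \<boxtimes> lunit K b) \<cdot> assoc K a (tunit K) b = runit K a \<boxtimes> ident K b"
    and hexagon:
      "\<lbrakk>a \<in> obj K; b \<in> obj K; c \<in> obj K\<rbrakk>
         \<Longrightarrow> assoc K b c a \<cdot> braid K a (b \<otimes> c) \<cdot> assoc K a b c
           = (ident K b \<boxtimes> braid K a c) \<cdot> assoc K b a c \<cdot> (braid K a b \<boxtimes> ident K c)"
    and tensor_exact_right:
      "a \<in> obj K \<Longrightarrow> exact_functor K K (\<lambda>b. a \<otimes> b) (\<lambda>f. ident K a \<boxtimes> f) (\<lambda>b. suspr K a b)"
    and tensor_exact_left:
      "b \<in> obj K \<Longrightarrow> exact_functor K K (\<lambda>a. a \<otimes> b) (\<lambda>f. f \<boxtimes> ident K b) (\<lambda>a. suspl K a b)"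
    and susp_anticommute:
      "\<lbrakk>a \<in> obj K; b \<in> obj K\<rbrakk>
         \<Longrightarrow> suspm K (suspl K a b) \<cdot> suspr K (susp K a) b
           = mneg K (suspm K (suspr K a b) \<cdot> suspl K a (susp K b))"

definition inverse_arr :: "('o, 'm, 'x) cat_scheme \<Rightarrow> 'm \<Rightarrow> 'm" where
  "inverse_arr C f = (THE g. g \<in> Mor C (tgt C f) (src C f) \<and>
     g \<cdot>\<^bsub>C\<^esub> f = ident C (src C f) \<and> f \<cdot>\<^bsub>C\<^esub> g = ident C (tgt C f))"

text \<open>
  The internal hom functor is given by \<open>H\<close> on objects and \<open>Hm\<close> on arrows, and
  \<open>\<Phi> a b c : Mor (a \<otimes> b) c \<rightarrow> Mor a (H b c)\<close> is the adjunction.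
\<close>

definition internal_hom_functor ::
  "('o, 'm, 'x) tt_cat_scheme \<Rightarrow> ('o \<Rightarrow> 'o \<Rightarrow> 'o) \<Rightarrow> ('m \<Rightarrow> 'm \<Rightarrow> 'm) \<Rightarrow> bool" where
  "internal_hom_functor K H Hm \<longleftrightarrow>
     (\<forall>a \<in> obj K. \<forall>b \<in> obj K. H a b \<in> obj K \<and> Hm (ident K a) (ident K b) = ident K (H a b)) \<and>
     (\<forall>a a' b b'. \<forall>f \<in> Mor K a' a. \<forall>g \<in> Mor K b b'. Hm f g \<in> Mor K (H a b) (H a' b')) \<and>
     (\<forall>a a' a'' b b' b''.
        \<forall>f \<in> Mor K a' a. \<forall>f' \<in> Mor K a'' a'. \<forall>g \<in> Mor K b b'. \<forall>g' \<in> Mor K b' b''.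
          Hm (f \<cdot>\<^bsub>K\<^esub> f') (g' \<cdot>\<^bsub>K\<^esub> g) = Hm f' g' \<cdot>\<^bsub>K\<^esub> Hm f g) \<and>
     (\<forall>a \<in> obj K. \<exists>\<theta>. exact_functor K K (\<lambda>b. H a b) (\<lambda>g. Hm (ident K a) g) \<theta>) \<and>
     (\<forall>b \<in> obj K. \<exists>\<theta>. exact_contravariant_functor K K (\<lambda>a. H a b) (\<lambda>f. Hm f (ident K b)) \<theta>)"

definition tensor_hom_adjunction ::
  "('o, 'm, 'x) tt_cat_scheme \<Rightarrow> ('o \<Rightarrow> 'o \<Rightarrow> 'o) \<Rightarrow> ('m \<Rightarrow> 'm \<Rightarrow> 'm)
    \<Rightarrow> ('o \<Rightarrow> 'o \<Rightarrow> 'o \<Rightarrow> 'm \<Rightarrow> 'm) \<Rightarrow> bool" where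
  "tensor_hom_adjunction K H Hm \<Phi> \<longleftrightarrow>
     (\<forall>a \<in> obj K. \<forall>b \<in> obj K. \<forall>c \<in> obj K.
        bij_betw (\<Phi> a b c) (Mor K (a \<otimes>\<^bsub>K\<^esub> b) c) (Mor K a (H b c))) \<and>
     (\<forall>a a' b b' c c'. \<forall>u \<in> Mor K a' a. \<forall>v \<in> Mor K b' b. \<forall>w \<in> Mor K c c'.
        \<forall>f \<in> Mor K (a \<otimes>\<^bsub>K\<^esub> b) c.
          \<Phi> a' b' c' (w \<cdot>\<^bsub>K\<^esub> f \<cdot>\<^bsub>K\<^esub> (u \<boxtimes>\<^bsub>K\<^esub> v)) = Hm v w \<cdot>\<^bsub>K\<^esub> \<Phi> a b c f \<cdot>\<^bsub>K\<^esub> u)"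

text \<open>The evaluation \<open>D a \<otimes> a \<rightarrow> 1\<close>, where \<open>D a = H a 1\<close>.\<close>

definition evaluation ::
  "('o, 'm, 'x) tt_cat_scheme \<Rightarrow> ('o \<Rightarrow> 'o \<Rightarrow> 'o) \<Rightarrow> ('o \<Rightarrow> 'o \<Rightarrow> 'o \<Rightarrow> 'm \<Rightarrow> 'm)
    \<Rightarrow> 'o \<Rightarrow> 'm" where
  "evaluation K H \<Phi> a =
     the_inv_into (Mor K (H a (tunit K) \<otimes>\<^bsub>K\<^esub> a) (tunit K)) (\<Phi> (H a (tunit K)) a (tunit K))
       (ident K (H a (tunit K)))"

text \<open>
  The natural morphism \<open>D a \<otimes> b \<rightarrow> H a b\<close>: the adjoint of
  \<open>(D a \<otimes> b) \<otimes> a \<cong> D a \<otimes> (b \<otimes> a) \<cong> D a \<otimes> (a \<otimes> b) \<cong> (D a \<otimes> a) \<otimes> b \<rightarrow> 1 \<otimes> b \<cong> b\<close>.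
\<close>

definition dual_tensor_to_hom ::
  "('o, 'm, 'x) tt_cat_scheme \<Rightarrow> ('o \<Rightarrow> 'o \<Rightarrow> 'o) \<Rightarrow> ('o \<Rightarrow> 'o \<Rightarrow> 'o \<Rightarrow> 'm \<Rightarrow> 'm)
    \<Rightarrow> 'o \<Rightarrow> 'o \<Rightarrow> 'm" where
  "dual_tensor_to_hom K H \<Phi> a b =
     (let Da = H a (tunit K) in
      \<Phi> (Da \<otimes>\<^bsub>K\<^esub> b) a b
        (lunit K b \<cdot>\<^bsub>K\<^esub> (evaluation K H \<Phi> a \<boxtimes>\<^bsub>K\<^esub> ident K b)
          \<cdot>\<^bsub>K\<^esub> inverse_arr K (assoc K Da a b)
          \<cdot>\<^bsub>K\<^esub> (ident K Da \<boxtimes>\<^bsub>K\<^esub> braid K b a) \<cdot>\<^bsub>K\<^esub> assoc K Da b a))"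

definition strongly_closed :: "('o, 'm, 'x) tt_cat_scheme \<Rightarrow> bool" where
  "strongly_closed K \<longleftrightarrow>
     (\<exists>H Hm \<Phi>. internal_hom_functor K H Hm \<and> tensor_hom_adjunction K H Hm \<Phi> \<and>
        (\<forall>a \<in> obj K. \<forall>b \<in> obj K.
           dual_tensor_to_hom K H \<Phi> a b \<in> Iso K (H a (tunit K) \<otimes>\<^bsub>K\<^esub> b) (H a b)))"


section \<open>The spectrum\<close>

text \<open>Full subcategories are represented by their sets of objects.\<close>

definition triangulated_subcategory :: "('o, 'm, 'x) triangulated_cat_scheme \<Rightarrow> 'o set \<Rightarrow> bool" where
  "triangulated_subcategory K P \<longleftrightarrow>
     P \<subseteq> obj K \<and> (\<forall>z. is_zero_object K z \<longrightarrow> z \<in> P) \<and>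
     (\<forall>a \<in> P. \<forall>b \<in> obj K. Iso K a b \<noteq> {} \<longrightarrow> b \<in> P) \<and>
     (\<forall>a \<in> obj K. susp K a \<in> P \<longleftrightarrow> a \<in> P) \<and>
     (\<forall>f g h. (f, g, h) \<in> dist K \<longrightarrow> src K f \<in> P \<longrightarrow> tgt K f \<in> P \<longrightarrow> tgt K g \<in> P)"

definition prime_ideal :: "('o, 'm, 'x) tt_cat_scheme \<Rightarrow> 'o set \<Rightarrow> bool" where
  "prime_ideal K P \<longleftrightarrow>
     triangulated_subcategory K P \<and> P \<noteq> obj K \<and>
     (\<forall>a b c. is_direct_sum K a b c \<longrightarrow> c \<in> P \<longrightarrow> a \<in> P \<and> b \<in> P) \<and>
     (\<forall>a \<in> P. \<forall>b \<in> obj K. a \<otimes>\<^bsub>K\<^esub> b \<in> P) \<and>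
     (\<forall>a \<in> obj K. \<forall>b \<in> obj K. a \<otimes>\<^bsub>K\<^esub> b \<in> P \<longrightarrow> a \<in> P \<or> b \<in> P)"

definition Spc :: "('o, 'm, 'x) tt_cat_scheme \<Rightarrow> 'o set set" where
  "Spc K = {P. prime_ideal K P}"

definition supp :: "('o, 'm, 'x) tt_cat_scheme \<Rightarrow> 'o \<Rightarrow> 'o set set" where
  "supp K a = {P \<in> Spc K. a \<notin> P}"

text \<open>
  The generating sets are closed under finite intersections (direct sums) and contain \<open>Spc K\<close>
  (zero objects), so they form a basis of the generated topology.
\<close>

definition Spc_topology :: "('o, 'm, 'x) tt_cat_scheme \<Rightarrow> 'o set topology" where
  "Spc_topology K = topology_generated_by {Spc K - supp K a |a. a \<in> obj K}"

text \<open>\<open>compactin\<close> does not include a separation axiom.\<close>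

definition quasi_compact_open :: "('o, 'm, 'x) tt_cat_scheme \<Rightarrow> 'o set set \<Rightarrow> bool" where
  "quasi_compact_open K U \<longleftrightarrow> openin (Spc_topology K) U \<and> compactin (Spc_topology K) U"

definition supported_on :: "('o, 'm, 'x) tt_cat_scheme \<Rightarrow> 'o set set \<Rightarrow> 'o set" where
  "supported_on K Y = {a \<in> obj K. supp K a \<subseteq> Y}"


section \<open>Verdier quotients\<close>

text \<open>
  Arrows \<open>a \<rightarrow> b\<close> of \<open>K/J\<close> are classes of roofs \<open>a \<leftarrow>s- c -f\<rightarrow> b\<close>, encoded as \<open>(s, f)\<close>, where the
  cone of \<open>s\<close> lies in \<open>J\<close>. The class carries its source and target objects with it.
\<close>

definition cone_in :: "('o, 'm, 'x) triangulated_cat_scheme \<Rightarrow> 'o set \<Rightarrow> 'm set" where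
  "cone_in K J = {s. \<exists>g h. (s, g, h) \<in> dist K \<and> tgt K g \<in> J}"

definition roofs ::
  "('o, 'm, 'x) triangulated_cat_scheme \<Rightarrow> 'o set \<Rightarrow> 'o \<Rightarrow> 'o \<Rightarrow> ('m \<times> 'm) set" where
  "roofs K J a b = {(s, f). s \<in> cone_in K J \<and> s \<in> Mor K (src K s) a \<and> f \<in> Mor K (src K s) b}"

definition roof_rel ::
  "('o, 'm, 'x) triangulated_cat_scheme \<Rightarrow> 'o set \<Rightarrow> 'o \<Rightarrow> 'o \<Rightarrow> (('m \<times> 'm) \<times> ('m \<times> 'm)) set" where
  "roof_rel K J a b =
     {((s, f), (s', f')). (s, f) \<in> roofs K J a b \<and> (s', f') \<in> roofs K J a b \<and>
        (\<exists>d. \<exists>u \<in> Mor K d (src K s). \<exists>u' \<in> Mor K d (src K s').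
           s \<cdot>\<^bsub>K\<^esub> u = s' \<cdot>\<^bsub>K\<^esub> u' \<and> s \<cdot>\<^bsub>K\<^esub> u \<in> cone_in K J \<and> f \<cdot>\<^bsub>K\<^esub> u = f' \<cdot>\<^bsub>K\<^esub> u')}"

type_synonym ('o, 'm) frac = "'o \<times> 'o \<times> ('m \<times> 'm) set"

definition frac ::
  "('o, 'm, 'x) triangulated_cat_scheme \<Rightarrow> 'o set \<Rightarrow> 'm \<Rightarrow> 'm \<Rightarrow> ('o, 'm) frac" where
  "frac K J s f = (tgt K s, tgt K f, roof_rel K J (tgt K s) (tgt K f) `` {(s, f)})"

text \<open>
  The composite of \<open>a \<leftarrow>s- \<bullet> -f\<rightarrow> b\<close> and \<open>b \<leftarrow>t- \<bullet> -g\<rightarrow> c\<close> is the class of \<open>(s w, g h)\<close>, where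
  \<open>f w = t h\<close> and the cone of \<open>w\<close> lies in \<open>J\<close>. It is written as the union over all choices of
  representatives and of \<open>w\<close>, \<open>h\<close>.
\<close>

definition frac_comp ::
  "('o, 'm, 'x) triangulated_cat_scheme \<Rightarrow> 'o set
    \<Rightarrow> ('o, 'm) frac \<Rightarrow> ('o, 'm) frac \<Rightarrow> ('o, 'm) frac" where
  "frac_comp K J = (\<lambda>(b', c, Y) (a, b, X).
     (a, c, roof_rel K J a c ``
        {(s \<cdot>\<^bsub>K\<^esub> w, g \<cdot>\<^bsub>K\<^esub> h) |s f t g w h.
           (s, f) \<in> X \<and> (t, g) \<in> Y \<and> w \<in> cone_in K J \<and>
           w \<in> Mor K (src K w) (src K s) \<and> h \<in> Mor K (src K w) (src K t) \<and>
           f \<cdot>\<^bsub>K\<^esub> w = t \<cdot>\<^bsub>K\<^esub> h}))"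

definition verdier_quotient ::
  "('o, 'm, 'x) triangulated_cat_scheme \<Rightarrow> 'o set \<Rightarrow> ('o, ('o, 'm) frac) cat" where
  "verdier_quotient K J =
     \<lparr>obj = obj K,
      arr = {(a, b, X). a \<in> obj K \<and> b \<in> obj K \<and> X \<in> roofs K J a b // roof_rel K J a b},
      src = (\<lambda>(a, b, X). a),
      tgt = (\<lambda>(a, b, X). b),
      ident = (\<lambda>a. frac K J (ident K a) (ident K a)),
      comp = frac_comp K J\<rparr>"

text \<open>
  The localization functor \<open>K \<rightarrow> K/J\<close> and, for \<open>J \<subseteq> J'\<close>, the induced functor \<open>K/J \<rightarrow> K/J'\<close>.
  Both are the identity on objects.
\<close>

definition localize_arr ::
  "('o, 'm, 'x) triangulated_cat_scheme \<Rightarrow> 'o set \<Rightarrow> 'm \<Rightarrow> ('o, 'm) frac" where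
  "localize_arr K J f = frac K J (ident K (src K f)) f"

definition further_localize_arr ::
  "('o, 'm, 'x) triangulated_cat_scheme \<Rightarrow> 'o set \<Rightarrow> ('o, 'm) frac \<Rightarrow> ('o, 'm) frac" where
  "further_localize_arr K J' = (\<lambda>(a, b, X). (a, b, roof_rel K J' a b `` X))"


section \<open>Idempotent completion\<close>

definition idempotent_completion ::
  "('o, 'm, 'x) cat_scheme \<Rightarrow> ('o \<times> 'm, ('o \<times> 'm) \<times> ('o \<times> 'm) \<times> 'm) cat" where
  "idempotent_completion C =
     (let Ob = {(a, e). a \<in> obj C \<and> e \<in> Mor C a a \<and> e \<cdot>\<^bsub>C\<^esub> e = e} in
      \<lparr>obj = Ob,
       arr = {(x, y, f). x \<in> Ob \<and> y \<in> Ob \<and> f \<in> Mor C (fst x) (fst y) \<and>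
                snd y \<cdot>\<^bsub>C\<^esub> f \<cdot>\<^bsub>C\<^esub> snd x = f},
       src = (\<lambda>(x, y, f). x),
       tgt = (\<lambda>(x, y, f). y),
       ident = (\<lambda>x. (x, x, snd x)),
       comp = (\<lambda>(y', z, g) (x, y, f). (x, z, g \<cdot>\<^bsub>C\<^esub> f))\<rparr>)"


section \<open>The categories over open subsets\<close>

type_synonym ('o, 'm) local_obj = "'o \<times> ('o, 'm) frac"
type_synonym ('o, 'm) local_arr =
  "('o, 'm) local_obj \<times> ('o, 'm) local_obj \<times> ('o, 'm) frac"

definition ideal_off :: "('o, 'm, 'x) tt_cat_scheme \<Rightarrow> 'o set set \<Rightarrow> 'o set" where
  "ideal_off K U = supported_on K (Spc K - U)"

text \<open>\<open>L_on K U\<close> is \<open>\<L>(U)\<close> and \<open>K_on K U\<close> is \<open>\<K>(U)\<close>.\<close>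

definition L_on :: "('o, 'm, 'x) tt_cat_scheme \<Rightarrow> 'o set set \<Rightarrow> ('o, ('o, 'm) frac) cat" where
  "L_on K U = verdier_quotient K (ideal_off K U)"

definition K_on ::
  "('o, 'm, 'x) tt_cat_scheme \<Rightarrow> 'o set set \<Rightarrow> (('o, 'm) local_obj, ('o, 'm) local_arr) cat" where
  "K_on K U = idempotent_completion (L_on K U)"

text \<open>The canonical functor \<open>\<rho>\<^sub>U : \<K> \<rightarrow> \<K>(U)\<close>.\<close>

definition rho_obj :: "('o, 'm, 'x) tt_cat_scheme \<Rightarrow> 'o set set \<Rightarrow> 'o \<Rightarrow> ('o, 'm) local_obj" where
  "rho_obj K U a = (a, ident (L_on K U) a)"

definition rho_arr :: "('o, 'm, 'x) tt_cat_scheme \<Rightarrow> 'o set set \<Rightarrow> 'm \<Rightarrow> ('o, 'm) local_arr" where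
  "rho_arr K U f =
     (rho_obj K U (src K f), rho_obj K U (tgt K f), localize_arr K (ideal_off K U) f)"

text \<open>
  The restriction functor \<open>\<K>(V) \<rightarrow> \<K>(U)\<close> for \<open>U \<subseteq> V\<close>. The defining formulas depend on \<open>V\<close> only
  through their arguments, so \<open>V\<close> is not a parameter.
\<close>

definition res_obj ::
  "('o, 'm, 'x) tt_cat_scheme \<Rightarrow> 'o set set \<Rightarrow> ('o, 'm) local_obj \<Rightarrow> ('o, 'm) local_obj" where
  "res_obj K U = (\<lambda>(a, e). (a, further_localize_arr K (ideal_off K U) e))"

definition res_arr ::
  "('o, 'm, 'x) tt_cat_scheme \<Rightarrow> 'o set set \<Rightarrow> ('o, 'm) local_arr \<Rightarrow> ('o, 'm) local_arr" where
  "res_arr K U =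
     (\<lambda>(x, y, f). (res_obj K U x, res_obj K U y, further_localize_arr K (ideal_off K U) f))"

definition is_gluing ::
  "('o, 'm, 'x) tt_cat_scheme \<Rightarrow> 'o set set \<Rightarrow> 'o set set
    \<Rightarrow> ('o, 'm) local_obj \<Rightarrow> ('o, 'm) local_obj \<Rightarrow> ('o, 'm) local_arr
    \<Rightarrow> 'o \<Rightarrow> ('o, 'm) local_arr \<Rightarrow> ('o, 'm) local_arr \<Rightarrow> bool" where
  "is_gluing K U\<^sub>1 U\<^sub>2 a\<^sub>1 a\<^sub>2 \<sigma> a f\<^sub>1 f\<^sub>2 \<longleftrightarrow>
     a \<in> obj K \<and>
     f\<^sub>1 \<in> Iso (K_on K U\<^sub>1) (rho_obj K U\<^sub>1 a) a\<^sub>1 \<and>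
     f\<^sub>2 \<in> Iso (K_on K U\<^sub>2) (rho_obj K U\<^sub>2 a) a\<^sub>2 \<and>
     \<sigma> \<cdot>\<^bsub>K_on K (U\<^sub>1 \<inter> U\<^sub>2)\<^esub> res_arr K (U\<^sub>1 \<inter> U\<^sub>2) f\<^sub>1 = res_arr K (U\<^sub>1 \<inter> U\<^sub>2) f\<^sub>2"

end

theory Submission
  imports Defs
begin

text \<open>
  Let \<open>J\<^sub>i\<close> be the objects supported off \<open>U\<^sub>i\<close> and \<open>J\<^sub>1\<^sub>2\<close> those supported off \<open>U\<^sub>1 \<inter> U\<^sub>2\<close>. If
  \<open>x \<in> J\<^sub>1\<close> and \<open>y \<in> J\<^sub>2\<close>, then \<open>x \<otimes> y\<close> lies in every prime, hence vanishes, and by duality there are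
  no nonzero arrows between \<open>x\<close> and \<open>y\<close>. Consequently the sums of an object of \<open>J\<^sub>1\<close> and one of \<open>J\<^sub>2\<close>
  form a thick ideal; as the complements of the \<open>U\<^sub>i\<close> are supports of single objects, this ideal
  is all of \<open>J\<^sub>1\<^sub>2\<close>.

  Arrows over \<open>U\<^sub>1\<close> and \<open>U\<^sub>2\<close> that agree over \<open>U\<^sub>1 \<inter> U\<^sub>2\<close> are represented on the two corners of a
  homotopy pullback; their difference factors through \<open>J\<^sub>1\<^sub>2\<close>, splits into a part through \<open>J\<^sub>1\<close> and
  a part through \<open>J\<^sub>2\<close>, and can be absorbed into the representatives, so that the weak pushout
  property gives an arrow of \<open>\<K>\<close>. This lift is unique up to a square-zero error, whence uniqueness
  of gluings. An isomorphism over \<open>U\<^sub>1 \<inter> U\<^sub>2\<close> between objects of \<open>\<K>\<close> is a roof whose legs factor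
  into arrows with cones in \<open>J\<^sub>1\<close> and in \<open>J\<^sub>2\<close>; a homotopy pushout of the inner halves glues.
  For direct summands \<open>(c\<^sub>1, e\<^sub>1)\<close> and \<open>(c\<^sub>2, e\<^sub>2)\<close> one glues two copies of \<open>c\<^sub>1 \<oplus> c\<^sub>2\<close> along an
  involution exchanging \<open>e\<^sub>1\<close> and \<open>e\<^sub>2\<close>, and lifts the resulting compatible idempotents.
\<close>

text \<open>The obstacle is that fill-ins of triangles are not functorial, so local data cannot be
  glued by a universal property. Two consequences of orthogonality take its place. First, an arrow
  that dies over both \<open>U\<^sub>1\<close> and \<open>U\<^sub>2\<close> factors through
  \<open>J\<^sub>1\<close> and also through \<open>J\<^sub>2\<close>; a composite of two such arrows
  passes through an arrow from \<open>J\<^sub>1\<close> to \<open>J\<^sub>2\<close> and is zero.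
  This is why errors have square zero, and they can then be inverted away or removed from
  idempotents by a polynomial. Second, as arrows from \<open>J\<^sub>2\<close> to
  \<open>J\<^sub>1\<close> vanish, an arrow into an object of \<open>J\<^sub>1\<close> extends along
  every arrow whose cone lies in \<open>J\<^sub>2\<close>, and symmetrically; this is what allows
  the absorption into representatives. All triangles live in the given category, while the quotients
  carry only composition and addition. Duality also makes every thick ideal radical, so an ideal
  avoiding one prescribed object can be enlarged to a prime that still avoids it. Such primes detect
  nonzero objects and show that the sums exhaust \<open>J\<^sub>1\<^sub>2\<close>.\<close>

notation madd (infixl "\<oplus>\<index>" 55)
notation mneg ("\<ominus>\<index> _" [81] 80)

section \<open>Preadditive categories\<close>

context category
begin

lemma Mor_iff: "f \<in> Mor C a b \<longleftrightarrow> f \<in> arr C \<and> src C f = a \<and> tgt C f = b"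
  by (simp add: Mor_def)

lemma Mor_obj: "f \<in> Mor C a b \<Longrightarrow> a \<in> obj C \<and> b \<in> obj C"
  using src_obj tgt_obj by (auto simp: Mor_def)

lemma comp_arr [simp]:
  assumes "f \<in> arr C" "g \<in> arr C" "src C g = tgt C f"
  shows "g \<cdot> f \<in> arr C" "src C (g \<cdot> f) = src C f" "tgt C (g \<cdot> f) = tgt C g"
  using comp_Mor[of f "src C f" "tgt C f" g "tgt C g"] assms by (auto simp: Mor_def)

lemma ident_arr [simp]:
  assumes "a \<in> obj C"
  shows "ident C a \<in> arr C" "src C (ident C a) = a" "tgt C (ident C a) = a"
  using ident_Mor[OF assms] by (auto simp: Mor_def)

lemma comp_ident [simp]:
  assumes "f \<in> arr C"
  shows "src C f = a \<Longrightarrow> f \<cdot> ident C a = f" "tgt C f = a \<Longrightarrow> ident C a \<cdot> f = f"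
  using assms comp_ident_right comp_ident_left by (auto simp: Mor_def)

lemma comp_assoc_arr [simp]:
  assumes "f \<in> arr C" "g \<in> arr C" "h \<in> arr C" "src C g = tgt C f" "src C h = tgt C g"
  shows "(h \<cdot> g) \<cdot> f = h \<cdot> g \<cdot> f"
  using comp_assoc[of f "src C f" "tgt C f" g "tgt C g" h "tgt C h"] assms by (auto simp: Mor_def)

text \<open>Simplification associates composites to the right, which hides an equation between
  two-fold composites inside a longer one. This form and \<open>comp_eq_arr\<close> restate such an
  equation with a further arrow \<open>f\<close> applied first, and serve as ad hoc rewrite rules
  throughout.\<close>

lemma comp_eq_comp:
  assumes "h \<cdot> g = h' \<cdot> g'" "f \<in> arr C" "g \<in> arr C" "h \<in> arr C" "g' \<in> arr C" "h' \<in> arr C"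
    "src C g = tgt C f" "src C h = tgt C g" "src C g' = tgt C f" "src C h' = tgt C g'"
  shows "h \<cdot> g \<cdot> f = h' \<cdot> g' \<cdot> f"
  using assms by (metis comp_assoc_arr)

lemma comp_eq_arr:
  assumes "h \<cdot> g = k" "f \<in> arr C" "g \<in> arr C" "h \<in> arr C" "src C g = tgt C f" "src C h = tgt C g"
  shows "h \<cdot> g \<cdot> f = k \<cdot> f"
  using assms by (metis comp_assoc_arr)

lemma Iso_iff:
  "f \<in> Iso C a b \<longleftrightarrow>
     f \<in> Mor C a b \<and> (\<exists>g \<in> Mor C b a. g \<cdot> f = ident C a \<and> f \<cdot> g = ident C b)"
  by (simp add: Iso_def)

lemma Iso_ident: "a \<in> obj C \<Longrightarrow> ident C a \<in> Iso C a a"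
  by (auto simp: Iso_iff Mor_iff intro!: bexI[of _ "ident C a"])

lemma Iso_sym:
  assumes "f \<in> Iso C a b"
  shows "Iso C b a \<noteq> {}"
proof -
  from assms obtain g where "g \<in> Mor C b a" "g \<cdot> f = ident C a" "f \<cdot> g = ident C b"
    unfolding Iso_iff by (elim conjE bexE)
  then have "g \<in> Iso C b a" using assms by (auto simp: Iso_iff)
  then show ?thesis by blast
qed

end

text \<open>Common ground of the given category and its Verdier quotients, so that one arithmetic of
  arrows serves both. For the quotients it is established in \<open>L_preadditive\<close>.\<close>

locale preadditive_category = category C
  for C :: "('o, 'm, 'x) additive_cat_scheme" (structure) +
  assumes Mor_comm_group':
      "\<lbrakk>a \<in> obj C; b \<in> obj C\<rbrakk> \<Longrightarrow> comm_group (Mor_group C a b)"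
    and comp_madd_left':
      "\<lbrakk>f \<in> Mor C a b; f' \<in> Mor C a b; g \<in> Mor C b c\<rbrakk>
         \<Longrightarrow> g \<cdot> (f \<oplus> f') = g \<cdot> f \<oplus> g \<cdot> f'"
    and comp_madd_right':
      "\<lbrakk>f \<in> Mor C a b; g \<in> Mor C b c; g' \<in> Mor C b c\<rbrakk>
         \<Longrightarrow> (g \<oplus> g') \<cdot> f = g \<cdot> f \<oplus> g' \<cdot> f"

sublocale additive_category \<subseteq> preadditive_category
  by (intro preadditive_category.intro category_axioms preadditive_category_axioms.intro
      Mor_comm_group comp_madd_left comp_madd_right)

context preadditive_category
begin

lemma madd_arr [simp]:
  assumes "f \<in> arr C" "g \<in> arr C" "src C g = src C f" "tgt C g = tgt C f"
  shows "f \<oplus> g \<in> arr C" "src C (f \<oplus> g) = src C f" "tgt C (f \<oplus> g) = tgt C f"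
proof -
  interpret G: comm_group "Mor_group C (src C f) (tgt C f)"
    using assms src_obj tgt_obj Mor_comm_group' by auto
  have "f \<oplus> g \<in> Mor C (src C f) (tgt C f)"
    using G.m_closed[of f g] assms by (simp add: Mor_group_def Mor_iff)
  then show "f \<oplus> g \<in> arr C" "src C (f \<oplus> g) = src C f" "tgt C (f \<oplus> g) = tgt C f"
    by (auto simp: Mor_iff)
qed

lemma mzero_arr [simp]:
  assumes "a \<in> obj C" "b \<in> obj C"
  shows "mzero C a b \<in> arr C" "src C (mzero C a b) = a" "tgt C (mzero C a b) = b"
proof -
  interpret G: comm_group "Mor_group C a b"
    using assms Mor_comm_group' by auto
  have "mzero C a b \<in> Mor C a b"
    using G.one_closed by (simp add: Mor_group_def)
  then show "mzero C a b \<in> arr C" "src C (mzero C a b) = a" "tgt C (mzero C a b) = b"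
    by (auto simp: Mor_iff)
qed

lemma mneg_arr [simp]:
  assumes "f \<in> arr C"
  shows "\<ominus> f \<in> arr C" "src C (\<ominus> f) = src C f" "tgt C (\<ominus> f) = tgt C f"
proof -
  interpret G: comm_group "Mor_group C (src C f) (tgt C f)"
    using assms src_obj tgt_obj Mor_comm_group' by auto
  have "\<ominus> f \<in> Mor C (src C f) (tgt C f)"
    using G.inv_closed[of f] assms unfolding mneg_def by (simp add: Mor_group_def Mor_iff)
  then show "\<ominus> f \<in> arr C" "src C (\<ominus> f) = src C f" "tgt C (\<ominus> f) = tgt C f"
    by (auto simp: Mor_iff)
qed

lemma madd_assoc [simp]:
  assumes "f \<in> arr C" "g \<in> arr C" "h \<in> arr C" "src C g = src C f" "tgt C g = tgt C f"
    "src C h = src C f" "tgt C h = tgt C f"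
  shows "f \<oplus> g \<oplus> h = f \<oplus> (g \<oplus> h)"
proof -
  interpret G: comm_group "Mor_group C (src C f) (tgt C f)"
    using assms src_obj tgt_obj Mor_comm_group' by auto
  show ?thesis using G.m_assoc[of f g h] assms by (simp add: Mor_group_def Mor_iff)
qed

lemma madd_commute:
  assumes "f \<in> arr C" "g \<in> arr C" "src C g = src C f" "tgt C g = tgt C f"
  shows "f \<oplus> g = g \<oplus> f"
proof -
  interpret G: comm_group "Mor_group C (src C f) (tgt C f)"
    using assms src_obj tgt_obj Mor_comm_group' by auto
  show ?thesis using G.m_comm[of f g] assms by (simp add: Mor_group_def Mor_iff)
qed

lemma madd_left_commute:
  assumes "f \<in> arr C" "g \<in> arr C" "h \<in> arr C" "src C g = src C f" "tgt C g = tgt C f"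
    "src C h = src C f" "tgt C h = tgt C f"
  shows "f \<oplus> (g \<oplus> h) = g \<oplus> (f \<oplus> h)"
  using madd_commute[of f g] madd_assoc[of f g h] madd_assoc[of g f h] assms by simp

lemma madd_zero [simp]:
  assumes "f \<in> arr C" "src C f = a" "tgt C f = b"
  shows "f \<oplus> mzero C a b = f" "mzero C a b \<oplus> f = f"
proof -
  interpret G: comm_group "Mor_group C a b"
    using assms src_obj tgt_obj Mor_comm_group' by auto
  show "f \<oplus> mzero C a b = f" "mzero C a b \<oplus> f = f"
    using G.r_one[of f] G.l_one[of f] assms by (auto simp add: Mor_group_def Mor_iff)
qed

lemma madd_neg [simp]:
  assumes "f \<in> arr C"
  shows "f \<oplus> \<ominus> f = mzero C (src C f) (tgt C f)" "\<ominus> f \<oplus> f = mzero C (src C f) (tgt C f)"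
proof -
  interpret G: comm_group "Mor_group C (src C f) (tgt C f)"
    using assms src_obj tgt_obj Mor_comm_group' by auto
  show "f \<oplus> \<ominus> f = mzero C (src C f) (tgt C f)" "\<ominus> f \<oplus> f = mzero C (src C f) (tgt C f)"
    using G.r_inv[of f] G.l_inv[of f] assms unfolding mneg_def
    by (auto simp add: Mor_group_def Mor_iff)
qed

lemma madd_neg_cancel [simp]:
  assumes "f \<in> arr C" "g \<in> arr C" "src C g = src C f" "tgt C g = tgt C f"
  shows "f \<oplus> (\<ominus> f \<oplus> g) = g" "\<ominus> f \<oplus> (f \<oplus> g) = g"
  using assms madd_assoc[of f "\<ominus> f" g] madd_assoc[of "\<ominus> f" f g] by simp_all

lemma madd_neg_cancel_right [simp]:
  assumes "f \<in> arr C" "g \<in> arr C" "src C g = src C f" "tgt C g = tgt C f"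
  shows "f \<oplus> (g \<oplus> \<ominus> f) = g" "\<ominus> f \<oplus> (g \<oplus> f) = g"
  using assms by (simp_all add: madd_left_commute[of f g] madd_left_commute[of "\<ominus> f" g])

lemma mneg_eqI:
  assumes "f \<oplus> g = mzero C (src C f) (tgt C f)" "f \<in> arr C" "g \<in> arr C"
    "src C g = src C f" "tgt C g = tgt C f"
  shows "g = \<ominus> f"
  using madd_neg_cancel(2)[of f g] assms by simp

lemma mneg_mneg [simp]: "f \<in> arr C \<Longrightarrow> \<ominus> (\<ominus> f) = f"
  by (rule mneg_eqI[symmetric]) simp_all

lemma mneg_mzero [simp]: "a \<in> obj C \<Longrightarrow> b \<in> obj C \<Longrightarrow> \<ominus> (mzero C a b) = mzero C a b"
  using mneg_eqI[of "mzero C a b" "mzero C a b"] by simp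

lemma mneg_madd [simp]:
  assumes "f \<in> arr C" "g \<in> arr C" "src C g = src C f" "tgt C g = tgt C f"
  shows "\<ominus> (f \<oplus> g) = \<ominus> f \<oplus> \<ominus> g"
  by (rule mneg_eqI[symmetric]) (use assms in \<open>simp_all add: madd_left_commute[of g]\<close>)

lemma diff_eq_zero:
  assumes "f \<oplus> \<ominus> g = mzero C (src C f) (tgt C f)" "f \<in> arr C" "g \<in> arr C"
    "src C g = src C f" "tgt C g = tgt C f"
  shows "f = g"
proof -
  have "\<ominus> g = \<ominus> f" using mneg_eqI[of f "\<ominus> g"] assms by simp
  then have "\<ominus> (\<ominus> g) = \<ominus> (\<ominus> f)" by simp
  then show ?thesis using assms by simp
qed

lemma comp_add [simp]:
  assumes "f \<in> arr C" "f' \<in> arr C" "src C f' = src C f" "tgt C f' = tgt C f" "g \<in> arr C"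
  shows "src C g = tgt C f \<Longrightarrow> g \<cdot> (f \<oplus> f') = g \<cdot> f \<oplus> g \<cdot> f'"
    "src C f = tgt C g \<Longrightarrow> (f \<oplus> f') \<cdot> g = f \<cdot> g \<oplus> f' \<cdot> g"
  using comp_madd_left'[of f "src C f" "tgt C f" f' g "tgt C g"]
    comp_madd_right'[of g "src C g" "tgt C g" f "tgt C f" f'] assms by (auto simp: Mor_iff)

lemma comp_zero [simp]:
  assumes "f \<in> arr C" "a \<in> obj C"
  shows "src C f = b \<Longrightarrow> f \<cdot> mzero C a b = mzero C a (tgt C f)"
    "tgt C f = b \<Longrightarrow> mzero C b a \<cdot> f = mzero C (src C f) a"
proof -
  \<comment> \<open>An arrow equal to its own double is zero, and distributivity makes composites
    with zero arrows of this kind.\<close>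
  have idem: "g = mzero C (src C g) (tgt C g)" if "g \<in> arr C" "g \<oplus> g = g" for g
    using madd_neg_cancel(2)[of g g] that by simp
  show "f \<cdot> mzero C a b = mzero C a (tgt C f)" if "src C f = b"
  proof -
    have b: "b \<in> obj C" using src_obj assms(1) that by blast
    show ?thesis
      using idem[of "f \<cdot> mzero C a b"] comp_add(1)[of "mzero C a b" "mzero C a b" f] assms b that
      by simp
  qed
  show "mzero C b a \<cdot> f = mzero C (src C f) a" if "tgt C f = b"
  proof -
    have b: "b \<in> obj C" using tgt_obj assms(1) that by blast
    show ?thesis
      using idem[of "mzero C b a \<cdot> f"] comp_add(2)[of "mzero C b a" "mzero C b a" f] assms b that
      by simp
  qed
qed

lemma comp_neg [simp]:
  assumes "f \<in> arr C" "g \<in> arr C" "src C g = tgt C f"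
  shows "g \<cdot> \<ominus> f = \<ominus> (g \<cdot> f)" "\<ominus> g \<cdot> f = \<ominus> (g \<cdot> f)"
  by (rule mneg_eqI; use assms src_obj tgt_obj comp_add(1)[of f "\<ominus> f" g] comp_add(2)[of g "\<ominus> g" f]
      in simp)+

lemma zero_comp_cong:
  assumes "h \<cdot> g = mzero C (src C g) (tgt C h)" "f \<in> arr C" "g \<in> arr C" "h \<in> arr C"
    "src C g = tgt C f" "src C h = tgt C g"
  shows "h \<cdot> g \<cdot> f = mzero C (src C f) (tgt C h)"
  using comp_eq_arr[OF assms(1-6)] assms tgt_obj by simp

lemma zero_object_Mor:
  assumes "is_zero_object C z" "f \<in> Mor C z a \<or> f \<in> Mor C a z"
  shows "f = mzero C (src C f) (tgt C f)"
proof -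
  have z: "z \<in> obj C" using assms by (simp add: is_zero_object_def)
  then have a: "a \<in> obj C" using assms Mor_obj by blast
  have "\<exists>!f. f \<in> Mor C z a" "\<exists>!f. f \<in> Mor C a z" using assms a by (simp_all add: is_zero_object_def)
  moreover have "mzero C z a \<in> Mor C z a" "mzero C a z \<in> Mor C a z" using a z by (auto simp: Mor_iff)
  ultimately show ?thesis using assms(2) unfolding Mor_iff by metis
qed

lemma zero_object_iff:
  "is_zero_object C z \<longleftrightarrow> z \<in> obj C \<and> ident C z = mzero C z z"
proof (intro iffI conjI)
  show "z \<in> obj C" if "is_zero_object C z" using that by (simp add: is_zero_object_def)
  show "ident C z = mzero C z z" if "is_zero_object C z"
    using zero_object_Mor[OF that, of "ident C z" z] that ident_Mor
    by (simp add: is_zero_object_def)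
  assume z: "z \<in> obj C \<and> ident C z = mzero C z z"
  have "f = mzero C z a" if "f \<in> Mor C z a" for f a
    using comp_ident(1)[of f z] that z Mor_obj[OF that] by (simp add: Mor_iff del: comp_ident)
  moreover have "f = mzero C a z" if "f \<in> Mor C a z" for f a
    using comp_ident(2)[of f z] that z Mor_obj[OF that] by (simp add: Mor_iff del: comp_ident)
  moreover have "mzero C z a \<in> Mor C z a" "mzero C a z \<in> Mor C a z" if "a \<in> obj C" for a
    using that z by (auto simp: Mor_iff)
  ultimately show "is_zero_object C z" unfolding is_zero_object_def using z by blast
qed

text \<open>The repair used where a construction is correct only up to an error of square zero: for
  arrows inverted in both quotients, and for fill-ins between cones.\<close>

lemma invertible_one_plus_square_zero:
  assumes "n \<in> Mor C a a" "n \<cdot> n = mzero C a a"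
  shows "(ident C a \<oplus> n) \<cdot> (ident C a \<oplus> \<ominus> n) = ident C a"
    "(ident C a \<oplus> \<ominus> n) \<cdot> (ident C a \<oplus> n) = ident C a"
  using assms Mor_obj[OF assms(1)] by (auto simp: Mor_iff)

end

section \<open>Triangulated categories\<close>

text \<open>\<open>dist\<close> records only the three arrows. Naming the vertices as well lets
  rules match on objects and makes all typing facts available through \<open>triD\<close>.\<close>

definition tri ::
  "('o, 'm, 'x) triangulated_cat_scheme \<Rightarrow> 'm \<Rightarrow> 'm \<Rightarrow> 'm \<Rightarrow> 'o \<Rightarrow> 'o \<Rightarrow> 'o \<Rightarrow> bool" where
  "tri C f g h x y z \<longleftrightarrow>
     (f, g, h) \<in> dist C \<and> f \<in> Mor C x y \<and> g \<in> Mor C y z \<and> h \<in> Mor C z (susp C x)"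

context triangulated_category
begin

abbreviation "T \<equiv> susp C"
abbreviation "Tm \<equiv> suspm C"

lemma susp_obj [simp]: "a \<in> obj C \<Longrightarrow> T a \<in> obj C"
  using susp_functor by (simp add: is_functor_def)

lemma suspm_ident [simp]: "a \<in> obj C \<Longrightarrow> Tm (ident C a) = ident C (T a)"
  using susp_functor by (simp add: is_functor_def)

lemma suspm_arr [simp]:
  assumes "f \<in> arr C"
  shows "Tm f \<in> arr C" "src C (Tm f) = T (src C f)" "tgt C (Tm f) = T (tgt C f)"
proof -
  have "f \<in> Mor C (src C f) (tgt C f)" using assms by (simp add: Mor_iff)
  then have "Tm f \<in> Mor C (T (src C f)) (T (tgt C f))"
    using susp_functor unfolding is_functor_def by blast
  then show "Tm f \<in> arr C" "src C (Tm f) = T (src C f)" "tgt C (Tm f) = T (tgt C f)"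
    by (auto simp: Mor_iff)
qed

lemma suspm_comp [simp]:
  assumes "f \<in> arr C" "g \<in> arr C" "src C g = tgt C f"
  shows "Tm (g \<cdot> f) = Tm g \<cdot> Tm f"
proof -
  have "f \<in> Mor C (src C f) (tgt C f)" "g \<in> Mor C (tgt C f) (tgt C g)"
    using assms by (simp_all add: Mor_iff)
  then show ?thesis using susp_functor unfolding is_functor_def by blast
qed

lemma suspm_madd [simp]:
  assumes "f \<in> arr C" "g \<in> arr C" "src C g = src C f" "tgt C g = tgt C f"
  shows "Tm (f \<oplus> g) = Tm f \<oplus> Tm g"
proof -
  have "f \<in> Mor C (src C f) (tgt C f)" "g \<in> Mor C (src C f) (tgt C f)"
    using assms by (simp_all add: Mor_iff)
  then show ?thesis using susp_additive unfolding additive_on_Mor_def by blast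
qed

lemma suspm_mzero [simp]:
  assumes "a \<in> obj C" "b \<in> obj C"
  shows "Tm (mzero C a b) = mzero C (T a) (T b)"
proof -
  let ?z = "Tm (mzero C a b)"
  have "?z \<oplus> ?z = ?z" using suspm_madd[of "mzero C a b" "mzero C a b"] assms by simp
  then show ?thesis using madd_neg_cancel(2)[of ?z ?z] assms by simp
qed

lemma suspm_mneg [simp]: "f \<in> arr C \<Longrightarrow> Tm (\<ominus> f) = \<ominus> (Tm f)"
  using suspm_madd[of f "\<ominus> f"] src_obj tgt_obj by (intro mneg_eqI) simp_all

lemma suspm_inj:
  assumes "Tm f = Tm g" "f \<in> Mor C a b" "g \<in> Mor C a b"
  shows "f = g"
  using susp_fully_faithful[of a b] assms Mor_obj[OF assms(2)] inj_onD
  unfolding bij_betw_def by metis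

lemma suspm_full:
  assumes "h \<in> Mor C (T a) (T b)" "a \<in> obj C" "b \<in> obj C"
  obtains f where "f \<in> Mor C a b" "Tm f = h"
proof -
  have "h \<in> Tm ` Mor C a b"
    using susp_fully_faithful[of a b] assms by (simp add: bij_betw_def)
  then show ?thesis using that by (elim imageE) simp
qed

lemma zero_object_susp: "is_zero_object C z \<Longrightarrow> is_zero_object C (T z)"
  using suspm_ident[of z] suspm_mzero[of z z] by (simp add: zero_object_iff)

section \<open>Rotation, signs and suspension of triangles\<close>

lemma triD:
  assumes "tri C f g h x y z"
  shows "f \<in> arr C" "src C f = x" "tgt C f = y" "g \<in> arr C" "src C g = y" "tgt C g = z"
    "h \<in> arr C" "src C h = z" "tgt C h = T x" "x \<in> obj C" "y \<in> obj C" "z \<in> obj C"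
    "(f, g, h) \<in> dist C"
  using assms src_obj tgt_obj by (auto simp: tri_def Mor_iff)

lemma dist_tri:
  assumes "(f, g, h) \<in> dist C"
  shows "tri C f g h (src C f) (tgt C f) (tgt C g)"
  using dist_triangle[OF assms] assms by (auto simp: tri_def is_triangle_def Mor_iff)

lemma tri_is_triangle: "tri C f g h x y z \<Longrightarrow> is_triangle C f g h"
  by (rule dist_triangle) (simp add: tri_def)

lemma tri_rotate: "tri C f g h x y z \<Longrightarrow> tri C g h (\<ominus> (Tm f)) y z (T x)"
  using TR2[OF tri_is_triangle] by (auto simp: tri_def Mor_iff)

lemma tri_unrotate:
  assumes "tri C g h (\<ominus> (Tm f)) y z (T x)" "f \<in> Mor C x y"
  shows "tri C f g h x y z"
proof -
  have "is_triangle C f g h" using assms triD[OF assms(1)]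
    by (simp add: is_triangle_def Mor_iff)
  then show ?thesis using TR2[of f g h] triD[OF assms(1)] assms(2) by (simp add: tri_def Mor_iff)
qed

lemma tri_iso:
  assumes "tri C f g h x y z" "f' \<in> Mor C x' y'" "g' \<in> Mor C y' z'" "h' \<in> Mor C z' (T x')"
    "u \<in> Iso C x x'" "v \<in> Iso C y y'" "w \<in> Iso C z z'"
    "v \<cdot> f = f' \<cdot> u" "w \<cdot> g = g' \<cdot> v" "Tm u \<cdot> h = h' \<cdot> w"
  shows "tri C f' g' h' x' y' z'"
proof -
  have "is_triangle C f' g' h'" using assms by (simp add: is_triangle_def Mor_iff)
  then show ?thesis
    using TR1_iso[of f g h f' g' h' u v w] assms triD[OF assms(1)] by (simp add: tri_def Mor_iff)
qed

lemma Iso_neg_ident: "a \<in> obj C \<Longrightarrow> \<ominus> (ident C a) \<in> Iso C a a"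
  by (auto simp: Iso_iff Mor_iff intro!: bexI[of _ "\<ominus> (ident C a)"])

text \<open>The isomorphism that is -1 on the middle vertex and the identity elsewhere flips two
  signs at once. It cancels signs that repeated rotation accumulates.\<close>

lemma tri_neg12:
  assumes "tri C f g h x y z"
  shows "tri C (\<ominus> f) (\<ominus> g) h x y z"
  by (rule tri_iso[OF assms, of _ _ _ _ _ _ "ident C x" "\<ominus> (ident C y)" "ident C z"])
    (use triD[OF assms] in \<open>auto simp: Mor_iff Iso_neg_ident Iso_ident\<close>)

text \<open>Octahedra are formed below with rotated triangles, so the triangle they return has
  suspended arrows. This reads it back one suspension lower.\<close>

lemma tri_desusp:
  assumes "tri C u (Tm p) (\<ominus> (Tm e)) j (T x) (T y)" "p \<in> Mor C x y" "e \<in> Mor C y j"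
  shows "tri C p e (\<ominus> u) x y j"
proof -
  have "tri C (\<ominus> u) (\<ominus> (Tm p)) (\<ominus> (Tm e)) j (T x) (T y)" by (rule tri_neg12[OF assms(1)])
  from tri_unrotate[OF tri_unrotate[OF this]] show ?thesis
    using assms(2,3) by (simp add: Mor_iff)
qed

lemma tri_susp:
  assumes "tri C f g h x y z"
  shows "tri C (Tm f) (Tm g) (\<ominus> (Tm h)) (T x) (T y) (T z)"
  using tri_neg12[OF tri_rotate[OF tri_rotate[OF tri_rotate[OF assms]]]] triD[OF assms] by simp

lemma tri_susp_rev:
  assumes "tri C (Tm f) (Tm g) (\<ominus> (Tm h)) (T x) (T y) (T z)"
    "f \<in> Mor C x y" "g \<in> Mor C y z" "h \<in> Mor C z (T x)"
  shows "tri C f g h x y z"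
proof -
  have "tri C g h (\<ominus> (Tm f)) y z (T x)" by (rule tri_desusp[OF assms(1,3,4)])
  then show ?thesis using assms(2) by (rule tri_unrotate)
qed

section \<open>Completing triangles; weak kernels and weak cokernels\<close>

lemma ex_zero_obj: obtains z where "is_zero_object C z" "z \<in> obj C"
  using ex_zero_object by (auto simp: is_zero_object_def)

lemma tri_ident:
  assumes "a \<in> obj C" "is_zero_object C z"
  shows "tri C (ident C a) (mzero C a z) (mzero C z (T a)) a a z"
  using TR1_ident[OF assms] assms by (auto simp: tri_def Mor_iff is_zero_object_def)

lemma tri_zero_ident:
  assumes "a \<in> obj C" "is_zero_object C z"
  shows "tri C (mzero C z a) (ident C a) (mzero C a (T z)) z a a"
proof (rule tri_unrotate)
  show "tri C (ident C a) (mzero C a (T z)) (\<ominus> (Tm (mzero C z a))) a a (T z)"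
    using tri_ident[OF assms(1) zero_object_susp[OF assms(2)]] assms by (simp add: zero_object_iff)
  show "mzero C z a \<in> Mor C z a" using assms by (simp add: zero_object_iff Mor_iff)
qed

lemma ex_cone:
  assumes "f \<in> Mor C x y"
  obtains z g h where "tri C f g h x y z"
proof -
  obtain g h where "(f, g, h) \<in> dist C" using TR1_cone[of f] assms by (auto simp: Mor_iff)
  from dist_tri[OF this] that show ?thesis using assms by (auto simp: Mor_iff)
qed

lemma tri_map:
  assumes "tri C f g h x y z" "tri C f' g' h' x' y' z'" "u \<in> Mor C x x'" "v \<in> Mor C y y'"
    "v \<cdot> f = f' \<cdot> u"
  obtains w where "w \<in> Mor C z z'" "w \<cdot> g = g' \<cdot> v" "Tm u \<cdot> h = h' \<cdot> w"
  using TR3[of f g h f' g' h' u v] assms triD[OF assms(1)] triD[OF assms(2)] by auto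

lemma tri_comp:
  assumes "tri C f g h x y z"
  shows "g \<cdot> f = mzero C x z" "h \<cdot> g = mzero C y (T x)" "Tm f \<cdot> h = mzero C z (T y)"
proof -
  have *: "g \<cdot> f = mzero C x z" if t: "tri C f g h x y z" for f g h x y z
  proof -
    obtain o' where o': "is_zero_object C o'" "o' \<in> obj C" by (rule ex_zero_obj)
    \<comment> \<open>The identity triangle on \<open>x\<close> maps to the given one by
      \<open>ident C x\<close> and \<open>f\<close>, so \<open>g \<cdot> f\<close> factors through a
      zero object.\<close>
    obtain w where "w \<in> Mor C o' z" "w \<cdot> mzero C x o' = g \<cdot> f"
      by (rule tri_map[OF tri_ident[OF _ o'(1)] t, of x "ident C x" f])
        (use triD[OF t] in \<open>auto simp: Mor_iff\<close>)
    then show ?thesis using triD[OF t] o' by (simp add: Mor_iff)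
  qed
  show "g \<cdot> f = mzero C x z" using *[OF assms] .
  show "h \<cdot> g = mzero C y (T x)" using *[OF tri_rotate[OF assms]] .
  have "\<ominus> (\<ominus> (Tm f) \<cdot> h) = mzero C z (T y)"
    using *[OF tri_rotate[OF tri_rotate[OF assms]]] triD[OF assms] by simp
  then show "Tm f \<cdot> h = mzero C z (T y)" using triD[OF assms] by simp
qed

text \<open>\<open>TR3\<close> only supplies the arrow between third vertices. So the triangles are
  rotated until the arrow sought stands there, and the result is desuspended by fullness. This makes
  \<open>f\<close> a weak kernel of \<open>g\<close>.\<close>

lemma tri_lift:
  assumes t: "tri C f g h x y z" and k: "k \<in> Mor C w y" "g \<cdot> k = mzero C w z"
  obtains l where "l \<in> Mor C w x" "f \<cdot> l = k"
proof -
  have w: "w \<in> obj C" using k Mor_obj by blast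
  obtain o' where o': "is_zero_object C o'" "o' \<in> obj C" by (rule ex_zero_obj)
  have t': "tri C (mzero C w o') (mzero C o' (T w)) (\<ominus> (ident C (T w))) w o' (T w)"
    using tri_rotate[OF tri_ident[OF w o'(1)]] w by simp
  obtain l' where l': "l' \<in> Mor C (T w) (T x)" "Tm k \<cdot> \<ominus> (ident C (T w)) = \<ominus> (Tm f) \<cdot> l'"
    by (rule tri_map[OF t' tri_rotate[OF t], of k "mzero C o' z"])
      (use triD[OF t] o' k w in \<open>auto simp: Mor_iff\<close>)
  obtain l where l: "l \<in> Mor C w x" "Tm l = l'" using suspm_full l'(1) w triD[OF t] by metis
  have "\<ominus> (\<ominus> (Tm k)) = \<ominus> (\<ominus> (Tm (f \<cdot> l)))" using l'(2) l(1) triD[OF t] k w unfolding l(2)[symmetric]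
    by (simp add: Mor_iff)
  then have "Tm k = Tm (f \<cdot> l)" using l(1) triD[OF t] k by (simp add: Mor_iff)
  then have "k = f \<cdot> l" by (rule suspm_inj) (use l triD[OF t] k in \<open>auto simp: Mor_iff\<close>)
  then show ?thesis using that l by blast
qed

lemma tri_lift2:
  assumes "tri C f g h x y z" "k \<in> Mor C w z" "h \<cdot> k = mzero C w (T x)"
  obtains l where "l \<in> Mor C w y" "g \<cdot> l = k"
  using tri_lift[OF tri_rotate[OF assms(1)]] assms by blast

lemma tri_extend:
  assumes t: "tri C f g h x y z" and k: "k \<in> Mor C y w" "k \<cdot> f = mzero C x w"
  obtains l where "l \<in> Mor C z w" "l \<cdot> g = k"
proof -
  have w: "w \<in> obj C" using k Mor_obj by blast
  obtain o' where o': "is_zero_object C o'" "o' \<in> obj C" by (rule ex_zero_obj)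
  obtain l where "l \<in> Mor C z w" "l \<cdot> g = ident C w \<cdot> k"
    by (rule tri_map[OF t tri_zero_ident[OF w o'(1)], of "mzero C x o'" k])
      (use triD[OF t] o' k w in \<open>auto simp: Mor_iff\<close>)
  then show ?thesis using that k by (simp add: Mor_iff)
qed

lemma tri_extend2:
  assumes "tri C f g h x y z" "k \<in> Mor C z w" "k \<cdot> g = mzero C y w"
  obtains l where "l \<in> Mor C (T x) w" "l \<cdot> h = k"
  using tri_extend[OF tri_rotate[OF assms(1)]] assms by blast

text \<open>After two rotations \<open>h\<close> and a signed \<open>Tm f\<close> are consecutive,
  so \<open>Tm k \<cdot> h\<close> is the obstruction to extending \<open>k\<close> along
  \<open>f\<close>. In the gluing argument this obstruction vanishes by orthogonality.\<close>

lemma tri_extend0: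
  assumes t: "tri C f g h x y z" and k: "k \<in> Mor C x w" "Tm k \<cdot> h = mzero C z (T w)"
  obtains l where "l \<in> Mor C y w" "l \<cdot> f = k"
proof -
  have w: "w \<in> obj C" using k Mor_obj by blast
  obtain l' where l': "l' \<in> Mor C (T y) (T w)" "l' \<cdot> \<ominus> (Tm f) = Tm k"
    using tri_extend[OF tri_rotate[OF tri_rotate[OF t]], of "Tm k" "T w"] k by (auto simp: Mor_iff)
  obtain l where l: "l \<in> Mor C y w" "Tm l = l'" using suspm_full l'(1) w triD[OF t] by metis
  have "Tm (\<ominus> l \<cdot> f) = Tm k" using l' l triD[OF t] k w by (simp add: Mor_iff)
  then have "\<ominus> l \<cdot> f = k" by (rule suspm_inj) (use l triD[OF t] k in \<open>auto simp: Mor_iff\<close>)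
  moreover have "\<ominus> l \<in> Mor C y w" using l by (simp add: Mor_iff)
  ultimately show ?thesis using that by blast
qed

text \<open>The suspension is only an equivalence, so \<open>w\<close> need not be a suspension. It
  is replaced by an isomorphic \<open>T x\<close> before the triangle is rotated backwards.\<close>

lemma tri_rotate_back:
  assumes t: "tri C g g' h' y z w"
  obtains x f h where "tri C f g h x y z" "Iso C w (T x) \<noteq> {}"
proof -
  obtain x where x: "x \<in> obj C" "Iso C (T x) w \<noteq> {}" using susp_ess_surj triD[OF t] by blast
  then obtain \<theta>' where th: "\<theta>' \<in> Iso C w (T x)" using Iso_sym by blast
  then obtain \<theta> where th2: "\<theta> \<in> Mor C (T x) w" "\<theta>' \<in> Mor C w (T x)"
      "\<theta> \<cdot> \<theta>' = ident C w" "\<theta>' \<cdot> \<theta> = ident C (T x)"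
    unfolding Iso_iff by blast
  have "h' \<cdot> \<theta> \<in> Mor C (T x) (T y)" using th2 triD[OF t] by (simp add: Mor_iff)
  then obtain f where f: "f \<in> Mor C x y" "Tm f = h' \<cdot> \<theta>" using suspm_full x triD[OF t] by metis
  have "tri C g (\<theta>' \<cdot> g') (h' \<cdot> \<theta>) y z (T x)"
    by (rule tri_iso[OF t, of _ _ _ _ _ _ "ident C y" "ident C z" \<theta>'])
      (use triD[OF t] th th2 in \<open>auto simp: Mor_iff Iso_ident\<close>)
  then have "tri C (\<ominus> f) g (\<theta>' \<cdot> g') x y z"
    using f th2 triD[OF t] by (intro tri_unrotate[where g = g]) (auto simp: Mor_iff)
  then show ?thesis using th by (intro that) auto
qed

lemma ex_fiber:
  assumes "g \<in> Mor C y z"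
  obtains x f h where "tri C f g h x y z"
  using ex_cone[OF assms] tri_rotate_back by metis

lemma ex_third:
  assumes "h \<in> Mor C z (T x)" "x \<in> obj C"
  obtains y f g where "tri C f g h x y z"
proof -
  obtain y g f' where t: "tri C g h f' y z (T x)" by (rule ex_fiber[OF assms(1)])
  obtain f where f: "f \<in> Mor C x y" "Tm f = f'"
    using suspm_full[of f' x y] triD[OF t] assms by (auto simp: Mor_iff)
  have "tri C (\<ominus> f) g h x y z"
    using f t by (intro tri_unrotate[where g = g]) (auto simp: Mor_iff)
  then show ?thesis by (rule that)
qed

section \<open>Octahedra: homotopy pullbacks, homotopy pushouts and factorizations\<close>

lemma octahedron:
  assumes "tri C f f1 f2 x y z'" "tri C g g1 g2 y z x'" "tri C (g \<cdot> f) h1 h2 x z y'"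
  obtains u v where "tri C u v (Tm f1 \<cdot> g2) z' y' x'" "u \<cdot> f1 = h1 \<cdot> g" "h2 \<cdot> u = f2"
    "v \<cdot> h1 = g1" "g2 \<cdot> v = Tm f \<cdot> h2"
proof -
  have "\<exists>u \<in> Mor C (tgt C f1) (tgt C h1). \<exists>v \<in> Mor C (tgt C h1) (tgt C g1).
          (u, v, suspm C f1 \<cdot> g2) \<in> dist C \<and>
          u \<cdot> f1 = h1 \<cdot> g \<and> h2 \<cdot> u = f2 \<and> v \<cdot> h1 = g1 \<and> g2 \<cdot> v = suspm C f \<cdot> h2"
    by (rule TR4) (use assms[THEN triD(13)] triD[OF assms(1)] triD[OF assms(2)] in auto)
  then obtain u v where uv: "u \<in> Mor C (tgt C f1) (tgt C h1)" "v \<in> Mor C (tgt C h1) (tgt C g1)"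
      "(u, v, Tm f1 \<cdot> g2) \<in> dist C" "u \<cdot> f1 = h1 \<cdot> g" "h2 \<cdot> u = f2" "v \<cdot> h1 = g1"
      "g2 \<cdot> v = Tm f \<cdot> h2"
    by (elim bexE conjE) (rule that)
  have "tri C u v (Tm f1 \<cdot> g2) z' y' x'"
    using dist_tri[OF uv(3)] uv(1,2) triD[OF assms(1)] triD[OF assms(2)] triD[OF assms(3)]
    by (simp add: Mor_iff)
  then show ?thesis using uv(4-7) by (rule that)
qed

text \<open>\<open>c0\<close> is the fiber of the composite \<open>q2 \<cdot> s1\<close>; the
  octahedron of this composite produces the second projection, whose cone is again the cone of
  \<open>s1\<close>. The identity \<open>Tm p2 \<cdot> d = r2\<close> is kept because it turns the
  square into a weak pushout in \<open>weak_pushout\<close>.\<close>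

lemma homotopy_pullback:
  assumes t1: "tri C s1 q1 r1 c1 a j1" and t2: "tri C s2 q2 r2 c2 a j2"
  obtains c0 p1 p2 d u where
    "tri C p1 (q2 \<cdot> s1) d c0 c1 j2" "tri C p2 (q1 \<cdot> s2) u c0 c2 j1"
    "s1 \<cdot> p1 = s2 \<cdot> p2" "Tm p2 \<cdot> d = r2"
proof -
  have "q2 \<cdot> s1 \<in> Mor C c1 j2" using triD[OF t1] triD[OF t2] by (simp add: Mor_iff)
  then obtain c0 p1 d where t0: "tri C p1 (q2 \<cdot> s1) d c0 c1 j2" by (rule ex_fiber)
  obtain u v where uv: "tri C u v (Tm q1 \<cdot> \<ominus> (Tm s2)) j1 (T c0) (T c2)"
      "v \<cdot> d = r2" "\<ominus> (Tm s2) \<cdot> v = Tm s1 \<cdot> \<ominus> (Tm p1)"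
    by (rule octahedron[OF t1 tri_rotate[OF t2] tri_rotate[OF t0]])
  have "v \<in> Mor C (T c0) (T c2)" using triD[OF uv(1)] by (simp add: Mor_iff)
  then obtain p2 where p2: "p2 \<in> Mor C c0 c2" "Tm p2 = v"
    using suspm_full triD[OF t0] triD[OF t2] by metis
  note D = triD[OF t0] triD[OF t1] triD[OF t2] p2[unfolded Mor_iff] triD[OF uv(1)]
  have "\<ominus> (\<ominus> (Tm (s2 \<cdot> p2))) = \<ominus> (\<ominus> (Tm (s1 \<cdot> p1)))" using uv(3) p2 D by simp
  then have "Tm (s1 \<cdot> p1) = Tm (s2 \<cdot> p2)" using D by simp
  then have eq: "s1 \<cdot> p1 = s2 \<cdot> p2" by (rule suspm_inj) (use D in \<open>auto simp: Mor_iff\<close>)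
  have "tri C p2 (q1 \<cdot> s2) (\<ominus> u) c0 c2 j1"
    by (rule tri_desusp) (use uv(1) D in \<open>auto simp: Mor_iff\<close>)
  then show ?thesis using that t0 eq uv(2) p2 by blast
qed

text \<open>The triangle on \<open>s\<close> is classified by its connecting arrow \<open>h\<close>.
  Pushing \<open>h\<close> forward along \<open>Tm f\<close> and completing gives the corner
  \<open>a\<close>, and an octahedron on suspended triangles identifies the cone of the other side
  with that of \<open>f\<close>.\<close>

lemma homotopy_pushout:
  assumes t1: "tri C s g h c a1 z" and t2: "tri C f f1 f2 c a2 y"
  obtains a u v g' e k k' where
    "tri C v g' k a2 a z" "tri C u e k' a1 a y" "u \<cdot> s = v \<cdot> f"
proof -
  note D0 = triD[OF t1] triD[OF t2]
  have "Tm f \<cdot> h \<in> Mor C z (T a2)" using D0 by (simp add: Mor_iff)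
  then obtain a v g' where t0: "tri C v g' (Tm f \<cdot> h) a2 a z"
    using ex_third D0 by metis
  note R1 = tri_rotate[OF tri_rotate[OF t1]] and R0 = tri_rotate[OF tri_rotate[OF t0]]
  obtain u v' where uv: "tri C u v' (Tm (\<ominus> (Tm s)) \<cdot> \<ominus> (Tm f2)) (T a1) (T a) (T y)"
      "u \<cdot> \<ominus> (Tm s) = \<ominus> (Tm v) \<cdot> Tm f"
    by (rule octahedron[OF R1 tri_susp[OF t2] R0])
  have "u \<in> Mor C (T a1) (T a)" "v' \<in> Mor C (T a) (T y)"
    using triD[OF uv(1)] by (simp_all add: Mor_iff)
  then obtain u0 v0 where u0: "u0 \<in> Mor C a1 a" "Tm u0 = u" and v0: "v0 \<in> Mor C a y" "Tm v0 = v'"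
    using suspm_full triD[OF t0] D0 by metis
  note D = D0 triD[OF t0] triD[OF uv(1)] u0[unfolded Mor_iff] v0[unfolded Mor_iff]
  have "\<ominus> (\<ominus> (Tm (u0 \<cdot> s))) = \<ominus> (\<ominus> (Tm (v \<cdot> f)))" using uv(2) u0 D by simp
  then have "Tm (u0 \<cdot> s) = Tm (v \<cdot> f)" using D by simp
  then have eq: "u0 \<cdot> s = v \<cdot> f" by (rule suspm_inj) (use D in \<open>auto simp: Mor_iff\<close>)
  have "tri C u0 v0 (\<ominus> (Tm s \<cdot> f2)) a1 a y"
    by (rule tri_susp_rev) (use uv(1) u0 v0 D in \<open>auto simp: Mor_iff\<close>)
  then show ?thesis using that t0 eq by blast
qed

text \<open>When the cone \<open>z\<close> of \<open>s\<close> is an extension of \<open>z1\<close>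
  by \<open>z2\<close>, restricting the connecting arrow to \<open>z2\<close> classifies an
  intermediate object \<open>c'\<close>. The octahedron of \<open>d \<cdot> i\<close> then shows
  that the rest of \<open>s\<close> has cone \<open>z1\<close>.\<close>

lemma factor_through_cone_extension:
  assumes t1: "tri C s q d c a z" and t2: "tri C i p e z2 z z1"
  obtains c' k s' l m n n' where
    "tri C k l m c c' z2" "tri C s' n n' c' a z1" "s = s' \<cdot> k"
proof -
  note D0 = triD[OF t1] triD[OF t2]
  have "d \<cdot> i \<in> Mor C z2 (T c)" using D0 by (simp add: Mor_iff)
  then obtain c' k l where t0: "tri C k l (d \<cdot> i) c c' z2" using ex_third D0 by metis
  note R1 = tri_rotate[OF tri_rotate[OF t1]] and R0 = tri_rotate[OF tri_rotate[OF t0]]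
  obtain u v where uv: "tri C u v (Tm p \<cdot> \<ominus> (Tm q)) z1 (T c') (T a)"
      "v \<cdot> \<ominus> (Tm k) = \<ominus> (Tm s)"
    by (rule octahedron[OF t2 R1 R0])
  have "v \<in> Mor C (T c') (T a)" using triD[OF uv(1)] by (simp add: Mor_iff)
  then obtain s' where s': "s' \<in> Mor C c' a" "Tm s' = v"
    using suspm_full triD[OF t0] D0 by metis
  note D = D0 triD[OF t0] triD[OF uv(1)] s'[unfolded Mor_iff]
  have "\<ominus> (\<ominus> (Tm s)) = \<ominus> (\<ominus> (Tm (s' \<cdot> k)))" using uv(2) s' D by simp
  then have "Tm s = Tm (s' \<cdot> k)" using D by simp
  then have eq: "s = s' \<cdot> k" by (rule suspm_inj) (use D in \<open>auto simp: Mor_iff\<close>)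
  have "tri C s' (p \<cdot> q) (\<ominus> u) c' a z1"
    by (rule tri_desusp) (use uv(1) D in \<open>auto simp: Mor_iff\<close>)
  then show ?thesis using that t0 eq by blast
qed

text \<open>The connecting arrow \<open>r2\<close> factors through \<open>d\<close>, so the
  obstruction to extending \<open>m2\<close> along \<open>s2\<close> dies because
  \<open>m2 \<cdot> p2\<close> equals \<open>m1 \<cdot> p1\<close>. The extension \<open>m0\<close>
  may be wrong on \<open>c1\<close>, but the discrepancy vanishes on \<open>p1\<close> and hence
  factors through \<open>q2 \<cdot> s1\<close>. Correcting by a multiple of \<open>q2\<close> does
  not disturb the restriction along \<open>s2\<close>.\<close>

lemma weak_pushout:
  assumes t1: "tri C p1 (q2 \<cdot> s1) d c0 c1 j" and t2: "tri C s2 q2 r2 c2 a j"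
    and s1: "s1 \<in> Mor C c1 a" and p2: "p2 \<in> Mor C c0 c2" "Tm p2 \<cdot> d = r2" "s1 \<cdot> p1 = s2 \<cdot> p2"
    and m: "m1 \<in> Mor C c1 b" "m2 \<in> Mor C c2 b" "m1 \<cdot> p1 = m2 \<cdot> p2"
  obtains m where "m \<in> Mor C a b" "m \<cdot> s1 = m1" "m \<cdot> s2 = m2"
proof -
  have b: "b \<in> obj C" using m Mor_obj by blast
  note D = triD[OF t1] triD[OF t2] s1[unfolded Mor_iff] p2(1)[unfolded Mor_iff]
    m(1,2)[unfolded Mor_iff] b
  have "Tm m2 \<cdot> r2 = Tm (m2 \<cdot> p2) \<cdot> d" using D p2(2) by simp
  also have "\<dots> = Tm m1 \<cdot> (Tm p1 \<cdot> d)" using m(3)[symmetric] D by simp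
  also have "\<dots> = mzero C j (T b)" using tri_comp(3)[OF t1] D by simp
  finally have "Tm m2 \<cdot> r2 = mzero C j (T b)" .
  then obtain m0 where m0: "m0 \<in> Mor C a b" "m0 \<cdot> s2 = m2" using tri_extend0[OF t2 m(2)] by blast
  note D = D m0(1)[unfolded Mor_iff]
  have "(m0 \<cdot> s1) \<cdot> p1 = m1 \<cdot> p1"
    using comp_eq_arr[OF m0(2), of p2] p2(3) m(3) D by simp
  then have "(m0 \<cdot> s1 \<oplus> \<ominus> m1) \<cdot> p1 = mzero C c0 b" using D by simp
  moreover have "m0 \<cdot> s1 \<oplus> \<ominus> m1 \<in> Mor C c1 b" using D by (simp add: Mor_iff)
  ultimately obtain n where n: "n \<in> Mor C j b" "n \<cdot> q2 \<cdot> s1 = m0 \<cdot> s1 \<oplus> \<ominus> m1"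
    using tri_extend[OF t1] by blast
  note D = D n(1)[unfolded Mor_iff]
  let ?m = "m0 \<oplus> \<ominus> (n \<cdot> q2)"
  have "?m \<cdot> s1 = m1" using D n(2) by (simp add: madd_commute[of _ m1])
  moreover have "?m \<cdot> s2 = m2" using D m0(2) tri_comp(1)[OF t2] by simp
  moreover have "?m \<in> Mor C a b" using D by (simp add: Mor_iff)
  ultimately show ?thesis using that by blast
qed

text \<open>The complement is the image of the idempotent \<open>1 - i p\<close>. This converts
  closure of primes under direct summands into closure under retracts.\<close>

lemma split_mono_direct_sum:
  assumes "idempotent_complete C" "i \<in> Mor C a c" "p \<in> Mor C c a" "p \<cdot> i = ident C a"
  obtains b where "is_direct_sum C a b c"
proof -
  note D = assms(2,3)[unfolded Mor_iff] Mor_obj[OF assms(2)]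
  let ?e = "ident C c \<oplus> \<ominus> (i \<cdot> p)"
  have e: "?e \<in> Mor C c c" "?e \<cdot> ?e = ?e"
    using D comp_eq_arr[OF assms(4), of p] by (simp_all add: Mor_iff)
  then obtain b q j where q: "b \<in> obj C" "q \<in> Mor C c b" "j \<in> Mor C b c" "j \<cdot> q = ?e"
      "q \<cdot> j = ident C b"
    using assms(1) D unfolding idempotent_complete_def by blast
  note D = D q(1) q(2,3)[unfolded Mor_iff]
  have "p \<cdot> j \<cdot> q = mzero C c a" using q(4) D comp_eq_arr[OF assms(4), of p] by simp
  then have "(p \<cdot> j \<cdot> q) \<cdot> j = mzero C b a" using D by simp
  then have pj: "p \<cdot> j = mzero C b a" using D q(5) by simp
  have "(j \<cdot> q) \<cdot> i = mzero C a c" using q(4) D assms(4) by simp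
  then have "q \<cdot> (j \<cdot> q) \<cdot> i = mzero C a b" using D by simp
  then have qi: "q \<cdot> i = mzero C a b" using D comp_eq_arr[OF q(5), of "q \<cdot> i"] by simp
  have "i \<cdot> p \<oplus> j \<cdot> q = ident C c" using D q(4) by (simp add: madd_left_commute[of _ "ident C c"])
  then have "is_direct_sum C a b c"
    unfolding is_direct_sum_def using D assms(2-4) q(2,3,5) pj qi by blast
  then show ?thesis by (rule that)
qed

end

section \<open>Verdier quotients\<close>

text \<open>Thickness is phrased by retracts, the form in which the quotient arguments use it: an
  identity arrow that factors through \<open>J\<close> exhibits a retract.\<close>

definition thick_subcategory :: "('o, 'm, 'x) triangulated_cat_scheme \<Rightarrow> 'o set \<Rightarrow> bool" where
  "thick_subcategory C J \<longleftrightarrow>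
     triangulated_subcategory C J \<and>
     (\<forall>a \<in> obj C. \<forall>b \<in> J. \<forall>i \<in> Mor C a b. \<forall>p \<in> Mor C b a. p \<cdot>\<^bsub>C\<^esub> i = ident C a \<longrightarrow> a \<in> J)"

text \<open>These are the arrows that become zero in the quotient, see
  \<open>Q_zero_iff\<close>.\<close>

definition factors_through :: "('o, 'm, 'x) cat_scheme \<Rightarrow> 'o set \<Rightarrow> 'm \<Rightarrow> bool" where
  "factors_through C J f \<longleftrightarrow>
     (\<exists>z \<in> J. \<exists>p \<in> Mor C (src C f) z. \<exists>i \<in> Mor C z (tgt C f). f = i \<cdot>\<^bsub>C\<^esub> p)"

text \<open>Like composition, the sum is a saturation over all representatives, here those with a
  common first leg. \<open>common_denominator\<close> provides such pairs and
  \<open>frac_add_eq\<close> shows that every choice gives the same class.\<close>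

definition frac_add ::
  "('o, 'm, 'x) triangulated_cat_scheme \<Rightarrow> 'o set
    \<Rightarrow> ('o, 'm) frac \<Rightarrow> ('o, 'm) frac \<Rightarrow> ('o, 'm) frac" where
  "frac_add C J = (\<lambda>(a, b, X) (a', b', Y).
     (a, b, roof_rel C J a b `` {(s, f \<oplus>\<^bsub>C\<^esub> g) |s f g. (s, f) \<in> X \<and> (s, g) \<in> Y}))"

text \<open>\<open>verdier_quotient\<close> is a bare category. Adding the sum of fractions makes
  the preadditive calculus applicable; \<open>verdier_additive_simps\<close> translates back at the
  end.\<close>

definition verdier_additive ::
  "('o, 'm, 'x) triangulated_cat_scheme \<Rightarrow> 'o set \<Rightarrow> ('o, ('o, 'm) frac) additive_cat" where
  "verdier_additive C J =
     \<lparr>obj = obj (verdier_quotient C J), arr = arr (verdier_quotient C J),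
      src = src (verdier_quotient C J), tgt = tgt (verdier_quotient C J),
      ident = ident (verdier_quotient C J), comp = comp (verdier_quotient C J),
      madd = frac_add C J, mzero = (\<lambda>a b. frac C J (ident C a) (mzero C a b))\<rparr>"

locale verdier = triangulated_category C
  for C :: "('o, 'm, 'x) triangulated_cat_scheme" (structure) +
  fixes J :: "'o set"
  assumes thick: "thick_subcategory C J"
begin

abbreviation "S \<equiv> cone_in C J"
abbreviation "Q \<equiv> localize_arr C J"
abbreviation "L \<equiv> verdier_additive C J"
abbreviation "fr \<equiv> frac C J"

lemma J_obj: "z \<in> J \<Longrightarrow> z \<in> obj C"
  using thick by (auto simp: thick_subcategory_def triangulated_subcategory_def)

lemma J_zero: "is_zero_object C z \<Longrightarrow> z \<in> J"
  using thick by (auto simp: thick_subcategory_def triangulated_subcategory_def)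

lemma triangulated_J:
  shows "\<forall>a \<in> J. \<forall>b \<in> obj C. Iso C a b \<noteq> {} \<longrightarrow> b \<in> J"
    and "\<forall>a \<in> obj C. T a \<in> J \<longleftrightarrow> a \<in> J"
proof -
  have "triangulated_subcategory C J" using thick by (simp add: thick_subcategory_def)
  then show "\<forall>a \<in> J. \<forall>b \<in> obj C. Iso C a b \<noteq> {} \<longrightarrow> b \<in> J" "\<forall>a \<in> obj C. T a \<in> J \<longleftrightarrow> a \<in> J"
    unfolding triangulated_subcategory_def by - (elim conjE, assumption)+
qed

lemma J_iso: "a \<in> J \<Longrightarrow> Iso C a b \<noteq> {} \<Longrightarrow> b \<in> J"
proof -
  assume a: "a \<in> J" "Iso C a b \<noteq> {}"
  then have "b \<in> obj C" using Mor_obj by (auto simp: Iso_iff)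
  then show "b \<in> J" using triangulated_J(1) a by blast
qed

lemma J_susp: "a \<in> obj C \<Longrightarrow> T a \<in> J \<longleftrightarrow> a \<in> J"
  using triangulated_J(2) by blast

lemma J_retract:
  assumes "b \<in> J" "i \<in> Mor C a b" "p \<in> Mor C b a" "p \<cdot> i = ident C a"
  shows "a \<in> J"
  using thick assms Mor_obj[OF assms(2)] unfolding thick_subcategory_def by blast

lemma J_cone: "tri C f g h x y z \<Longrightarrow> x \<in> J \<Longrightarrow> y \<in> J \<Longrightarrow> z \<in> J"
  using thick triD[of f g h x y z]
  unfolding thick_subcategory_def triangulated_subcategory_def by metis

lemma J_middle: "tri C f g h x y z \<Longrightarrow> x \<in> J \<Longrightarrow> z \<in> J \<Longrightarrow> y \<in> J"
  using J_cone[OF tri_rotate[OF tri_rotate]] J_susp triD[of f g h x y z] by metis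

lemma J_fiber: "tri C f g h x y z \<Longrightarrow> y \<in> J \<Longrightarrow> z \<in> J \<Longrightarrow> x \<in> J"
  using J_cone[OF tri_rotate] J_susp triD[of f g h x y z] by metis

section \<open>The multiplicative system of arrows with cone in \<open>J\<close>\<close>

lemma S_I: "tri C s g h x y z \<Longrightarrow> z \<in> J \<Longrightarrow> s \<in> S"
  using triD[of s g h x y z] by (auto simp: cone_in_def)

lemma S_E:
  assumes "s \<in> S"
  obtains g h z where "tri C s g h (src C s) (tgt C s) z" "z \<in> J"
proof -
  obtain g h where "(s, g, h) \<in> dist C" "tgt C g \<in> J" using assms by (auto simp: cone_in_def)
  then show ?thesis using that dist_tri by blast
qed

lemma S_arr [simp]: "s \<in> S \<Longrightarrow> s \<in> arr C"
  using S_E triD by metis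

lemma S_ident [simp]: "a \<in> obj C \<Longrightarrow> ident C a \<in> S"
  using ex_zero_obj tri_ident S_I J_zero by metis

lemma S_susp: "s \<in> S \<Longrightarrow> Tm s \<in> S"
  using S_E[of s] tri_susp S_I J_susp triD by metis

text \<open>The source of the two-out-of-three property: the cones of \<open>s\<close>,
  \<open>t\<close> and \<open>t \<cdot> s\<close> are the vertices of one triangle.\<close>

lemma S_octahedron:
  assumes "s \<in> arr C" "t \<in> arr C" "tgt C s = src C t"
    "tri C s g h (src C s) (tgt C s) z" "tri C t g' h' (src C t) (tgt C t) z'"
    "tri C (t \<cdot> s) g'' h'' (src C s) (tgt C t) z''"
  obtains u v w where "tri C u v w z z'' z'"
  using octahedron[of s g h "src C s" "tgt C s" z t g' h' "tgt C t" z' g'' h'' z''] assms by metis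

lemma S_comp:
  assumes "s \<in> S" "t \<in> S" "src C t = tgt C s"
  shows "t \<cdot> s \<in> S"
proof -
  obtain g h z where 1: "tri C s g h (src C s) (tgt C s) z" "z \<in> J" by (rule S_E[OF assms(1)])
  obtain g' h' z' where 2: "tri C t g' h' (src C t) (tgt C t) z'" "z' \<in> J" by (rule S_E[OF assms(2)])
  have "t \<cdot> s \<in> Mor C (src C s) (tgt C t)" using assms by (simp add: Mor_iff)
  then obtain z'' g'' h'' where 3: "tri C (t \<cdot> s) g'' h'' (src C s) (tgt C t) z''" by (rule ex_cone)
  obtain u v w where "tri C u v w z z'' z'"
    using S_octahedron[OF _ _ _ 1(1) 2(1) 3] assms by auto
  then show ?thesis using J_middle 1 2 S_I[OF 3] by blast
qed

lemma S_cancel_left: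
  assumes "t \<in> S" "t \<cdot> s \<in> S" "s \<in> arr C" "src C t = tgt C s"
  shows "s \<in> S"
proof -
  obtain g' h' z' where 2: "tri C t g' h' (src C t) (tgt C t) z'" "z' \<in> J" by (rule S_E[OF assms(1)])
  obtain g'' h'' z'' where 3: "tri C (t \<cdot> s) g'' h'' (src C s) (tgt C t) z''" "z'' \<in> J"
    using S_E[OF assms(2)] assms by auto
  have "s \<in> Mor C (src C s) (tgt C s)" using assms by (simp add: Mor_iff)
  then obtain z g h where 1: "tri C s g h (src C s) (tgt C s) z" by (rule ex_cone)
  obtain u v w where "tri C u v w z z'' z'"
    using S_octahedron[OF _ _ _ 1(1) 2(1) 3(1)] assms by auto
  then show ?thesis using J_fiber 2 3 S_I[OF 1] by blast
qed

text \<open>Take for \<open>w\<close> the fiber of \<open>f\<close> followed by the map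
  \<open>g\<close> to the cone of \<open>s\<close>. Then \<open>f \<cdot> w\<close> is killed by
  \<open>g\<close> and lifts through \<open>s\<close>, while the cone of \<open>w\<close> is that of
  \<open>s\<close>.\<close>

lemma ore:
  assumes "f \<in> arr C" "s \<in> S" "tgt C f = tgt C s"
  obtains w h where "w \<in> S" "tgt C w = src C f" "h \<in> Mor C (src C w) (src C s)" "f \<cdot> w = s \<cdot> h"
proof -
  obtain g k z where t: "tri C s g k (src C s) (tgt C s) z" "z \<in> J" by (rule S_E[OF assms(2)])
  note D = triD[OF t(1)]
  have "g \<cdot> f \<in> Mor C (src C f) z" using D assms by (simp add: Mor_iff)
  then obtain d w l where t2: "tri C w (g \<cdot> f) l d (src C f) z" by (rule ex_fiber)
  have w: "w \<in> S" using S_I[OF t2 t(2)] .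
  have "g \<cdot> (f \<cdot> w) = mzero C d z" using tri_comp(1)[OF t2] triD[OF t2] D assms by simp
  moreover have "f \<cdot> w \<in> Mor C d (tgt C s)" using triD[OF t2] D assms by (simp add: Mor_iff)
  ultimately obtain h where "h \<in> Mor C d (src C s)" "s \<cdot> h = f \<cdot> w" using tri_lift[OF t(1)] by blast
  then show ?thesis using that w triD[OF t2] by auto
qed

lemma factors_throughI:
  "z \<in> J \<Longrightarrow> p \<in> Mor C a z \<Longrightarrow> i \<in> Mor C z b \<Longrightarrow> f = i \<cdot> p \<Longrightarrow> factors_through C J f"
  unfolding factors_through_def
  by (intro bexI[of _ z] bexI[of _ p] bexI[of _ i]) (auto simp: Mor_iff)

text \<open>An arrow killed by \<open>r\<close> extends over the cone of \<open>r\<close>.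
  Conversely, in \<open>factors_imp_killed\<close>, the fiber of the first factor kills the
  composite.\<close>

lemma killed_imp_factors:
  assumes "f \<in> arr C" "r \<in> S" "tgt C r = src C f" "f \<cdot> r = mzero C (src C r) (tgt C f)"
  shows "factors_through C J f"
proof -
  obtain g k z where t: "tri C r g k (src C r) (tgt C r) z" "z \<in> J" by (rule S_E[OF assms(2)])
  obtain l where "l \<in> Mor C z (tgt C f)" "l \<cdot> g = f"
    using tri_extend[OF t(1), of f "tgt C f"] assms by (auto simp: Mor_iff)
  then show ?thesis
    using t triD[OF t(1)] assms by (intro factors_throughI[of z g "src C f" l]) (auto simp: Mor_iff)
qed

lemma factors_imp_killed:
  assumes "factors_through C J f"
  obtains r where "r \<in> S" "tgt C r = src C f" "f \<cdot> r = mzero C (src C r) (tgt C f)"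
proof -
  obtain z p i where z: "z \<in> J" "p \<in> Mor C (src C f) z" "i \<in> Mor C z (tgt C f)" "f = i \<cdot> p"
    using assms unfolding factors_through_def by blast
  obtain d r l where t: "tri C r p l d (src C f) z" by (rule ex_fiber[OF z(2)])
  have "(i \<cdot> p) \<cdot> r = mzero C (src C r) (tgt C f)"
    using tri_comp(1)[OF t] triD[OF t] z(2,3) tgt_obj by (simp add: Mor_iff)
  then show ?thesis using that S_I[OF t z(1)] triD[OF t] z(4) by metis
qed

text \<open>The difference of \<open>f\<close> and \<open>g\<close> lifts to the fiber of
  \<open>t\<close>, which lies in \<open>J\<close> because its suspension is isomorphic to the cone.
  So the difference factors through \<open>J\<close> and is killed by an arrow of
  \<open>S\<close>.\<close>

lemma S_equalize:
  assumes "t \<in> S" "t \<cdot> f = t \<cdot> g" "f \<in> arr C" "g \<in> arr C" "tgt C f = src C t" "tgt C g = src C t"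
    "src C g = src C f"
  obtains r where "r \<in> S" "tgt C r = src C f" "f \<cdot> r = g \<cdot> r"
proof -
  obtain g' h' z where t': "tri C t g' h' (src C t) (tgt C t) z" "z \<in> J" by (rule S_E[OF assms(1)])
  obtain d k l where t: "tri C k t l d (src C t) (tgt C t)" "Iso C z (T d) \<noteq> {}"
    by (rule tri_rotate_back[OF t'(1)])
  have d: "d \<in> J" using J_iso[OF t'(2) t(2)] J_susp triD[OF t(1)] by simp
  note t = t(1)
  have "t \<cdot> (f \<oplus> \<ominus> g) = mzero C (src C f) (tgt C t)" using assms by simp
  moreover have "f \<oplus> \<ominus> g \<in> Mor C (src C f) (src C t)" using assms by (simp add: Mor_iff)
  ultimately obtain m where m: "m \<in> Mor C (src C f) d" "k \<cdot> m = f \<oplus> \<ominus> g"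
    using tri_lift[OF t] by blast
  have "factors_through C J (f \<oplus> \<ominus> g)"
    using m triD[OF t] d assms by (intro factors_throughI[of d m "src C f" k]) (auto simp: Mor_iff)
  then obtain r where r: "r \<in> S" "tgt C r = src C f" "(f \<oplus> \<ominus> g) \<cdot> r = mzero C (src C r) (tgt C f)"
    using factors_imp_killed[of "f \<oplus> \<ominus> g"] assms by auto
  have "f \<cdot> r = g \<cdot> r" by (rule diff_eq_zero) (use r assms in auto)
  then show ?thesis using that r by blast
qed


lemma ore2:
  assumes "f \<in> S" "s \<in> S" "tgt C f = tgt C s"
  obtains w h where "w \<in> S" "tgt C w = src C f" "h \<in> S" "src C h = src C w" "tgt C h = src C s"
    "f \<cdot> w = s \<cdot> h"
proof -
  obtain w h where w: "w \<in> S" "tgt C w = src C f" "h \<in> Mor C (src C w) (src C s)" "f \<cdot> w = s \<cdot> h"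
    using ore[OF S_arr[OF assms(1)] assms(2,3)] by blast
  have "s \<cdot> h \<in> S" using S_comp[of w f] w assms by simp
  then have "h \<in> S" using S_cancel_left[of s h] assms w by (simp add: Mor_iff)
  then show ?thesis using that w by (simp add: Mor_iff)
qed

section \<open>The calculus of roofs\<close>

lemma roofs_iff: "(s, f) \<in> roofs C J a b \<longleftrightarrow>
    s \<in> S \<and> tgt C s = a \<and> f \<in> arr C \<and> src C f = src C s \<and> tgt C f = b"
  by (auto simp: roofs_def Mor_iff)

text \<open>By left cancellation the refinements \<open>u\<close> and \<open>u'\<close> themselves
  lie in \<open>S\<close>, not only their composites with the denominators. In this form refinements
  can be composed.\<close>

lemma roof_rel_iff: "((s, f), (s', f')) \<in> roof_rel C J a b \<longleftrightarrow>
    (s, f) \<in> roofs C J a b \<and> (s', f') \<in> roofs C J a b \<and>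
    (\<exists>u u'. u \<in> S \<and> u' \<in> S \<and> tgt C u = src C s \<and> tgt C u' = src C s' \<and> src C u = src C u' \<and>
       s \<cdot> u = s' \<cdot> u' \<and> f \<cdot> u = f' \<cdot> u')" (is "_ \<longleftrightarrow> ?r \<and> ?r' \<and> ?e")
proof (intro iffI conjI)
  assume l: "((s, f), (s', f')) \<in> roof_rel C J a b"
  then show r: ?r ?r' by (simp_all add: roof_rel_def)
  obtain d u u' where u: "u \<in> Mor C d (src C s)" "u' \<in> Mor C d (src C s')" "s \<cdot> u = s' \<cdot> u'"
      "s \<cdot> u \<in> S" "f \<cdot> u = f' \<cdot> u'"
    using l unfolding roof_rel_def by blast
  have "u \<in> S" using S_cancel_left[of s u] u r by (simp add: Mor_iff roofs_iff)
  moreover have "u' \<in> S" using S_cancel_left[of s' u'] u r by (simp add: Mor_iff roofs_iff)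
  ultimately show ?e using u by (intro exI[of _ u] exI[of _ u']) (simp add: Mor_iff)
next
  assume l: "?r \<and> ?r' \<and> ?e"
  then obtain u u' where u: "u \<in> S" "u' \<in> S" "tgt C u = src C s" "tgt C u' = src C s'"
      "src C u = src C u'" "s \<cdot> u = s' \<cdot> u'" "f \<cdot> u = f' \<cdot> u'" by blast
  have "s \<cdot> u \<in> S" using S_comp[of u s] u l by (simp add: roofs_iff)
  moreover have "u \<in> Mor C (src C u) (src C s)" "u' \<in> Mor C (src C u) (src C s')"
    using u by (simp_all add: Mor_iff)
  ultimately show "((s, f), (s', f')) \<in> roof_rel C J a b"
    using l u unfolding roof_rel_def by blast
qed

lemma roof_relI:
  assumes "(s, f) \<in> roofs C J a b" "(s', f') \<in> roofs C J a b" "u \<in> S" "u' \<in> S"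
    "tgt C u = src C s" "tgt C u' = src C s'" "src C u = src C u'"
    "s \<cdot> u = s' \<cdot> u'" "f \<cdot> u = f' \<cdot> u'"
  shows "((s, f), (s', f')) \<in> roof_rel C J a b"
  unfolding roof_rel_iff using assms by blast

lemma equiv_roof_rel: "equiv (roofs C J a b) (roof_rel C J a b)"
proof (rule equivI)
  show "roof_rel C J a b \<subseteq> roofs C J a b \<times> roofs C J a b" by (auto simp: roof_rel_def)
  show "refl_on (roofs C J a b) (roof_rel C J a b)"
  proof (rule refl_onI; clarify)
    fix s f assume r: "(s, f) \<in> roofs C J a b"
    let ?i = "ident C (src C s)"
    have "src C s \<in> obj C" using r src_obj[of s] by (simp add: roofs_iff)
    then show "((s, f), (s, f)) \<in> roof_rel C J a b"
      using r by (intro roof_relI[of _ _ _ _ _ _ ?i ?i]) (auto simp: roofs_iff)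
  qed
  show "sym (roof_rel C J a b)"
  proof (rule symI; clarify)
    fix s f s' f' assume 1: "((s, f), (s', f')) \<in> roof_rel C J a b"
    then obtain u u' where u: "u \<in> S" "u' \<in> S" "tgt C u = src C s" "tgt C u' = src C s'"
        "src C u = src C u'" "s \<cdot> u = s' \<cdot> u'" "f \<cdot> u = f' \<cdot> u'"
      unfolding roof_rel_iff by blast
    have r: "(s, f) \<in> roofs C J a b" "(s', f') \<in> roofs C J a b" using 1 by (simp_all add: roof_rel_iff)
    show "((s', f'), (s, f)) \<in> roof_rel C J a b"
      by (rule roof_relI[OF r(2,1) u(2,1,4,3) u(5)[symmetric] u(6)[symmetric] u(7)[symmetric]])
  qed
  show "trans (roof_rel C J a b)"
  proof (rule transI; clarify)
    fix s f s' f' s'' f''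
    assume 1: "((s, f), (s', f')) \<in> roof_rel C J a b" and 2: "((s', f'), (s'', f'')) \<in> roof_rel C J a b"
    obtain u u' where u: "u \<in> S" "u' \<in> S" "tgt C u = src C s" "tgt C u' = src C s'"
        "src C u = src C u'" "s \<cdot> u = s' \<cdot> u'" "f \<cdot> u = f' \<cdot> u'"
      using 1 unfolding roof_rel_iff by blast
    obtain v v' where v: "v \<in> S" "v' \<in> S" "tgt C v = src C s'" "tgt C v' = src C s''"
        "src C v = src C v'" "s' \<cdot> v = s'' \<cdot> v'" "f' \<cdot> v = f'' \<cdot> v'"
      using 2 unfolding roof_rel_iff by blast
    have r: "(s, f) \<in> roofs C J a b" "(s', f') \<in> roofs C J a b" "(s'', f'') \<in> roofs C J a b"
      using 1 2 by (simp_all add: roof_rel_iff)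
    \<comment> \<open>The two comparisons meet at the middle roof; an Ore square over the source of
      \<open>s'\<close> gives one common refinement.\<close>
    obtain w x where w: "w \<in> S" "tgt C w = src C u'" "x \<in> S" "src C x = src C w" "tgt C x = src C v"
        "u' \<cdot> w = v \<cdot> x"
      using ore2[of u' v] u v by metis
    note D = r[unfolded roofs_iff] u(1-5) v(1-5) w(1-5)
    show "((s, f), (s'', f'')) \<in> roof_rel C J a b"
    proof (rule roof_relI[OF r(1,3)])
      show "u \<cdot> w \<in> S" "v' \<cdot> x \<in> S" using S_comp u v w by auto
      show "s \<cdot> u \<cdot> w = s'' \<cdot> v' \<cdot> x"
        by (simp add: D w(6) comp_eq_comp[OF u(6)] comp_eq_comp[OF v(6)])
      show "f \<cdot> u \<cdot> w = f'' \<cdot> v' \<cdot> x"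
        by (simp add: D w(6) comp_eq_comp[OF u(7)] comp_eq_comp[OF v(7)])
    qed (simp_all add: D)
  qed
qed

lemma frac_eq_iff:
  assumes "(s, f) \<in> roofs C J a b" "(s', f') \<in> roofs C J a b"
  shows "fr s f = fr s' f' \<longleftrightarrow> ((s, f), (s', f')) \<in> roof_rel C J a b"
  using eq_equiv_class_iff[OF equiv_roof_rel, of "(s, f)" a b "(s', f')"] assms
  by (simp add: frac_def roofs_iff)

lemma frac_refine:
  assumes "(s, f) \<in> roofs C J a b" "w \<in> S" "tgt C w = src C s"
  shows "fr (s \<cdot> w) (f \<cdot> w) = fr s f"
proof -
  have o: "src C w \<in> obj C" using assms(2) src_obj by simp
  have r: "(s \<cdot> w, f \<cdot> w) \<in> roofs C J a b" using assms S_comp by (simp add: roofs_iff)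
  have "((s \<cdot> w, f \<cdot> w), (s, f)) \<in> roof_rel C J a b"
    by (rule roof_relI[OF r assms(1), of "ident C (src C w)" w]) (use assms o in \<open>auto simp: roofs_iff\<close>)
  then show ?thesis using frac_eq_iff[OF r assms(1)] by simp
qed

lemma L_simps:
  "obj L = obj C"
  "arr L = {(a, b, X). a \<in> obj C \<and> b \<in> obj C \<and> X \<in> roofs C J a b // roof_rel C J a b}"
  "src L (a, b, X) = a" "tgt L (a, b, X) = b" "ident L a = fr (ident C a) (ident C a)"
  "x \<cdot>\<^bsub>L\<^esub> y = frac_comp C J x y" "x \<oplus>\<^bsub>L\<^esub> y = frac_add C J x y"
  "mzero L a b = fr (ident C a) (mzero C a b)"
  by (simp_all add: verdier_additive_def verdier_quotient_def)

lemma L_Mor_iff: "x \<in> Mor L a b \<longleftrightarrow> (\<exists>s f. (s, f) \<in> roofs C J a b \<and> x = fr s f)"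
proof
  assume "x \<in> Mor L a b"
  then obtain X where x: "x = (a, b, X)" "X \<in> roofs C J a b // roof_rel C J a b"
    by (auto simp: Mor_def L_simps)
  then obtain s f where "(s, f) \<in> roofs C J a b" "X = roof_rel C J a b `` {(s, f)}"
    by (auto elim!: quotientE)
  then show "\<exists>s f. (s, f) \<in> roofs C J a b \<and> x = fr s f"
    using x by (auto simp: frac_def roofs_iff)
next
  assume "\<exists>s f. (s, f) \<in> roofs C J a b \<and> x = fr s f"
  then obtain s f where r: "(s, f) \<in> roofs C J a b" "x = fr s f" by blast
  then have "a \<in> obj C" "b \<in> obj C" using tgt_obj by (auto simp: roofs_iff)
  moreover have "x = (a, b, roof_rel C J a b `` {(s, f)})" using r by (simp add: frac_def roofs_iff)
  ultimately show "x \<in> Mor L a b" using r(1) by (auto simp: Mor_def L_simps intro: quotientI)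
qed

lemma frac_Mor: "(s, f) \<in> roofs C J a b \<Longrightarrow> fr s f \<in> Mor L a b"
  using L_Mor_iff by blast

text \<open>Composition and addition are saturations of whole sets of representatives. It suffices
  that all of them are related to one, and then the result is its class.\<close>

lemma roof_rel_Image_eq:
  assumes "r \<in> Z" "r \<in> roofs C J a b" "\<And>r'. r' \<in> Z \<Longrightarrow> (r, r') \<in> roof_rel C J a b"
  shows "roof_rel C J a b `` Z = roof_rel C J a b `` {r}"
proof -
  have "roof_rel C J a b `` {r'} = roof_rel C J a b `` {r}" if zin: "r' \<in> Z" for r'
    using equiv_class_eq[OF equiv_roof_rel assms(3)[OF that]] by simp
  then show ?thesis using assms(1) by blast
qed

text \<open>Well-definedness of composition, in a form that computes with any chosen Ore square. The
  left legs are compared by Ore squares alone; the right legs agree at first only after composition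
  with a denominator, which has to be cancelled by further refinement.\<close>

lemma frac_comp_eq:
  assumes r: "(s, f) \<in> roofs C J a b" "(t, g) \<in> roofs C J b c"
    and w: "w \<in> S" "tgt C w = src C s" "h \<in> arr C" "src C h = src C w" "tgt C h = src C t"
      "f \<cdot> w = t \<cdot> h"
  shows "fr t g \<cdot>\<^bsub>L\<^esub> fr s f = fr (s \<cdot> w) (g \<cdot> h)"
proof -
  define X where "X = roof_rel C J a b `` {(s, f)}"
  define Y where "Y = roof_rel C J b c `` {(t, g)}"
  define Z where "Z = {(s \<cdot> w, g \<cdot> h) |s f t g w h.
           (s, f) \<in> X \<and> (t, g) \<in> Y \<and> w \<in> S \<and>
           w \<in> Mor C (src C w) (src C s) \<and> h \<in> Mor C (src C w) (src C t) \<and>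
           f \<cdot> w = t \<cdot> h}"
  have fX: "fr s f = (a, b, X)" "fr t g = (b, c, Y)"
    using r by (simp_all add: frac_def X_def Y_def roofs_iff)
  have rr: "(s \<cdot> w, g \<cdot> h) \<in> roofs C J a c" using r w S_comp by (simp add: roofs_iff)
  have "(s, f) \<in> X" "(t, g) \<in> Y"
    unfolding X_def Y_def using equiv_class_self[OF equiv_roof_rel] r by auto
  moreover have "w \<in> Mor C (src C w) (src C s)" "h \<in> Mor C (src C w) (src C t)"
    using w by (simp_all add: Mor_iff)
  ultimately have inZ: "(s \<cdot> w, g \<cdot> h) \<in> Z" unfolding Z_def using w(1,6)
    by (intro CollectI exI[of _ s] exI[of _ f] exI[of _ t] exI[of _ g] exI[of _ w] exI[of _ h]
        conjI refl)
  have rel: "((s \<cdot> w, g \<cdot> h), r') \<in> roof_rel C J a c" if zin: "r' \<in> Z" for r'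
  proof -
    obtain s' f' t' g' w' h' where z0: "r' = (s' \<cdot> w', g' \<cdot> h')" "(s', f') \<in> X" "(t', g') \<in> Y"
        "w' \<in> S" "w' \<in> Mor C (src C w') (src C s')" "h' \<in> Mor C (src C w') (src C t')"
        "f' \<cdot> w' = t' \<cdot> h'"
      using zin unfolding Z_def by blast
    have z: "((s, f), (s', f')) \<in> roof_rel C J a b" "((t, g), (t', g')) \<in> roof_rel C J b c"
        "w' \<in> S" "tgt C w' = src C s'" "h' \<in> arr C" "src C h' = src C w'" "tgt C h' = src C t'"
      using z0 by (simp_all add: X_def Y_def Mor_iff)
    have r': "(s', f') \<in> roofs C J a b" "(t', g') \<in> roofs C J b c"
      using z by (simp_all add: roof_rel_iff)
    obtain u u' where u: "u \<in> S" "u' \<in> S" "tgt C u = src C s" "tgt C u' = src C s'"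
        "src C u = src C u'" "s \<cdot> u = s' \<cdot> u'" "f \<cdot> u = f' \<cdot> u'"
      using z(1) unfolding roof_rel_iff by blast
    obtain v v' where v: "v \<in> S" "v' \<in> S" "tgt C v = src C t" "tgt C v' = src C t'"
        "src C v = src C v'" "t \<cdot> v = t' \<cdot> v'" "g \<cdot> v = g' \<cdot> v'"
      using z(2) unfolding roof_rel_iff by blast
    \<comment> \<open>Three Ore squares bring the comparison of \<open>s\<close> with
      \<open>s'\<close> and the two choices \<open>w\<close> and \<open>w'\<close> to the common
      source \<open>src C k\<close>.\<close>
    obtain x y where x: "x \<in> S" "tgt C x = src C u" "y \<in> S" "src C y = src C x" "tgt C y = src C w"
        "u \<cdot> x = w \<cdot> y"
      using ore2[of u w] u w by metis
    obtain x' y' where x': "x' \<in> S" "tgt C x' = src C u'" "y' \<in> S" "src C y' = src C x'"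
        "tgt C y' = src C w'" "u' \<cdot> x' = w' \<cdot> y'"
      using ore2[of u' w'] u z by metis
    obtain k k' where k: "k \<in> S" "tgt C k = src C x" "k' \<in> S" "src C k' = src C k"
        "tgt C k' = src C x'" "x \<cdot> k = x' \<cdot> k'"
      using ore2[of x x'] x x' u by metis
    note D = r[unfolded roofs_iff] r'[unfolded roofs_iff] w(1-5) z(3-7) u(1-5) v(1-5) x(1-5) x'(1-5)
      k(1-5)
    have wy: "w \<cdot> y \<cdot> k = u \<cdot> x \<cdot> k" by (simp add: D comp_eq_comp[OF x(6)])
    have wy': "w' \<cdot> y' \<cdot> k' = u' \<cdot> x \<cdot> k" by (simp add: D k(6) comp_eq_comp[OF x'(6)])
    have E1: "s \<cdot> w \<cdot> y \<cdot> k = s' \<cdot> w' \<cdot> y' \<cdot> k'"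
      by (simp add: D wy wy' comp_eq_comp[OF u(6)])
    have "t \<cdot> h \<cdot> y \<cdot> k = f \<cdot> w \<cdot> y \<cdot> k" by (simp add: D comp_eq_comp[OF w(6)])
    also have "\<dots> = f' \<cdot> w' \<cdot> y' \<cdot> k'" by (simp add: D wy wy' comp_eq_comp[OF u(7)])
    also have "\<dots> = t' \<cdot> h' \<cdot> y' \<cdot> k'" by (simp add: D comp_eq_comp[OF z0(7)])
    finally have E2: "t \<cdot> h \<cdot> y \<cdot> k = t' \<cdot> h' \<cdot> y' \<cdot> k'" .
    define A where "A = h \<cdot> y \<cdot> k"
    define A' where "A' = h' \<cdot> y' \<cdot> k'"
    have A: "A \<in> arr C" "src C A = src C k" "tgt C A = src C t" "A' \<in> arr C" "src C A' = src C k"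
        "tgt C A' = src C t'" "t \<cdot> A = t' \<cdot> A'"
      by (simp_all add: A_def A'_def D E2)
    \<comment> \<open>A further refinement \<open>r1\<close> makes \<open>A\<close> factor through
      \<open>v\<close>, after which \<open>g\<close> and \<open>g'\<close> are known to
      agree.\<close>
    have "v \<in> S" "tgt C A = tgt C v" using A v by simp_all
    then obtain r1 B where r1: "r1 \<in> S" "tgt C r1 = src C A" "B \<in> Mor C (src C r1) (src C v)"
        "A \<cdot> r1 = v \<cdot> B"
      using ore[OF A(1)] by blast
    note D' = D A(1-6) r1(1-2) r1(3)[unfolded Mor_iff]
    have "t' \<cdot> A' \<cdot> r1 = t \<cdot> A \<cdot> r1" by (simp add: D' comp_eq_comp[OF A(7)])
    also have "\<dots> = t' \<cdot> v' \<cdot> B" by (simp add: D' r1(4) comp_eq_comp[OF v(6)])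
    finally have "t' \<cdot> A' \<cdot> r1 = t' \<cdot> v' \<cdot> B" .
    \<comment> \<open>The denominator \<open>t'\<close> need not be monic; it is cancelled at the
      price of the refinement \<open>r2\<close>.\<close>
    then obtain r2 where r2: "r2 \<in> S" "tgt C r2 = src C (A' \<cdot> r1)" "(A' \<cdot> r1) \<cdot> r2 = (v' \<cdot> B) \<cdot> r2"
      by (rule S_equalize[rotated]) (simp_all add: D')
    have r2': "tgt C r2 = src C r1" using r2(2) by (simp add: D')
    note D' = D' r2(1) r2'
    have Ar: "A' \<cdot> r1 \<cdot> r2 = v' \<cdot> B \<cdot> r2" using r2(3) by (simp add: D')
    have "g \<cdot> A \<cdot> r1 \<cdot> r2 = g' \<cdot> A' \<cdot> r1 \<cdot> r2"
      by (simp add: D' Ar comp_eq_comp[OF r1(4)] comp_eq_comp[OF v(7)])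
    then have E3: "g \<cdot> h \<cdot> y \<cdot> k \<cdot> r1 \<cdot> r2 = g' \<cdot> h' \<cdot> y' \<cdot> k' \<cdot> r1 \<cdot> r2"
      unfolding A_def A'_def by (simp add: D r1(1) r2(1) r2' r1(2)[unfolded A_def])
    note D' = D r1(1) r1(2)[unfolded A(2)] r2(1) r2'
    have rr': "(s' \<cdot> w', g' \<cdot> h') \<in> roofs C J a c" by (simp add: roofs_iff S_comp D)
    show ?thesis unfolding z0(1)
    proof (rule roof_relI[OF rr rr'])
      show "y \<cdot> k \<cdot> r1 \<cdot> r2 \<in> S" "y' \<cdot> k' \<cdot> r1 \<cdot> r2 \<in> S" by (auto intro!: S_comp simp: D')
      show "(s \<cdot> w) \<cdot> y \<cdot> k \<cdot> r1 \<cdot> r2 = (s' \<cdot> w') \<cdot> y' \<cdot> k' \<cdot> r1 \<cdot> r2"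
        using arg_cong[OF E1, of "\<lambda>q. q \<cdot> r1 \<cdot> r2"] by (simp add: D')
      show "(g \<cdot> h) \<cdot> y \<cdot> k \<cdot> r1 \<cdot> r2 = (g' \<cdot> h') \<cdot> y' \<cdot> k' \<cdot> r1 \<cdot> r2"
        by (simp add: D' E3)
    qed (simp_all add: D')
  qed
  have "fr t g \<cdot>\<^bsub>L\<^esub> fr s f = (a, c, roof_rel C J a c `` Z)"
    by (simp add: fX L_simps frac_comp_def Z_def)
  also have "\<dots> = fr (s \<cdot> w) (g \<cdot> h)"
    using roof_rel_Image_eq[OF inZ rr rel] rr by (simp add: frac_def roofs_iff)
  finally show ?thesis .
qed

lemma frac_add_eq:
  assumes r: "(s, f) \<in> roofs C J a b" "(s, g) \<in> roofs C J a b"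
  shows "fr s f \<oplus>\<^bsub>L\<^esub> fr s g = fr s (f \<oplus> g)"
proof -
  define X where "X = roof_rel C J a b `` {(s, f)}"
  define Y where "Y = roof_rel C J a b `` {(s, g)}"
  define Z where "Z = {(s, f \<oplus> g) |s f g. (s, f) \<in> X \<and> (s, g) \<in> Y}"
  have fX: "fr s f = (a, b, X)" "fr s g = (a, b, Y)"
    using r by (simp_all add: frac_def X_def Y_def roofs_iff)
  have rr: "(s, f \<oplus> g) \<in> roofs C J a b" using r by (simp add: roofs_iff)
  have "(s, f) \<in> X" "(s, g) \<in> Y"
    unfolding X_def Y_def using equiv_class_self[OF equiv_roof_rel] r by auto
  then have inZ: "(s, f \<oplus> g) \<in> Z" unfolding Z_def by auto
  have rel: "((s, f \<oplus> g), r') \<in> roof_rel C J a b" if zin: "r' \<in> Z" for r'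
  proof -
    obtain s' f' g' where z: "r' = (s', f' \<oplus> g')" "((s, f), (s', f')) \<in> roof_rel C J a b"
        "((s, g), (s', g')) \<in> roof_rel C J a b"
      using zin unfolding Z_def X_def Y_def by blast
    have r': "(s', f') \<in> roofs C J a b" "(s', g') \<in> roofs C J a b"
      using z by (simp_all add: roof_rel_iff)
    obtain u u' where u: "u \<in> S" "u' \<in> S" "tgt C u = src C s" "tgt C u' = src C s'"
        "src C u = src C u'" "s \<cdot> u = s' \<cdot> u'" "f \<cdot> u = f' \<cdot> u'"
      using z(2) unfolding roof_rel_iff by blast
    obtain v v' where v: "v \<in> S" "v' \<in> S" "tgt C v = src C s" "tgt C v' = src C s'"
        "src C v = src C v'" "s \<cdot> v = s' \<cdot> v'" "g \<cdot> v = g' \<cdot> v'"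
      using z(3) unfolding roof_rel_iff by blast
    obtain w x where w: "w \<in> S" "tgt C w = src C u'" "x \<in> S" "src C x = src C w" "tgt C x = src C v'"
        "u' \<cdot> w = v' \<cdot> x"
      using ore2[of u' v'] u v by metis
    note D = r[unfolded roofs_iff] r'[unfolded roofs_iff] u(1-5) v(1-5) w(1-5)
    \<comment> \<open>The two equivalences come with unrelated refinements \<open>u\<close> and
      \<open>v\<close>. These agree after \<open>s\<close>, hence after a refinement
      \<open>q\<close>, and then both numerators are compared along the same arrow.\<close>
    have "s \<cdot> u \<cdot> w = s \<cdot> v \<cdot> x"
      by (simp add: D w(6) comp_eq_comp[OF u(6)] comp_eq_comp[OF v(6)])
    then obtain q where q: "q \<in> S" "tgt C q = src C (u \<cdot> w)" "(u \<cdot> w) \<cdot> q = (v \<cdot> x) \<cdot> q"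
      by (rule S_equalize[rotated]) (simp_all add: D)
    have q2: "tgt C q = src C w" using q(2) by (simp add: D)
    note D = D q(1) q2
    have w': "u' \<cdot> w \<cdot> q = v' \<cdot> x \<cdot> q" by (simp add: D comp_eq_comp[OF w(6)])
    have q': "u \<cdot> w \<cdot> q = v \<cdot> x \<cdot> q" using q(3) by (simp add: D)
    have rr': "(s', f' \<oplus> g') \<in> roofs C J a b" by (simp add: roofs_iff D)
    have F: "f \<cdot> u \<cdot> w \<cdot> q = f' \<cdot> u' \<cdot> w \<cdot> q"
      by (simp add: D comp_eq_comp[OF u(7)])
    have G: "g \<cdot> u \<cdot> w \<cdot> q = g' \<cdot> u' \<cdot> w \<cdot> q"
      by (simp add: D w' q' comp_eq_comp[OF v(7)])
    show ?thesis unfolding z(1)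
    proof (rule roof_relI[OF rr rr'])
      show "u \<cdot> w \<cdot> q \<in> S" "u' \<cdot> w \<cdot> q \<in> S" by (auto intro!: S_comp simp: D)
      show "s \<cdot> u \<cdot> w \<cdot> q = s' \<cdot> u' \<cdot> w \<cdot> q"
        by (simp add: D comp_eq_comp[OF u(6)])
      show "(f \<oplus> g) \<cdot> u \<cdot> w \<cdot> q = (f' \<oplus> g') \<cdot> u' \<cdot> w \<cdot> q"
        by (simp add: D F G)
    qed (simp_all add: D)
  qed
  have "fr s f \<oplus>\<^bsub>L\<^esub> fr s g = (a, b, roof_rel C J a b `` Z)"
    by (simp add: fX L_simps frac_add_def Z_def)
  also have "\<dots> = fr s (f \<oplus> g)"
    using roof_rel_Image_eq[OF inZ rr rel] rr by (simp add: frac_def roofs_iff)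
  finally show ?thesis .
qed

end

section \<open>The quotient as a preadditive category\<close>

context verdier
begin

lemma L_Mor_E:
  assumes "x \<in> Mor L a b"
  obtains s f where "(s, f) \<in> roofs C J a b" "x = fr s f"
  using assms L_Mor_iff by blast

lemma common_denominator:
  assumes "x \<in> Mor L a b" "y \<in> Mor L a c"
  obtains s f g where "(s, f) \<in> roofs C J a b" "(s, g) \<in> roofs C J a c" "x = fr s f" "y = fr s g"
proof -
  obtain s f where x: "(s, f) \<in> roofs C J a b" "x = fr s f" using assms(1) by (rule L_Mor_E)
  obtain t g where y: "(t, g) \<in> roofs C J a c" "y = fr t g" using assms(2) by (rule L_Mor_E)
  have "s \<in> S" "t \<in> S" "tgt C s = tgt C t" using x y by (simp_all add: roofs_iff)
  then obtain w h where w: "w \<in> S" "tgt C w = src C s" "h \<in> S" "src C h = src C w" "tgt C h = src C t"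
      "s \<cdot> w = t \<cdot> h"
    by (rule ore2)
  note D = x(1)[unfolded roofs_iff] y(1)[unfolded roofs_iff] w(1-5)
  have "x = fr (s \<cdot> w) (f \<cdot> w)" using frac_refine[OF x(1) w(1,2)] x by simp
  moreover have "y = fr (s \<cdot> w) (g \<cdot> h)" using frac_refine[OF y(1) w(3,5)] y w(6) by simp
  moreover have "(s \<cdot> w, f \<cdot> w) \<in> roofs C J a b" "(s \<cdot> w, g \<cdot> h) \<in> roofs C J a c"
    by (simp_all add: roofs_iff D S_comp)
  ultimately show ?thesis using that by blast
qed

lemma common_denominator3:
  assumes "x \<in> Mor L a b" "y \<in> Mor L a b" "z \<in> Mor L a b"
  obtains s f g h where "(s, f) \<in> roofs C J a b" "(s, g) \<in> roofs C J a b" "(s, h) \<in> roofs C J a b"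
    "x = fr s f" "y = fr s g" "z = fr s h"
proof -
  obtain s f g where x: "(s, f) \<in> roofs C J a b" "(s, g) \<in> roofs C J a b" "x = fr s f" "y = fr s g"
    using common_denominator[OF assms(1,2)] .
  obtain t h where z: "(t, h) \<in> roofs C J a b" "z = fr t h" using assms(3) by (rule L_Mor_E)
  have "s \<in> S" "t \<in> S" "tgt C s = tgt C t" using x z by (simp_all add: roofs_iff)
  then obtain w k where w: "w \<in> S" "tgt C w = src C s" "k \<in> S" "src C k = src C w" "tgt C k = src C t"
      "s \<cdot> w = t \<cdot> k"
    by (rule ore2)
  note D = x(1,2)[unfolded roofs_iff] z(1)[unfolded roofs_iff] w(1-5)
  have "x = fr (s \<cdot> w) (f \<cdot> w)" using frac_refine[OF x(1) w(1,2)] x by simp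
  moreover have "y = fr (s \<cdot> w) (g \<cdot> w)" using frac_refine[OF x(2) w(1,2)] x by simp
  moreover have "z = fr (s \<cdot> w) (h \<cdot> k)" using frac_refine[OF z(1) w(3,5)] z w(6) by simp
  moreover have "(s \<cdot> w, f \<cdot> w) \<in> roofs C J a b" "(s \<cdot> w, g \<cdot> w) \<in> roofs C J a b"
    "(s \<cdot> w, h \<cdot> k) \<in> roofs C J a b"
    by (simp_all add: roofs_iff D S_comp)
  ultimately show ?thesis using that by blast
qed

lemma composable_roofs:
  assumes "(s, f) \<in> roofs C J a b" "(t, g) \<in> roofs C J b c"
  obtains w h where "w \<in> S" "tgt C w = src C s" "h \<in> arr C" "src C h = src C w" "tgt C h = src C t"
    "f \<cdot> w = t \<cdot> h" "(s \<cdot> w, g \<cdot> h) \<in> roofs C J a c"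
proof -
  obtain w h where w: "w \<in> S" "tgt C w = src C f" "h \<in> Mor C (src C w) (src C t)" "f \<cdot> w = t \<cdot> h"
    using ore[of f t] assms by (auto simp: roofs_iff)
  note D = assms[unfolded roofs_iff] w(1,2) w(3)[unfolded Mor_iff]
  show ?thesis by (rule that[OF w(1) _ _ _ _ w(4)]) (simp_all add: D roofs_iff S_comp)
qed

lemma ident_roof: "a \<in> obj C \<Longrightarrow> (ident C a, ident C a) \<in> roofs C J a a"
  by (simp add: roofs_iff)

lemma zero_roof: "a \<in> obj C \<Longrightarrow> b \<in> obj C \<Longrightarrow> (ident C a, mzero C a b) \<in> roofs C J a b"
  by (simp add: roofs_iff)

lemma L_comp_Mor:
  assumes "x \<in> Mor L a b" "y \<in> Mor L b c"
  shows "y \<cdot>\<^bsub>L\<^esub> x \<in> Mor L a c"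
proof -
  obtain s f where x: "(s, f) \<in> roofs C J a b" "x = fr s f" using assms(1) by (rule L_Mor_E)
  obtain t g where y: "(t, g) \<in> roofs C J b c" "y = fr t g" using assms(2) by (rule L_Mor_E)
  obtain w h where w: "w \<in> S" "tgt C w = src C s" "h \<in> arr C" "src C h = src C w" "tgt C h = src C t"
    "f \<cdot> w = t \<cdot> h" "(s \<cdot> w, g \<cdot> h) \<in> roofs C J a c"
    by (rule composable_roofs[OF x(1) y(1)])
  show ?thesis unfolding x y frac_comp_eq[OF x(1) y(1) w(1-6)] by (rule frac_Mor[OF w(7)])
qed

lemma L_comp_assoc:
  assumes "x \<in> Mor L a b" "y \<in> Mor L b c" "z \<in> Mor L c d"
  shows "(z \<cdot>\<^bsub>L\<^esub> y) \<cdot>\<^bsub>L\<^esub> x = z \<cdot>\<^bsub>L\<^esub> (y \<cdot>\<^bsub>L\<^esub> x)"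
proof -
  obtain s f where x: "(s, f) \<in> roofs C J a b" "x = fr s f" using assms(1) by (rule L_Mor_E)
  obtain t g where y: "(t, g) \<in> roofs C J b c" "y = fr t g" using assms(2) by (rule L_Mor_E)
  obtain r k where z: "(r, k) \<in> roofs C J c d" "z = fr r k" using assms(3) by (rule L_Mor_E)
  obtain w h where w: "w \<in> S" "tgt C w = src C t" "h \<in> arr C" "src C h = src C w" "tgt C h = src C r"
    "g \<cdot> w = r \<cdot> h" "(t \<cdot> w, k \<cdot> h) \<in> roofs C J b d"
    by (rule composable_roofs[OF y(1) z(1)])
  obtain v j where v: "v \<in> S" "tgt C v = src C s" "j \<in> arr C" "src C j = src C v" "tgt C j = src C (t \<cdot> w)"
    "f \<cdot> v = (t \<cdot> w) \<cdot> j" "(s \<cdot> v, (k \<cdot> h) \<cdot> j) \<in> roofs C J a d"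
    by (rule composable_roofs[OF x(1) w(7)])
  note R = x(1)[unfolded roofs_iff] y(1)[unfolded roofs_iff] z(1)[unfolded roofs_iff]
  have j: "tgt C j = src C w" using v(5) R w by simp
  note D = R w(1-5) v(1-4) j
  have sv: "src C v \<in> obj C" using v(1) src_obj by simp
  have 1: "(z \<cdot>\<^bsub>L\<^esub> y) \<cdot>\<^bsub>L\<^esub> x = fr (s \<cdot> v) ((k \<cdot> h) \<cdot> j)"
    unfolding x y z frac_comp_eq[OF y(1) z(1) w(1-6)] by (rule frac_comp_eq[OF x(1) w(7) v(1-6)])
  have yx: "fr t g \<cdot>\<^bsub>L\<^esub> fr s f = fr (s \<cdot> v) (g \<cdot> (w \<cdot> j))"
    by (rule frac_comp_eq[OF x(1) y(1)]) (simp_all add: D v(6))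
  have r: "(s \<cdot> v, g \<cdot> (w \<cdot> j)) \<in> roofs C J a c" by (simp add: roofs_iff D S_comp)
  have "z \<cdot>\<^bsub>L\<^esub> (y \<cdot>\<^bsub>L\<^esub> x) = fr ((s \<cdot> v) \<cdot> ident C (src C v)) (k \<cdot> (h \<cdot> j))"
    unfolding x y z yx
    by (rule frac_comp_eq[OF r z(1)]) (simp_all add: D sv comp_eq_comp[OF w(6)])
  then show ?thesis unfolding 1 by (simp add: D sv)
qed

lemma L_category: "category L"
proof
  fix f assume "f \<in> arr L"
  then show "src L f \<in> obj L" "tgt L f \<in> obj L" by (auto simp: L_simps)
next
  fix a assume "a \<in> obj L"
  then show "ident L a \<in> Mor L a a" using frac_Mor[OF ident_roof] by (simp add: L_simps)
next
  fix x a b assume "x \<in> Mor L a b"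
  then obtain s f where x: "(s, f) \<in> roofs C J a b" "x = fr s f" by (rule L_Mor_E)
  have o: "a \<in> obj C" "b \<in> obj C" "src C s \<in> obj C"
    using x(1) tgt_obj[of s] tgt_obj[of f] src_obj[of s] by (simp_all add: roofs_iff)
  note D = x(1)[unfolded roofs_iff] o
  have "x \<cdot>\<^bsub>L\<^esub> ident L a = fr (ident C a \<cdot> s) (f \<cdot> ident C (src C s))"
    unfolding x(2) L_simps(5)
    by (rule frac_comp_eq[OF ident_roof x(1)]) (simp_all add: D)
  then show "x \<cdot>\<^bsub>L\<^esub> ident L a = x" using x(2) by (simp add: D)
  have "ident L b \<cdot>\<^bsub>L\<^esub> x = fr (s \<cdot> ident C (src C s)) (ident C b \<cdot> f)"
    unfolding x(2) L_simps(5)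
    by (rule frac_comp_eq[OF x(1) ident_roof]) (simp_all add: D)
  then show "ident L b \<cdot>\<^bsub>L\<^esub> x = x" using x(2) by (simp add: D)
qed (rule L_comp_Mor L_comp_assoc; assumption)+

lemma L_add_Mor: "x \<in> Mor L a b \<Longrightarrow> y \<in> Mor L a b \<Longrightarrow> x \<oplus>\<^bsub>L\<^esub> y \<in> Mor L a b"
proof -
  assume "x \<in> Mor L a b" "y \<in> Mor L a b"
  then obtain s f g where x: "(s, f) \<in> roofs C J a b" "(s, g) \<in> roofs C J a b" "x = fr s f" "y = fr s g"
    by (rule common_denominator)
  have "(s, f \<oplus> g) \<in> roofs C J a b" using x by (simp add: roofs_iff)
  then show "x \<oplus>\<^bsub>L\<^esub> y \<in> Mor L a b" using x frac_add_eq frac_Mor by simp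
qed

lemma frac_zero:
  assumes "s \<in> S" "b \<in> obj C"
  shows "fr s (mzero C (src C s) b) = mzero L (tgt C s) b"
proof -
  have o: "tgt C s \<in> obj C" using assms tgt_obj by simp
  have "fr (ident C (tgt C s) \<cdot> s) (mzero C (tgt C s) b \<cdot> s) = fr (ident C (tgt C s)) (mzero C (tgt C s) b)"
    by (rule frac_refine[OF zero_roof]) (use assms o in auto)
  then show ?thesis using assms o by (simp add: L_simps)
qed

lemma L_comm_group:
  assumes "a \<in> obj L" "b \<in> obj L"
  shows "comm_group (Mor_group L a b)"
proof (rule comm_groupI)
  have o: "a \<in> obj C" "b \<in> obj C" using assms by (simp_all add: L_simps)
  let ?G = "Mor_group L a b"
  have G: "carrier ?G = Mor L a b" "mult ?G = madd L" "one ?G = mzero L a b"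
    by (simp_all add: Mor_group_def)
  show "\<one>\<^bsub>?G\<^esub> \<in> carrier ?G" using o by (simp add: G L_simps(8) frac_Mor zero_roof)
  fix x y assume x: "x \<in> carrier ?G" "y \<in> carrier ?G"
  show "mult ?G x y \<in> carrier ?G" using x L_add_Mor by (simp add: G)
  obtain s f g where f: "(s, f) \<in> roofs C J a b" "(s, g) \<in> roofs C J a b" "x = fr s f" "y = fr s g"
    using common_denominator[OF x[unfolded G]] .
  show "mult ?G x y = mult ?G y x"
    unfolding G f frac_add_eq[OF f(1,2)] frac_add_eq[OF f(2,1)]
    using madd_commute[of f g] f(1,2) by (simp add: roofs_iff)
  have z: "mzero L a b = fr s (mzero C (src C s) b)" "(s, mzero C (src C s) b) \<in> roofs C J a b"
    using frac_zero[of s b] f(1) o src_obj[of s] by (simp_all add: roofs_iff)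
  show "mult ?G \<one>\<^bsub>?G\<^esub> x = x"
    unfolding G f z(1) frac_add_eq[OF z(2) f(1)] using f(1) by (simp add: roofs_iff)
  have n: "(s, \<ominus> f) \<in> roofs C J a b" using f(1) by (simp add: roofs_iff)
  show "\<exists>y \<in> carrier ?G. mult ?G y x = \<one>\<^bsub>?G\<^esub>"
    unfolding G f(3) z(1)
    by (rule bexI[OF _ frac_Mor[OF n]]) (use frac_add_eq[OF n f(1)] f(1) in \<open>simp add: roofs_iff\<close>)
  fix z assume z: "z \<in> carrier ?G"
  obtain s f g h where f: "(s, f) \<in> roofs C J a b" "(s, g) \<in> roofs C J a b"
      "(s, h) \<in> roofs C J a b" "x = fr s f" "y = fr s g" "z = fr s h"
    using common_denominator3[OF x[unfolded G] z[unfolded G]] .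
  have "(s, f \<oplus> g) \<in> roofs C J a b" "(s, g \<oplus> h) \<in> roofs C J a b"
    using f by (simp_all add: roofs_iff)
  then show "mult ?G (mult ?G x y) z = mult ?G x (mult ?G y z)"
    using f frac_add_eq by (simp add: G roofs_iff)
qed

text \<open>The numerators \<open>f\<close> and \<open>g\<close> have unrelated Ore squares against
  \<open>t\<close>. Forming the second over the refined denominator \<open>s \<cdot> w\<close> gives
  all composites the denominator \<open>s \<cdot> w \<cdot> v\<close>.\<close>

lemma L_comp_add_left:
  assumes "x \<in> Mor L a b" "y \<in> Mor L a b" "z \<in> Mor L b c"
  shows "z \<cdot>\<^bsub>L\<^esub> (x \<oplus>\<^bsub>L\<^esub> y) = z \<cdot>\<^bsub>L\<^esub> x \<oplus>\<^bsub>L\<^esub> z \<cdot>\<^bsub>L\<^esub> y"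
proof -
  obtain s f g where x: "(s, f) \<in> roofs C J a b" "(s, g) \<in> roofs C J a b" "x = fr s f" "y = fr s g"
    using assms(1,2) by (rule common_denominator)
  obtain t k where z: "(t, k) \<in> roofs C J b c" "z = fr t k" using assms(3) by (rule L_Mor_E)
  obtain w h where w: "w \<in> S" "tgt C w = src C s" "h \<in> arr C" "src C h = src C w" "tgt C h = src C t"
    "f \<cdot> w = t \<cdot> h" "(s \<cdot> w, k \<cdot> h) \<in> roofs C J a c"
    by (rule composable_roofs[OF x(1) z(1)])
  have r: "(s \<cdot> w, g \<cdot> w) \<in> roofs C J a b" using x w S_comp by (simp add: roofs_iff)
  obtain v j where v: "v \<in> S" "tgt C v = src C (s \<cdot> w)" "j \<in> arr C" "src C j = src C v" "tgt C j = src C t"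
    "(g \<cdot> w) \<cdot> v = t \<cdot> j" "((s \<cdot> w) \<cdot> v, k \<cdot> j) \<in> roofs C J a c"
    by (rule composable_roofs[OF r z(1)])
  note R = x(1,2)[unfolded roofs_iff] z(1)[unfolded roofs_iff]
  have v2: "tgt C v = src C w" using v(2) R w by simp
  note D = R w(1-5) v(1,3-5) v2
  have e: "g \<cdot> w \<cdot> v = t \<cdot> j" using v(6) by (simp add: D)
  have 1: "z \<cdot>\<^bsub>L\<^esub> x = fr (s \<cdot> w \<cdot> v) (k \<cdot> h \<cdot> v)" unfolding x(3) z(2)
    by (rule frac_comp_eq[OF x(1) z(1)]) (simp_all add: D S_comp comp_eq_comp[OF w(6)])
  have 2: "z \<cdot>\<^bsub>L\<^esub> y = fr (s \<cdot> w \<cdot> v) (k \<cdot> j)" unfolding x(4) z(2)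
    by (rule frac_comp_eq[OF x(2) z(1)]) (simp_all add: D S_comp e)
  have s: "(s, f \<oplus> g) \<in> roofs C J a b" by (simp add: roofs_iff D)
  have 3: "z \<cdot>\<^bsub>L\<^esub> (x \<oplus>\<^bsub>L\<^esub> y) = fr (s \<cdot> w \<cdot> v) (k \<cdot> (h \<cdot> v \<oplus> j))"
    unfolding x(3,4) z(2) frac_add_eq[OF x(1,2)]
    by (rule frac_comp_eq[OF s z(1)]) (simp_all add: D S_comp e comp_eq_comp[OF w(6)])
  have "fr (s \<cdot> w \<cdot> v) (k \<cdot> h \<cdot> v) \<oplus>\<^bsub>L\<^esub> fr (s \<cdot> w \<cdot> v) (k \<cdot> j) = fr (s \<cdot> w \<cdot> v) (k \<cdot> h \<cdot> v \<oplus> k \<cdot> j)"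
    by (rule frac_add_eq[of _ _ a c]) (simp_all add: roofs_iff D S_comp)
  then show ?thesis unfolding 1 2 3 by (simp add: D)
qed

lemma L_comp_add_right:
  assumes "x \<in> Mor L a b" "y \<in> Mor L b c" "z \<in> Mor L b c"
  shows "(y \<oplus>\<^bsub>L\<^esub> z) \<cdot>\<^bsub>L\<^esub> x = y \<cdot>\<^bsub>L\<^esub> x \<oplus>\<^bsub>L\<^esub> z \<cdot>\<^bsub>L\<^esub> x"
proof -
  obtain t g k where y: "(t, g) \<in> roofs C J b c" "(t, k) \<in> roofs C J b c" "y = fr t g" "z = fr t k"
    using assms(2,3) by (rule common_denominator)
  obtain s f where x: "(s, f) \<in> roofs C J a b" "x = fr s f" using assms(1) by (rule L_Mor_E)
  obtain w h where w: "w \<in> S" "tgt C w = src C s" "h \<in> arr C" "src C h = src C w" "tgt C h = src C t"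
    "f \<cdot> w = t \<cdot> h" "(s \<cdot> w, g \<cdot> h) \<in> roofs C J a c"
    by (rule composable_roofs[OF x(1) y(1)])
  note D = y(1,2)[unfolded roofs_iff] x(1)[unfolded roofs_iff] w(1-5)
  have r: "(t, g \<oplus> k) \<in> roofs C J b c" "(s \<cdot> w, k \<cdot> h) \<in> roofs C J a c"
    by (simp_all add: roofs_iff D S_comp)
  have "(y \<oplus>\<^bsub>L\<^esub> z) \<cdot>\<^bsub>L\<^esub> x = fr (s \<cdot> w) ((g \<oplus> k) \<cdot> h)"
    unfolding x(2) y(3,4) frac_add_eq[OF y(1,2)] by (rule frac_comp_eq[OF x(1) r(1) w(1-6)])
  also have "\<dots> = fr (s \<cdot> w) (g \<cdot> h) \<oplus>\<^bsub>L\<^esub> fr (s \<cdot> w) (k \<cdot> h)"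
    unfolding frac_add_eq[OF w(7) r(2)] by (simp add: D)
  also have "\<dots> = y \<cdot>\<^bsub>L\<^esub> x \<oplus>\<^bsub>L\<^esub> z \<cdot>\<^bsub>L\<^esub> x"
    unfolding x(2) y(3,4) frac_comp_eq[OF x(1) y(1) w(1-6)] frac_comp_eq[OF x(1) y(2) w(1-6)] ..
  finally show ?thesis .
qed

lemma L_preadditive: "preadditive_category L"
  by (intro preadditive_category.intro L_category preadditive_category_axioms.intro
      L_comm_group L_comp_add_left L_comp_add_right)

end

sublocale verdier \<subseteq> L: preadditive_category "verdier_additive C J"
  by (rule L_preadditive)

section \<open>The localization functor and its kernel\<close>

context verdier
begin

lemma obj_L [simp]: "obj L = obj C"
  by (simp add: L_simps)

lemma Q_roof: "f \<in> arr C \<Longrightarrow> (ident C (src C f), f) \<in> roofs C J (src C f) (tgt C f)"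
  using src_obj by (simp add: roofs_iff)

lemma Q_arr [simp]:
  assumes "f \<in> arr C"
  shows "Q f \<in> arr L" "src L (Q f) = src C f" "tgt L (Q f) = tgt C f"
  using frac_Mor[OF Q_roof[OF assms]] by (auto simp: localize_arr_def L.Mor_iff)

lemma frac_arr [simp]:
  assumes "s \<in> S" "f \<in> arr C" "src C f = src C s"
  shows "fr s f \<in> arr L" "src L (fr s f) = tgt C s" "tgt L (fr s f) = tgt C f"
  using frac_Mor[of s f "tgt C s" "tgt C f"] assms by (auto simp: roofs_iff L.Mor_iff)

lemma Q_ident [simp]: "a \<in> obj C \<Longrightarrow> Q (ident C a) = ident L a"
  by (simp add: localize_arr_def L_simps)

lemma Q_mzero [simp]: "a \<in> obj C \<Longrightarrow> b \<in> obj C \<Longrightarrow> Q (mzero C a b) = mzero L a b"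
  by (simp add: localize_arr_def L_simps)

lemma Q_comp [simp]:
  assumes "f \<in> arr C" "g \<in> arr C" "src C g = tgt C f"
  shows "Q (g \<cdot> f) = Q g \<cdot>\<^bsub>L\<^esub> Q f"
proof -
  have o: "src C f \<in> obj C" "tgt C f \<in> obj C" using src_obj tgt_obj assms by auto
  have r: "(ident C (tgt C f), g) \<in> roofs C J (tgt C f) (tgt C g)" using Q_roof[of g] assms by simp
  have "fr (ident C (tgt C f)) g \<cdot>\<^bsub>L\<^esub> fr (ident C (src C f)) f
      = fr (ident C (src C f) \<cdot> ident C (src C f)) (g \<cdot> f)"
    by (rule frac_comp_eq[OF Q_roof[OF assms(1)] r]) (use assms o in auto)
  then show ?thesis using assms o by (simp add: localize_arr_def)
qed

lemma Q_madd [simp]: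
  assumes "f \<in> arr C" "g \<in> arr C" "src C g = src C f" "tgt C g = tgt C f"
  shows "Q (f \<oplus> g) = Q f \<oplus>\<^bsub>L\<^esub> Q g"
  using frac_add_eq[OF Q_roof[OF assms(1)], of g] Q_roof[OF assms(2)] assms
  by (simp add: localize_arr_def)

lemma Q_mneg [simp]: "f \<in> arr C \<Longrightarrow> Q (\<ominus> f) = \<ominus>\<^bsub>L\<^esub> (Q f)"
  using Q_madd[of f "\<ominus> f"] src_obj tgt_obj by (intro L.mneg_eqI) simp_all

text \<open>So \<open>fr s f\<close> is \<open>Q f\<close> after the inverse of \<open>Q s\<close>.
  Through \<open>L_Mor_roof\<close> and \<open>Q_epi\<close>, later arguments clear denominators
  instead of handling classes of roofs.\<close>

lemma frac_comp_Q:
  assumes "s \<in> S" "f \<in> arr C" "src C f = src C s"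
  shows "fr s f \<cdot>\<^bsub>L\<^esub> Q s = Q f"
proof -
  have o: "src C s \<in> obj C" using assms src_obj by simp
  have r: "(s, f) \<in> roofs C J (tgt C s) (tgt C f)" using assms by (simp add: roofs_iff)
  have "fr s f \<cdot>\<^bsub>L\<^esub> fr (ident C (src C s)) s = fr (ident C (src C s) \<cdot> ident C (src C s)) (f \<cdot> ident C (src C s))"
    by (rule frac_comp_eq[OF Q_roof r]) (use assms o in auto)
  then show ?thesis using assms o by (simp add: localize_arr_def)
qed

lemma Q_comp_frac:
  assumes "s \<in> S" "f \<in> arr C" "src C f = src C s" "g \<in> arr C" "src C g = tgt C f"
  shows "Q g \<cdot>\<^bsub>L\<^esub> fr s f = fr s (g \<cdot> f)"
proof -
  have o: "src C s \<in> obj C" "tgt C f \<in> obj C" using assms src_obj tgt_obj by auto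
  have r: "(s, f) \<in> roofs C J (tgt C s) (tgt C f)" using assms by (simp add: roofs_iff)
  have r': "(ident C (tgt C f), g) \<in> roofs C J (tgt C f) (tgt C g)" using Q_roof[of g] assms by simp
  have "fr (ident C (tgt C f)) g \<cdot>\<^bsub>L\<^esub> fr s f = fr (s \<cdot> ident C (src C s)) (g \<cdot> f)"
    by (rule frac_comp_eq[OF r r']) (use assms o in auto)
  then show ?thesis using assms o by (simp add: localize_arr_def)
qed

lemma frac_self: 
  assumes "s \<in> S"
  shows "fr s s = ident L (tgt C s)"
proof -
  have o: "tgt C s \<in> obj C" using assms tgt_obj by simp
  have "fr (ident C (tgt C s) \<cdot> s) (ident C (tgt C s) \<cdot> s) = fr (ident C (tgt C s)) (ident C (tgt C s))"
    by (rule frac_refine[OF ident_roof]) (use assms o in auto)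
  then show ?thesis using assms o by (simp add: L_simps)
qed

lemma Q_epi:
  assumes "x \<cdot>\<^bsub>L\<^esub> Q s = y \<cdot>\<^bsub>L\<^esub> Q s" "s \<in> S" "x \<in> Mor L (tgt C s) b" "y \<in> Mor L (tgt C s) b"
  shows "x = y"
proof -
  have o: "src C s \<in> obj C" "tgt C s \<in> obj C" using assms src_obj tgt_obj by auto
  let ?r = "fr s (ident C (src C s))"
  have r: "?r \<in> arr L" "src L ?r = tgt C s" "tgt L ?r = src C s" using assms o by simp_all
  have 1: "Q s \<cdot>\<^bsub>L\<^esub> ?r = ident L (tgt C s)"
    using Q_comp_frac[of s "ident C (src C s)" s] frac_self assms(2) o by simp
  have "(x \<cdot>\<^bsub>L\<^esub> Q s) \<cdot>\<^bsub>L\<^esub> ?r = (y \<cdot>\<^bsub>L\<^esub> Q s) \<cdot>\<^bsub>L\<^esub> ?r" using assms(1) by simp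
  then show ?thesis using r 1 assms(2-4) by (simp add: L.Mor_iff)
qed

lemma Q_Iso:
  assumes "s \<in> S"
  obtains r where "r \<in> Mor L (tgt C s) (src C s)" "Q s \<cdot>\<^bsub>L\<^esub> r = ident L (tgt C s)"
    "r \<cdot>\<^bsub>L\<^esub> Q s = ident L (src C s)"
proof -
  have o: "src C s \<in> obj C" "tgt C s \<in> obj C" using assms src_obj tgt_obj by auto
  let ?r = "fr s (ident C (src C s))"
  have "?r \<in> Mor L (tgt C s) (src C s)" using assms o by (simp add: L.Mor_iff)
  moreover have "Q s \<cdot>\<^bsub>L\<^esub> ?r = ident L (tgt C s)"
    using Q_comp_frac[of s "ident C (src C s)" s] frac_self assms o by simp
  moreover have "?r \<cdot>\<^bsub>L\<^esub> Q s = ident L (src C s)"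
    using frac_comp_Q[of s "ident C (src C s)"] assms o by simp
  ultimately show ?thesis using that by blast
qed

lemma L_Mor_roof:
  assumes "x \<in> Mor L a b"
  obtains s f where "s \<in> S" "tgt C s = a" "f \<in> Mor C (src C s) b" "x \<cdot>\<^bsub>L\<^esub> Q s = Q f" "x = fr s f"
  using assms by (elim L_Mor_E) (auto simp: roofs_iff Mor_iff frac_comp_Q)

lemma Q_zero_iff:
  assumes "f \<in> arr C"
  shows "Q f = mzero L (src C f) (tgt C f) \<longleftrightarrow> factors_through C J f"
proof
  have o: "src C f \<in> obj C" "tgt C f \<in> obj C" using assms src_obj tgt_obj by auto
  assume "Q f = mzero L (src C f) (tgt C f)"
  then have "fr (ident C (src C f)) f = fr (ident C (src C f)) (mzero C (src C f) (tgt C f))"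
    by (simp add: localize_arr_def L_simps)
  then obtain u u' where u: "u \<in> S" "u' \<in> S" "tgt C u = src C f" "tgt C u' = src C f"
      "src C u = src C u'" "f \<cdot> u = mzero C (src C f) (tgt C f) \<cdot> u'"
    unfolding frac_eq_iff[OF Q_roof[OF assms] zero_roof[OF o]] roof_rel_iff using o by auto
  then show "factors_through C J f"
    using killed_imp_factors[OF assms u(1,3)] o by simp
next
  have o: "src C f \<in> obj C" "tgt C f \<in> obj C" using assms src_obj tgt_obj by auto
  assume "factors_through C J f"
  then obtain r where r: "r \<in> S" "tgt C r = src C f" "f \<cdot> r = mzero C (src C r) (tgt C f)"
    by (rule factors_imp_killed)
  have "Q f = fr (ident C (src C f) \<cdot> r) (f \<cdot> r)"
    using frac_refine[OF Q_roof[OF assms], of r] r o by (simp add: localize_arr_def)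
  also have "\<dots> = mzero L (src C f) (tgt C f)" using r o frac_zero by simp
  finally show "Q f = mzero L (src C f) (tgt C f)" .
qed

lemma Q_eq_iff:
  assumes "f \<in> arr C" "g \<in> arr C" "src C g = src C f" "tgt C g = tgt C f"
  shows "Q f = Q g \<longleftrightarrow> factors_through C J (f \<oplus> \<ominus> g)"
proof -
  have "Q (f \<oplus> \<ominus> g) = mzero L (src C f) (tgt C f) \<longleftrightarrow> Q f = Q g"
    using assms L.diff_eq_zero[of "Q f" "Q g"] by auto
  then show ?thesis using Q_zero_iff[of "f \<oplus> \<ominus> g"] assms by simp
qed

lemma J_of_Q_ident_zero:
  assumes "a \<in> obj C" "ident L a = mzero L a a"
  shows "a \<in> J"
proof -
  have "factors_through C J (ident C a)" using Q_zero_iff[of "ident C a"] assms by simp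
  then obtain z p i where "z \<in> J" "p \<in> Mor C a z" "i \<in> Mor C z a" "i \<cdot> p = ident C a"
    unfolding factors_through_def using assms(1) by auto
  then show ?thesis using J_retract by blast
qed

text \<open>This is where thickness of \<open>J\<close> is needed: arrows inverted in the quotient have their cones
  in \<open>J\<close>.\<close>

lemma S_of_Q_Iso:
  assumes f: "f \<in> Mor C c a" and x: "x \<in> Mor L a c"
    and inv: "x \<cdot>\<^bsub>L\<^esub> Q f = ident L c" "Q f \<cdot>\<^bsub>L\<^esub> x = ident L a"
  shows "f \<in> S"
proof -
  obtain y k h where t: "tri C k f h y c a" by (rule ex_fiber[OF f])
  note R = tri_rotate[OF t]
  note D = triD[OF t] x[unfolded L.Mor_iff]
  have "x \<cdot>\<^bsub>L\<^esub> Q f \<cdot>\<^bsub>L\<^esub> Q k = mzero L y c"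
    using arg_cong[OF tri_comp(1)[OF t], of Q] D by simp
  then have "Q k = mzero L y c" using L.comp_eq_arr[OF inv(1), of "Q k"] D by simp
  then have "factors_through C J k" using Q_zero_iff[of k] D by simp
  then obtain r where r: "r \<in> S" "tgt C r = y" "k \<cdot> r = mzero C (src C r) c"
    using factors_imp_killed[of k] D by auto
  have ro: "src C r \<in> obj C" using r src_obj by simp
  have "Q h \<cdot>\<^bsub>L\<^esub> Q f \<cdot>\<^bsub>L\<^esub> x = mzero L a (T y)"
    using arg_cong[OF tri_comp(2)[OF t], of Q] L.zero_comp_cong[of "Q h" "Q f" x] D by simp
  then have Qh: "Q h = mzero L a (T y)" using inv(2) D by simp
  \<comment> \<open>As \<open>k \<cdot> r\<close> vanishes, \<open>Tm r\<close> lifts along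
    \<open>h\<close>. Since \<open>Q h\<close> is zero, \<open>Q (Tm r)\<close> is both zero and
    invertible, which forces \<open>T y\<close>, the cone of \<open>f\<close>, to vanish in the
    quotient.\<close>
  have "\<ominus> (Tm k) \<cdot> Tm r = mzero C (T (src C r)) (T c)"
  proof -
    have "Tm (k \<cdot> r) = mzero C (T (src C r)) (T c)" using r(3) D ro by simp
    then show ?thesis using suspm_comp[of r k] D r(1,2) ro by simp
  qed
  moreover have "Tm r \<in> Mor C (T (src C r)) (T y)" using r by (simp add: Mor_iff)
  ultimately obtain m where m: "m \<in> Mor C (T (src C r)) a" "h \<cdot> m = Tm r"
    using tri_lift2[OF R] by blast
  have "Q (Tm r) = mzero L (T (src C r)) (T y)"
    using Qh m D ro Q_comp[of m h] by (simp add: Mor_iff)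
  then have "ident L (T y) \<cdot>\<^bsub>L\<^esub> Q (Tm r) = mzero L (T y) (T y) \<cdot>\<^bsub>L\<^esub> Q (Tm r)"
    using r D ro by simp
  then have "ident L (T y) = mzero L (T y) (T y)"
    by (rule Q_epi) (use S_susp[OF r(1)] r D in \<open>auto simp: L.Mor_iff\<close>)
  then have "T y \<in> J" using J_of_Q_ident_zero D by simp
  then show ?thesis using S_I[OF R] by blast
qed

end

section \<open>Passing to a larger thick subcategory\<close>

locale verdier_inclusion = verdier C J + V': verdier C J'
  for C :: "('o, 'm, 'x) triangulated_cat_scheme" (structure) and J J' :: "'o set" +
  assumes incl: "J \<subseteq> J'"
begin

abbreviation "R \<equiv> further_localize_arr C J'"

lemma S_mono: "s \<in> S \<Longrightarrow> s \<in> V'.S"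
  using incl by (auto simp: cone_in_def)

lemma roofs_mono: "(s, f) \<in> roofs C J a b \<Longrightarrow> (s, f) \<in> roofs C J' a b"
  using S_mono by (simp add: roofs_def)

text \<open>Enlarging \<open>J\<close> to \<open>J'\<close> enlarges both the roofs and the relation
  between them, so saturating a class for \<open>J\<close> yields the class of the same roof for
  \<open>J'\<close>.\<close>

lemma R_frac:
  assumes "s \<in> S" "f \<in> arr C" "src C f = src C s"
  shows "R (fr s f) = V'.fr s f"
proof -
  let ?a = "tgt C s" and ?b = "tgt C f"
  have r: "(s, f) \<in> roofs C J ?a ?b" using assms by (simp add: roofs_iff)
  have "roof_rel C J' ?a ?b `` (roof_rel C J ?a ?b `` {(s, f)}) = roof_rel C J' ?a ?b `` {(s, f)}"
  proof (rule V'.roof_rel_Image_eq)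
    show "(s, f) \<in> roof_rel C J ?a ?b `` {(s, f)}"
      using equiv_class_self[OF equiv_roof_rel r] by simp
    show "((s, f), r') \<in> roof_rel C J' ?a ?b" if "r' \<in> roof_rel C J ?a ?b `` {(s, f)}" for r'
      using that S_mono roofs_mono unfolding roof_rel_def by blast
  qed (rule roofs_mono[OF r])
  then show ?thesis by (simp add: further_localize_arr_def frac_def)
qed

lemma R_arr [simp]:
  assumes "x \<in> arr L"
  shows "R x \<in> arr V'.L" "src V'.L (R x) = src L x" "tgt V'.L (R x) = tgt L x"
proof -
  have "x \<in> Mor L (src L x) (tgt L x)" using assms by (simp add: L.Mor_iff)
  then obtain s f where x: "s \<in> S" "f \<in> Mor C (src C s) (tgt L x)" "x = fr s f"
    using L_Mor_roof by metis
  have f: "f \<in> arr C" "src C f = src C s" using x(2) by (simp_all add: Mor_iff)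
  then show "R x \<in> arr V'.L" "src V'.L (R x) = src L x" "tgt V'.L (R x) = tgt L x"
    unfolding x(3) using x(1) f by (simp_all add: R_frac S_mono)
qed

lemma R_Q [simp]: "f \<in> arr C \<Longrightarrow> R (Q f) = V'.Q f"
  using src_obj by (simp add: localize_arr_def R_frac)

lemma R_ident [simp]: "a \<in> obj C \<Longrightarrow> R (ident L a) = ident V'.L a"
  using R_Q[of "ident C a"] by simp

lemma R_mzero [simp]: "a \<in> obj C \<Longrightarrow> b \<in> obj C \<Longrightarrow> R (mzero L a b) = mzero V'.L a b"
  using R_Q[of "mzero C a b"] by simp

lemma R_comp [simp]:
  assumes "x \<in> arr L" "y \<in> arr L" "src L y = tgt L x"
  shows "R (y \<cdot>\<^bsub>L\<^esub> x) = R y \<cdot>\<^bsub>V'.L\<^esub> R x"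
proof -
  have "x \<in> Mor L (src L x) (tgt L x)" "y \<in> Mor L (tgt L x) (tgt L y)"
    using assms by (simp_all add: L.Mor_iff)
  then obtain s f t g where x: "(s, f) \<in> roofs C J (src L x) (tgt L x)" "x = fr s f"
      and y: "(t, g) \<in> roofs C J (tgt L x) (tgt L y)" "y = fr t g"
    by (elim L_Mor_E)
  obtain w h where w: "w \<in> S" "tgt C w = src C s" "h \<in> arr C" "src C h = src C w" "tgt C h = src C t"
    "f \<cdot> w = t \<cdot> h" "(s \<cdot> w, g \<cdot> h) \<in> roofs C J (src L x) (tgt L y)"
    by (rule composable_roofs[OF x(1) y(1)])
  have "R (y \<cdot>\<^bsub>L\<^esub> x) = R (fr (s \<cdot> w) (g \<cdot> h))" using frac_comp_eq[OF x(1) y(1) w(1-6)] x y by simp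
  also have "\<dots> = V'.fr (s \<cdot> w) (g \<cdot> h)" using w(7) by (intro R_frac) (auto simp: roofs_iff)
  also have "\<dots> = V'.fr t g \<cdot>\<^bsub>V'.L\<^esub> V'.fr s f"
    using V'.frac_comp_eq[OF roofs_mono[OF x(1)] roofs_mono[OF y(1)] S_mono[OF w(1)] w(2-6)] by simp
  also have "V'.fr s f = R x"
    unfolding x(2) by (rule R_frac[symmetric]) (use x(1) in \<open>simp_all add: roofs_iff\<close>)
  also have "V'.fr t g = R y"
    unfolding y(2) by (rule R_frac[symmetric]) (use y(1) in \<open>simp_all add: roofs_iff\<close>)
  finally show ?thesis .
qed

lemma R_madd [simp]:
  assumes "x \<in> arr L" "y \<in> arr L" "src L y = src L x" "tgt L y = tgt L x"
  shows "R (x \<oplus>\<^bsub>L\<^esub> y) = R x \<oplus>\<^bsub>V'.L\<^esub> R y"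
proof -
  have "x \<in> Mor L (src L x) (tgt L x)" "y \<in> Mor L (src L x) (tgt L x)"
    using assms by (simp_all add: L.Mor_iff)
  then obtain s f g where x: "(s, f) \<in> roofs C J (src L x) (tgt L x)"
      "(s, g) \<in> roofs C J (src L x) (tgt L x)" "x = fr s f" "y = fr s g"
    by (rule common_denominator)
  have "R (x \<oplus>\<^bsub>L\<^esub> y) = R (fr s (f \<oplus> g))" using frac_add_eq[OF x(1,2)] x(3,4) by simp
  also have "\<dots> = V'.fr s (f \<oplus> g)" using x(1,2) by (intro R_frac) (auto simp: roofs_iff)
  also have "\<dots> = V'.fr s f \<oplus>\<^bsub>V'.L\<^esub> V'.fr s g"
    using V'.frac_add_eq[OF roofs_mono[OF x(1)] roofs_mono[OF x(2)]] by simp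
  also have "V'.fr s f = R x"
    unfolding x(3) by (rule R_frac[symmetric]) (use x(1) in \<open>simp_all add: roofs_iff\<close>)
  also have "V'.fr s g = R y"
    unfolding x(4) by (rule R_frac[symmetric]) (use x(2) in \<open>simp_all add: roofs_iff\<close>)
  finally show ?thesis .
qed

end

section \<open>Gluing\<close>

text \<open>The matrix \<open>((1 - e, \<alpha>), (\<sigma>, 1 - e'))\<close> is an involution of \<open>x \<oplus> y\<close> exchanging the images of
  \<open>e\<close> and \<open>e'\<close>. It reduces gluing in the idempotent completions to gluing of honest objects.\<close>

lemma (in preadditive_category) exchange_involution:
  assumes ij: "i \<in> Mor C x c" "j \<in> Mor C y c" "p \<in> Mor C c x" "q \<in> Mor C c y"
    and pi: "p \<cdot> i = ident C x" "q \<cdot> j = ident C y" "p \<cdot> j = mzero C y x" "q \<cdot> i = mzero C x y"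
      "i \<cdot> p \<oplus> j \<cdot> q = ident C c"
    and e: "e \<in> Mor C x x" "e' \<in> Mor C y y" "e \<cdot> e = e" "e' \<cdot> e' = e'"
    and s: "s \<in> Mor C x y" "a \<in> Mor C y x" "a \<cdot> s = e" "s \<cdot> a = e'" "s \<cdot> e = s" "e' \<cdot> s = s"
      "a \<cdot> e' = a" "e \<cdot> a = a"
  obtains t where "t \<in> Mor C c c" "t \<cdot> t = ident C c"
    "q \<cdot> t = s \<cdot> p \<oplus> (ident C y \<oplus> \<ominus> e') \<cdot> q" "t \<cdot> j = i \<cdot> a \<oplus> j \<cdot> (ident C y \<oplus> \<ominus> e')"
proof -
  have o: "x \<in> obj C" "y \<in> obj C" "c \<in> obj C" using Mor_obj ij by auto
  note D = ij[unfolded Mor_iff] e(1,2)[unfolded Mor_iff] s(1,2)[unfolded Mor_iff] o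
  note pi' = pi(1-4) comp_eq_arr[OF pi(1)] comp_eq_arr[OF pi(2)] comp_eq_arr[OF pi(3)]
    comp_eq_arr[OF pi(4)]
  note es = e(3,4) s(3-8) comp_eq_arr[OF e(3)] comp_eq_arr[OF e(4)] s(3-8)[THEN comp_eq_arr]
  \<comment> \<open>\<open>u\<close> and \<open>v\<close> are the two rows of the matrix
    \<open>t\<close>, so that \<open>t \<cdot> t\<close> is computed row by row.\<close>
  define u where "u = (ident C x \<oplus> \<ominus> e) \<cdot> p \<oplus> a \<cdot> q"
  define v where "v = s \<cdot> p \<oplus> (ident C y \<oplus> \<ominus> e') \<cdot> q"
  define t where "t = i \<cdot> u \<oplus> j \<cdot> v"
  have u: "u \<in> arr C" "src C u = c" "tgt C u = x" by (simp_all add: u_def D)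
  have v: "v \<in> arr C" "src C v = c" "tgt C v = y" by (simp_all add: v_def D)
  have t: "t \<in> arr C" "src C t = c" "tgt C t = c" by (simp_all add: t_def D u v)
  have pt: "p \<cdot> t = u" "q \<cdot> t = v" by (simp_all add: t_def D u v pi')
  have ut: "u \<cdot> t = p"
  proof -
    have "u \<cdot> t = (ident C x \<oplus> \<ominus> e) \<cdot> (p \<cdot> t) \<oplus> a \<cdot> (q \<cdot> t)"
      by (simp add: u_def D t)
    also have "\<dots> = (ident C x \<oplus> \<ominus> e) \<cdot> u \<oplus> a \<cdot> v" unfolding pt ..
    also have "\<dots> = p" by (simp add: u_def v_def D es madd_left_commute[of _ p])
    finally show ?thesis .
  qed
  have vt: "v \<cdot> t = q"
  proof -
    have "v \<cdot> t = s \<cdot> (p \<cdot> t) \<oplus> (ident C y \<oplus> \<ominus> e') \<cdot> (q \<cdot> t)"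
      by (simp add: v_def D t)
    also have "\<dots> = s \<cdot> u \<oplus> (ident C y \<oplus> \<ominus> e') \<cdot> v" unfolding pt ..
    also have "\<dots> = q" by (simp add: u_def v_def D es madd_left_commute[of _ q])
    finally show ?thesis .
  qed
  have "t \<cdot> t = i \<cdot> u \<cdot> t \<oplus> j \<cdot> v \<cdot> t" by (simp add: t_def D u v t del: comp_add(1))
  then have tt: "t \<cdot> t = ident C c" using ut vt pi by simp
  have "t \<cdot> j = i \<cdot> u \<cdot> j \<oplus> j \<cdot> v \<cdot> j" by (simp add: t_def D u v t del: comp_add(1))
  also have "u \<cdot> j = a" by (simp add: u_def D pi')
  also have "v \<cdot> j = ident C y \<oplus> \<ominus> e'" by (simp add: v_def D pi')
  finally show ?thesis using that[of t] t tt pt(2) v_def by (simp add: Mor_iff)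
qed

text \<open>Isolates what the spectrum contributes: orthogonality in both directions and a
  decomposition of \<open>J12\<close>. The latter only writes the identity of \<open>z\<close> as a
  sum of two arrows through \<open>J1\<close> and \<open>J2\<close>; \<open>split_triangle\<close>
  recovers an honest splitting from orthogonality.\<close>

locale gluing_data = triangulated_category C +
    V1: verdier_inclusion C J1 J12 + V2: verdier_inclusion C J2 J12
  for C :: "('o, 'm, 'x) triangulated_cat_scheme" (structure) and J1 J2 J12 :: "'o set" +
  assumes orth: "\<lbrakk>x \<in> J1; y \<in> J2; f \<in> Mor C x y\<rbrakk> \<Longrightarrow> f = mzero C x y"
    and orth': "\<lbrakk>x \<in> J1; y \<in> J2; f \<in> Mor C y x\<rbrakk> \<Longrightarrow> f = mzero C y x"
    and decomposition: "z \<in> J12 \<Longrightarrow>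
      \<exists>x \<in> J1. \<exists>y \<in> J2. \<exists>i \<in> Mor C x z. \<exists>p \<in> Mor C z x. \<exists>j \<in> Mor C y z. \<exists>q \<in> Mor C z y.
        i \<cdot> p \<oplus> j \<cdot> q = ident C z"
    and idempotent_complete: "idempotent_complete C"
begin

abbreviation "L1 \<equiv> verdier_additive C J1"
abbreviation "L2 \<equiv> verdier_additive C J2"
abbreviation "L12 \<equiv> verdier_additive C J12"
abbreviation "Q1 \<equiv> localize_arr C J1"
abbreviation "Q2 \<equiv> localize_arr C J2"
abbreviation "Q12 \<equiv> localize_arr C J12"
abbreviation "R \<equiv> further_localize_arr C J12"

text \<open>Lets one-sided results such as \<open>S_factor\<close> and
  \<open>lift_to_weak_pullback\<close> be used with the two ideals exchanged.\<close>

lemma swap: "gluing_data C J2 J1 J12"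
proof
  fix z assume "z \<in> J12"
  from decomposition[OF this] obtain x y i p j q where z: "x \<in> J1" "y \<in> J2" "i \<in> Mor C x z"
      "p \<in> Mor C z x" "j \<in> Mor C y z" "q \<in> Mor C z y" "i \<cdot> p \<oplus> j \<cdot> q = ident C z"
    by blast
  have "j \<cdot> q \<oplus> i \<cdot> p = ident C z" using z madd_commute[of "i \<cdot> p" "j \<cdot> q"] by (simp add: Mor_iff)
  then show "\<exists>x \<in> J2. \<exists>y \<in> J1. \<exists>i \<in> Mor C x z. \<exists>p \<in> Mor C z x. \<exists>j \<in> Mor C y z. \<exists>q \<in> Mor C z y.
      i \<cdot> p \<oplus> j \<cdot> q = ident C z"
    using z by blast
qed (use orth orth' V1.incl V2.incl idempotent_complete in auto)

text \<open>The middle of the composite runs from \<open>J1\<close> to \<open>J2\<close>. For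
  \<open>f = g\<close> this shows that an endomorphism killed in both quotients has square
  zero.\<close>

lemma orth_comp:
  assumes "factors_through C J1 f" "factors_through C J2 g" "f \<in> arr C" "g \<in> arr C" "src C g = tgt C f"
  shows "g \<cdot> f = mzero C (src C f) (tgt C g)"
proof -
  obtain x p i where x: "x \<in> J1" "p \<in> Mor C (src C f) x" "i \<in> Mor C x (tgt C f)" "f = i \<cdot> p"
    using assms(1) unfolding factors_through_def by blast
  obtain y q j where y: "y \<in> J2" "q \<in> Mor C (src C g) y" "j \<in> Mor C y (tgt C g)" "g = j \<cdot> q"
    using assms(2) unfolding factors_through_def by blast
  have o: "src C f \<in> obj C" "tgt C g \<in> obj C" using assms src_obj tgt_obj by auto
  have "q \<cdot> i \<in> Mor C x y" using x(2,3) y(2,3) assms(5) by (simp add: Mor_iff)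
  then have qi: "q \<cdot> i = mzero C x y" by (rule orth[OF x(1) y(1)])
  note D = x(2,3)[unfolded Mor_iff] y(2,3)[unfolded Mor_iff] V1.J_obj[OF x(1)] V2.J_obj[OF y(1)] o
  have "(j \<cdot> q) \<cdot> (i \<cdot> p) = j \<cdot> (q \<cdot> i) \<cdot> p" using D assms(5) by simp
  also have "\<dots> = mzero C (src C f) (tgt C g)" using D by (simp add: qi)
  finally show ?thesis using x(4) y(4) by simp
qed

text \<open>Orthogonality gives \<open>p \<cdot> j = 0\<close>, which makes
  \<open>j \<cdot> q\<close> idempotent. Its image is the part in \<open>J2\<close>, and the cone of
  the inclusion of this image is the part in \<open>J1\<close>.\<close>

lemma split_triangle:
  assumes "z \<in> J12"
  obtains x y i p e where "x \<in> J1" "y \<in> J2" "tri C i p e y z x"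
proof -
  from decomposition[OF assms] obtain x y i p j q where z: "x \<in> J1" "y \<in> J2" "i \<in> Mor C x z"
      "p \<in> Mor C z x" "j \<in> Mor C y z" "q \<in> Mor C z y" "i \<cdot> p \<oplus> j \<cdot> q = ident C z"
    by blast
  note D = z(3-6)[unfolded Mor_iff] V1.J_obj[OF z(1)] V2.J_obj[OF z(2)] V1.V'.J_obj[OF assms]
  have "p \<cdot> j = mzero C y x" by (rule orth'[OF z(1,2)]) (simp add: Mor_iff D)
  then have "j = j \<cdot> q \<cdot> j"
    using arg_cong[OF z(7), of "\<lambda>f. f \<cdot> j"] by (simp add: D)
  then have jq: "(j \<cdot> q) \<cdot> (j \<cdot> q) = j \<cdot> q"
    using comp_assoc_arr[of q "j \<cdot> q \<cdot> j" "ident C z"] D comp_assoc_arr[of q "q \<cdot> j" j]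
    by simp
  have "j \<cdot> q \<in> Mor C z z" "z \<in> obj C" using D by (simp_all add: Mor_iff)
  then obtain y' q' j' where y': "y' \<in> obj C" "q' \<in> Mor C z y'" "j' \<in> Mor C y' z"
      "j' \<cdot> q' = j \<cdot> q" "q' \<cdot> j' = ident C y'"
    using idempotent_complete jq unfolding idempotent_complete_def by blast
  note D = D y'(1) y'(2,3)[unfolded Mor_iff]
  \<comment> \<open>This exhibits the image \<open>y'\<close> as a retract of
    \<open>y\<close>.\<close>
  have "(q' \<cdot> j) \<cdot> (q \<cdot> j') = q' \<cdot> (j \<cdot> q) \<cdot> j'" by (simp add: D)
  also have "\<dots> = ident C y'"
    using D y'(5) comp_eq_arr[OF y'(5), of "q' \<cdot> j'"] by (simp add: y'(4)[symmetric])
  finally have y'2: "y' \<in> J2"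
    by (rule V2.J_retract[OF z(2), rotated 2]) (simp_all add: Mor_iff D)
  obtain w g h where t: "tri C j' g h y' z w" by (rule ex_cone[OF y'(3)])
  note D = D triD[OF t]
  have Tq: "Tm q' \<cdot> Tm j' = ident C (T y')" using arg_cong[OF y'(5), of Tm] D by simp
  \<comment> \<open>The split monomorphism \<open>Tm j'\<close> annihilates \<open>h\<close>, so
    \<open>h\<close> vanishes and \<open>g\<close> acquires a section \<open>r\<close>. On
    \<open>w\<close> only the summand \<open>i \<cdot> p\<close> survives, whence \<open>w\<close>
    is a retract of \<open>x\<close>.\<close>
  have "h = mzero C w (T y')"
    using comp_eq_arr[OF Tq, of h] tri_comp(3)[OF t] D by simp
  then have "h \<cdot> ident C w = mzero C w (T y')" "ident C w \<in> Mor C w w" using D by (simp_all add: Mor_iff)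
  then obtain r where r: "r \<in> Mor C w z" "g \<cdot> r = ident C w" using tri_lift2[OF t] by blast
  note D = D r(1)[unfolded Mor_iff]
  have "g \<cdot> (j \<cdot> q) \<cdot> r = mzero C w w"
    unfolding y'(4)[symmetric] using D tri_comp(1)[OF t] zero_comp_cong[of g j' "q' \<cdot> r"] by simp
  moreover have "g \<cdot> (i \<cdot> p \<oplus> j \<cdot> q) \<cdot> r = ident C w" using z(7) r D by simp
  ultimately have "(g \<cdot> i) \<cdot> (p \<cdot> r) = ident C w" using D by simp
  then have "w \<in> J1"
    by (rule V1.J_retract[OF z(1), rotated 2]) (simp_all add: Mor_iff D)
  then show ?thesis using that y'2 t by blast
qed

text \<open>The cone of \<open>s\<close> is an extension of an object of \<open>J1\<close> by one of
  \<open>J2\<close>, and \<open>s\<close> factors accordingly. The order matters: the half with cone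
  in \<open>J2\<close> comes first, and \<open>swap\<close> provides the other order.\<close>

lemma S_factor:
  assumes "s \<in> V1.V'.S"
  obtains k s' where "k \<in> V2.S" "s' \<in> V1.S" "src C s' = tgt C k" "s = s' \<cdot> k"
proof -
  obtain g h z where t: "tri C s g h (src C s) (tgt C s) z" "z \<in> J12" using assms by (rule V1.V'.S_E)
  obtain x y i p e where x: "x \<in> J1" "y \<in> J2" "tri C i p e y z x" using t(2) by (rule split_triangle)
  obtain c' k s' l m n n' where "tri C k l m (src C s) c' y" "tri C s' n n' c' (tgt C s) x" "s = s' \<cdot> k"
    by (rule factor_through_cone_extension[OF t(1) x(3)])
  then show ?thesis using that V1.S_I V2.S_I x triD by metis
qed

text \<open>The obstruction is an arrow from \<open>j\<close> in \<open>J2\<close> to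
  \<open>T x\<close> in \<open>J1\<close>, hence zero.\<close>

lemma lift_to_weak_pullback:
  assumes t: "tri C p q d c0 c j" and j: "j \<in> J2" and k: "k \<in> Mor C c0 x" "x \<in> J1"
  obtains m where "m \<in> Mor C c x" "m \<cdot> p = k"
proof -
  have "Tm k \<cdot> d \<in> Mor C j (T x)" using k triD[OF t] by (simp add: Mor_iff)
  then have "Tm k \<cdot> d = mzero C j (T x)"
    using k(2) V1.J_susp[of x] V1.J_obj[of x] by (intro orth'[OF _ j]) auto
  then show ?thesis using tri_extend0[OF t k(1)] that by blast
qed

theorem lift_arrow:
  assumes x: "x1 \<in> Mor L1 a a'" "x2 \<in> Mor L2 a a'" "R x1 = R x2"
  obtains g where "g \<in> Mor C a a'" "Q1 g = x1" "Q2 g = x2"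
proof -
  interpret sw: gluing_data C J2 J1 J12 by (rule swap)
  obtain s1 h1 where s1: "s1 \<in> V1.S" "tgt C s1 = a" "h1 \<in> Mor C (src C s1) a'"
      "x1 \<cdot>\<^bsub>L1\<^esub> Q1 s1 = Q1 h1"
    using x(1) by (rule V1.L_Mor_roof)
  obtain s2 h2 where s2: "s2 \<in> V2.S" "tgt C s2 = a" "h2 \<in> Mor C (src C s2) a'"
      "x2 \<cdot>\<^bsub>L2\<^esub> Q2 s2 = Q2 h2"
    using x(2) by (rule V2.L_Mor_roof)
  obtain q1 r1 j1 where t1: "tri C s1 q1 r1 (src C s1) (tgt C s1) j1" "j1 \<in> J1" using s1(1) by (rule V1.S_E)
  obtain q2 r2 j2 where t2: "tri C s2 q2 r2 (src C s2) (tgt C s2) j2" "j2 \<in> J2" using s2(1) by (rule V2.S_E)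
  note t1' = t1(1)[unfolded s1(2)] and t2' = t2(1)[unfolded s2(2)]
  obtain c0 p1 p2 d u where P: "tri C p1 (q2 \<cdot> s1) d c0 (src C s1) j2"
      "tri C p2 (q1 \<cdot> s2) u c0 (src C s2) j1" "s1 \<cdot> p1 = s2 \<cdot> p2" "Tm p2 \<cdot> d = r2"
    by (rule homotopy_pullback[OF t1' t2'])
  note D = triD[OF P(1)] triD[OF P(2)] s1(2) s1(3)[unfolded Mor_iff] s2(2) s2(3)[unfolded Mor_iff]
    s1(1) s2(1) V1.S_arr[OF s1(1)] V2.S_arr[OF s2(1)] x(1)[unfolded V1.L.Mor_iff]
    x(2)[unfolded V2.L.Mor_iff]
  have o: "a \<in> obj C" "a' \<in> obj C" using triD[OF t1'] Mor_obj[OF s1(3)] by simp_all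
  have 1: "Q12 (h1 \<cdot> p1) = R x1 \<cdot>\<^bsub>L12\<^esub> Q12 (s1 \<cdot> p1)"
  proof -
    have "Q12 h1 = R x1 \<cdot>\<^bsub>L12\<^esub> Q12 s1" using arg_cong[OF s1(4), of R] by (simp add: D)
    then show ?thesis by (simp add: D)
  qed
  have 2: "Q12 (h2 \<cdot> p2) = R x2 \<cdot>\<^bsub>L12\<^esub> Q12 (s2 \<cdot> p2)"
  proof -
    have "Q12 h2 = R x2 \<cdot>\<^bsub>L12\<^esub> Q12 s2" using arg_cong[OF s2(4), of R] by (simp add: D)
    then show ?thesis by (simp add: D)
  qed
  have "Q12 (h1 \<cdot> p1) = Q12 (h2 \<cdot> p2)" unfolding 1 2 P(3) x(3) ..
  then have "factors_through C J12 (h1 \<cdot> p1 \<oplus> \<ominus> (h2 \<cdot> p2))"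
    by (subst (asm) V1.V'.Q_eq_iff) (simp_all add: D)
  then obtain z p i where z: "z \<in> J12" "p \<in> Mor C c0 z" "i \<in> Mor C z a'"
      "h1 \<cdot> p1 \<oplus> \<ominus> (h2 \<cdot> p2) = i \<cdot> p"
    unfolding factors_through_def using D by auto
  obtain x y i1 \<pi>1 i2 \<pi>2 where y: "x \<in> J1" "y \<in> J2" "i1 \<in> Mor C x z" "\<pi>1 \<in> Mor C z x"
      "i2 \<in> Mor C y z" "\<pi>2 \<in> Mor C z y" "i1 \<cdot> \<pi>1 \<oplus> i2 \<cdot> \<pi>2 = ident C z"
    using decomposition[OF z(1)] by blast
  have k: "\<pi>1 \<cdot> p \<in> Mor C c0 x" "\<pi>2 \<cdot> p \<in> Mor C c0 y" using z y by (simp_all add: Mor_iff)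
  \<comment> \<open>Cones and ideals are crossed: \<open>p1\<close> has its cone in
    \<open>J2\<close>, so the \<open>J1\<close> component extends along it, and likewise for
    \<open>p2\<close>.\<close>
  obtain m1 where m1: "m1 \<in> Mor C (src C s1) x" "m1 \<cdot> p1 = \<pi>1 \<cdot> p"
    by (rule lift_to_weak_pullback[OF P(1) t2(2) k(1) y(1)])
  obtain m2 where m2: "m2 \<in> Mor C (src C s2) y" "m2 \<cdot> p2 = \<pi>2 \<cdot> p"
    by (rule sw.lift_to_weak_pullback[OF P(2) t1(2) k(2) y(2)])
  note D = D o z(2,3)[unfolded Mor_iff] y(3-6)[unfolded Mor_iff] m1(1)[unfolded Mor_iff]
    m2(1)[unfolded Mor_iff]
  define n1 where "n1 = i \<cdot> i1 \<cdot> m1"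
  define n2 where "n2 = i \<cdot> i2 \<cdot> m2"
  have n: "n1 \<in> arr C" "src C n1 = src C s1" "tgt C n1 = a'" "n2 \<in> arr C" "src C n2 = src C s2" "tgt C n2 = a'"
    by (simp_all add: n1_def n2_def D)
  \<comment> \<open>Hence \<open>h1\<close> may be changed by \<open>n1\<close> without affecting
    \<open>x1\<close>, and \<open>h2\<close> by \<open>n2\<close> without affecting
    \<open>x2\<close>. These corrections make the representatives agree on
    \<open>c0\<close>.\<close>
  have "factors_through C J1 n1" "factors_through C J2 n2"
    by (rule V1.factors_throughI[OF y(1) m1(1), of "i \<cdot> i1" a'] V2.factors_throughI[OF y(2) m2(1), of "i \<cdot> i2" a'];
      simp add: n1_def n2_def D Mor_iff)+
  then have Qn: "Q1 n1 = mzero L1 (src C s1) a'" "Q2 n2 = mzero L2 (src C s2) a'"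
    using V1.Q_zero_iff[of n1] V2.Q_zero_iff[of n2] n by simp_all
  have "i \<cdot> p = i \<cdot> (i1 \<cdot> \<pi>1 \<oplus> i2 \<cdot> \<pi>2) \<cdot> p" unfolding y(7) by (simp add: D)
  also have "\<dots> = n1 \<cdot> p1 \<oplus> n2 \<cdot> p2" by (simp add: n1_def n2_def D m1(2) m2(2))
  finally have e: "h1 \<cdot> p1 \<oplus> \<ominus> (h2 \<cdot> p2) = n1 \<cdot> p1 \<oplus> n2 \<cdot> p2" using z(4) by simp
  have "h1 \<cdot> p1 = (h1 \<cdot> p1 \<oplus> \<ominus> (h2 \<cdot> p2)) \<oplus> h2 \<cdot> p2" by (simp add: D)
  then have e': "h1 \<cdot> p1 = n1 \<cdot> p1 \<oplus> (n2 \<cdot> p2 \<oplus> h2 \<cdot> p2)" unfolding e by (simp add: D n)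
  have "(h1 \<oplus> \<ominus> n1) \<cdot> p1 = h1 \<cdot> p1 \<oplus> \<ominus> (n1 \<cdot> p1)" by (simp add: D n)
  also have "\<dots> = (h2 \<oplus> n2) \<cdot> p2"
    unfolding e' by (simp add: D n madd_commute[of "n2 \<cdot> p2"] madd_left_commute[of "n1 \<cdot> p1"])
  finally have eq: "(h1 \<oplus> \<ominus> n1) \<cdot> p1 = (h2 \<oplus> n2) \<cdot> p2" .
  have s1a: "s1 \<in> Mor C (src C s1) a" "p2 \<in> Mor C c0 (src C s2)"
      "h1 \<oplus> \<ominus> n1 \<in> Mor C (src C s1) a'" "h2 \<oplus> n2 \<in> Mor C (src C s2) a'"
    by (simp_all add: Mor_iff D n)
  obtain g where g: "g \<in> Mor C a a'" "g \<cdot> s1 = h1 \<oplus> \<ominus> n1" "g \<cdot> s2 = h2 \<oplus> n2"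
    by (rule weak_pushout[OF P(1) t2' s1a(1,2) P(4,3) s1a(3,4) eq])
  have ga: "g \<in> arr C" "src C g = a" "tgt C g = a'" using g(1) by (simp_all add: Mor_iff)
  have "Q1 g \<cdot>\<^bsub>L1\<^esub> Q1 s1 = Q1 (g \<cdot> s1)" by (simp add: ga D)
  also have "\<dots> = x1 \<cdot>\<^bsub>L1\<^esub> Q1 s1" unfolding g(2) s1(4) using n by (simp add: D Qn)
  finally have "Q1 g = x1" by (rule V1.Q_epi) (simp_all add: V1.L.Mor_iff ga D)
  moreover have "Q2 g \<cdot>\<^bsub>L2\<^esub> Q2 s2 = Q2 (g \<cdot> s2)" by (simp add: ga D)
  then have "Q2 g \<cdot>\<^bsub>L2\<^esub> Q2 s2 = x2 \<cdot>\<^bsub>L2\<^esub> Q2 s2" unfolding g(3) s2(4) using n by (simp add: D Qn)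
  then have "Q2 g = x2" by (rule V2.Q_epi) (simp_all add: V2.L.Mor_iff ga D)
  ultimately show ?thesis using that g(1) by blast
qed

end

section \<open>Local isomorphisms, gluing of objects and lifting of idempotents\<close>

context gluing_data
begin

text \<open>Both composites of \<open>g\<close> and \<open>h\<close> become identities in each
  quotient, so they differ from identities by errors of square zero and are invertible.\<close>

lemma Iso_of_local_inverses:
  assumes g: "g \<in> Mor C a b" "h \<in> Mor C b a"
    and 1: "Q1 h \<cdot>\<^bsub>L1\<^esub> Q1 g = ident L1 a" "Q1 g \<cdot>\<^bsub>L1\<^esub> Q1 h = ident L1 b"
    and 2: "Q2 h \<cdot>\<^bsub>L2\<^esub> Q2 g = ident L2 a" "Q2 g \<cdot>\<^bsub>L2\<^esub> Q2 h = ident L2 b"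
  shows "g \<in> Iso C a b"
proof -
  have inv: "\<exists>u \<in> Mor C a a. u \<cdot> f = ident C a \<and> f \<cdot> u = ident C a"
    if f: "f \<in> Mor C a a" "Q1 f = ident L1 a" "Q2 f = ident L2 a" for f a
  proof -
    have o: "a \<in> obj C" using f Mor_obj by blast
    let ?n = "f \<oplus> \<ominus> (ident C a)"
    have n: "?n \<in> Mor C a a" using f o by (simp add: Mor_iff)
    have "factors_through C J1 ?n" "factors_through C J2 ?n"
      using V1.Q_eq_iff[of f "ident C a"] V2.Q_eq_iff[of f "ident C a"] f o by (simp_all add: Mor_iff)
    then have "?n \<cdot> ?n = mzero C a a" using orth_comp[of ?n ?n] n by (simp add: Mor_iff)
    from invertible_one_plus_square_zero[OF n this]
    have "f \<cdot> (ident C a \<oplus> \<ominus> ?n) = ident C a" "(ident C a \<oplus> \<ominus> ?n) \<cdot> f = ident C a"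
      using f(1) o by (simp_all add: Mor_iff)
    moreover have "ident C a \<oplus> \<ominus> ?n \<in> Mor C a a" using n o by (simp add: Mor_iff)
    ultimately show ?thesis by blast
  qed
  have o: "a \<in> obj C" "b \<in> obj C" using g Mor_obj by auto
  note D = g[unfolded Mor_iff] o
  obtain u where u: "u \<in> Mor C a a" "u \<cdot> (h \<cdot> g) = ident C a"
    using inv[of "h \<cdot> g" a] 1 2 D by (auto simp: Mor_iff)
  obtain v where v: "v \<in> Mor C b b" "(g \<cdot> h) \<cdot> v = ident C b"
    using inv[of "g \<cdot> h" b] 1 2 D by (auto simp: Mor_iff)
  note D = D u(1)[unfolded Mor_iff] v(1)[unfolded Mor_iff]
  have v': "g \<cdot> h \<cdot> v = ident C b" using v(2) by (simp add: D)
  \<comment> \<open>\<open>g\<close> has the left inverse \<open>u \<cdot> h\<close> and the right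
    inverse \<open>h \<cdot> v\<close>, which therefore coincide.\<close>
  have "u \<cdot> h = u \<cdot> h \<cdot> (g \<cdot> h \<cdot> v)" unfolding v' by (simp add: D)
  also have "\<dots> = (u \<cdot> h \<cdot> g) \<cdot> h \<cdot> v" by (simp add: D)
  also have "\<dots> = h \<cdot> v" unfolding u(2) by (simp add: D)
  finally have "g \<cdot> u \<cdot> h = ident C b" using v' by simp
  then show ?thesis unfolding Iso_iff using u(2) D g(1)
    by (auto intro!: bexI[of _ "u \<cdot> h"] simp: Mor_iff)
qed

text \<open>The leg \<open>s\<close> is factored as \<open>s' \<cdot> k\<close> with
  \<open>s'\<close> in the system of \<open>J1\<close>, and \<open>f\<close> as
  \<open>f' \<cdot> l\<close> with \<open>f'\<close> in the system of \<open>J2\<close>. So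
  \<open>a1\<close> may be replaced by the target of \<open>k\<close> in \<open>L1\<close>, and
  \<open>a2\<close> by the target of \<open>l\<close> in \<open>L2\<close>. In the pushout
  \<open>b\<close> of \<open>k\<close> and \<open>l\<close>, the side \<open>u\<close> has the cone
  of \<open>l\<close>, in \<open>J1\<close>, and \<open>v\<close> that of \<open>k\<close>, in
  \<open>J2\<close>; hence \<open>b\<close> is isomorphic to both replacements in the respective
  quotients.\<close>

theorem glue_objects:
  assumes t: "t \<in> Mor L12 a1 a2" "t' \<in> Mor L12 a2 a1"
    and inv: "t' \<cdot>\<^bsub>L12\<^esub> t = ident L12 a1" "t \<cdot>\<^bsub>L12\<^esub> t' = ident L12 a2"
  obtains b g1 h1 g2 h2 where "b \<in> obj C"
    "g1 \<in> Mor L1 b a1" "h1 \<in> Mor L1 a1 b" "h1 \<cdot>\<^bsub>L1\<^esub> g1 = ident L1 b" "g1 \<cdot>\<^bsub>L1\<^esub> h1 = ident L1 a1"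
    "g2 \<in> Mor L2 b a2" "h2 \<in> Mor L2 a2 b" "h2 \<cdot>\<^bsub>L2\<^esub> g2 = ident L2 b" "g2 \<cdot>\<^bsub>L2\<^esub> h2 = ident L2 a2"
    "t \<cdot>\<^bsub>L12\<^esub> R g1 = R g2"
proof -
  interpret sw: gluing_data C J2 J1 J12 by (rule swap)
  obtain s f where s: "s \<in> V1.V'.S" "tgt C s = a1" "f \<in> Mor C (src C s) a2"
      "t \<cdot>\<^bsub>L12\<^esub> Q12 s = Q12 f"
    using t(1) by (rule V1.V'.L_Mor_roof)
  obtain r where r: "r \<in> Mor L12 (tgt C s) (src C s)" "Q12 s \<cdot>\<^bsub>L12\<^esub> r = ident L12 (tgt C s)"
      "r \<cdot>\<^bsub>L12\<^esub> Q12 s = ident L12 (src C s)"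
    using s(1) by (rule V1.V'.Q_Iso)
  have o: "a1 \<in> obj C" "a2 \<in> obj C" "src C s \<in> obj C" using V1.V'.L.Mor_obj[OF t(1)] Mor_obj[OF s(3)] by simp_all
  note D = t[unfolded V1.V'.L.Mor_iff] s(1,2) V1.V'.S_arr[OF s(1)] s(3)[unfolded Mor_iff]
    r(1)[unfolded V1.V'.L.Mor_iff] o
  \<comment> \<open>\<open>Q12 f\<close> is invertible because \<open>t\<close> and
    \<open>Q12 s\<close> are; by thickness the cone of \<open>f\<close> is then in
    \<open>J12\<close>.\<close>
  have f: "f \<in> V1.V'.S"
  proof (rule V1.V'.S_of_Q_Iso[OF s(3), of "r \<cdot>\<^bsub>L12\<^esub> t'"])
    show "r \<cdot>\<^bsub>L12\<^esub> t' \<in> Mor L12 a2 (src C s)" by (simp add: V1.V'.L.Mor_iff D)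
    show "(r \<cdot>\<^bsub>L12\<^esub> t') \<cdot>\<^bsub>L12\<^esub> Q12 f = ident L12 (src C s)"
      using r(3) by (simp add: D s(4)[symmetric] V1.V'.L.comp_eq_arr[OF inv(1)])
    show "Q12 f \<cdot>\<^bsub>L12\<^esub> r \<cdot>\<^bsub>L12\<^esub> t' = ident L12 a2"
      using inv(2) by (simp add: D s(4)[symmetric] V1.V'.L.comp_eq_arr[OF r(2)])
  qed
  obtain k s' where k: "k \<in> V2.S" "s' \<in> V1.S" "src C s' = tgt C k" "s = s' \<cdot> k"
    using s(1) by (rule S_factor)
  obtain l f' where l: "l \<in> V1.S" "f' \<in> V2.S" "src C f' = tgt C l" "f = f' \<cdot> l"
    using f by (rule sw.S_factor)
  note A = V2.S_arr[OF k(1)] V1.S_arr[OF k(2)] V1.S_arr[OF l(1)] V2.S_arr[OF l(2)]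
  have st: "tgt C s' = a1" "tgt C f' = a2" "src C l = src C k"
    using s(2) s(3)[unfolded Mor_iff] A k(3) l(3) unfolding k(4) l(4) by simp_all
  obtain x y z where k': "tri C k x y (src C k) (tgt C k) z" "z \<in> J2" using k(1) by (rule V2.S_E)
  obtain x' y' z' where l': "tri C l x' y' (src C l) (tgt C l) z'" "z' \<in> J1" using l(1) by (rule V1.S_E)
  obtain b u v p q m n where b: "tri C v p m (tgt C l) b z" "tri C u q n (tgt C k) b z'" "u \<cdot> k = v \<cdot> l"
    by (rule homotopy_pushout[OF k'(1) l'(1)[unfolded st(3)]])
  have u: "u \<in> V1.S" "v \<in> V2.S" using V1.S_I[OF b(2) l'(2)] V2.S_I[OF b(1) k'(2)] .
  note B = triD(1-3)[OF b(1)] triD(1-3)[OF b(2)] triD(11)[OF b(1)] A k(3) l(3) st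
  obtain u' where u': "u' \<in> Mor L1 b (tgt C k)" "Q1 u \<cdot>\<^bsub>L1\<^esub> u' = ident L1 b"
      "u' \<cdot>\<^bsub>L1\<^esub> Q1 u = ident L1 (tgt C k)"
    using V1.Q_Iso[OF u(1)] unfolding B .
  obtain v' where v': "v' \<in> Mor L2 b (tgt C l)" "Q2 v \<cdot>\<^bsub>L2\<^esub> v' = ident L2 b"
      "v' \<cdot>\<^bsub>L2\<^esub> Q2 v = ident L2 (tgt C l)"
    using V2.Q_Iso[OF u(2)] unfolding B .
  obtain r1 where r1: "r1 \<in> Mor L1 a1 (tgt C k)" "Q1 s' \<cdot>\<^bsub>L1\<^esub> r1 = ident L1 a1"
      "r1 \<cdot>\<^bsub>L1\<^esub> Q1 s' = ident L1 (tgt C k)"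
    using V1.Q_Iso[OF k(2)] unfolding B .
  obtain r2 where r2: "r2 \<in> Mor L2 a2 (tgt C l)" "Q2 f' \<cdot>\<^bsub>L2\<^esub> r2 = ident L2 a2"
      "r2 \<cdot>\<^bsub>L2\<^esub> Q2 f' = ident L2 (tgt C l)"
    using V2.Q_Iso[OF l(2)] unfolding B .
  note E = B o u'(1)[unfolded V1.L.Mor_iff] v'(1)[unfolded V2.L.Mor_iff] r1(1)[unfolded V1.L.Mor_iff]
    r2(1)[unfolded V2.L.Mor_iff]
  define g1 where "g1 = Q1 s' \<cdot>\<^bsub>L1\<^esub> u'"
  define h1 where "h1 = Q1 u \<cdot>\<^bsub>L1\<^esub> r1"
  define g2 where "g2 = Q2 f' \<cdot>\<^bsub>L2\<^esub> v'"
  define h2 where "h2 = Q2 v \<cdot>\<^bsub>L2\<^esub> r2"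
  have g: "g1 \<in> Mor L1 b a1" "h1 \<in> Mor L1 a1 b" "g2 \<in> Mor L2 b a2" "h2 \<in> Mor L2 a2 b"
    by (simp_all add: g1_def h1_def g2_def h2_def V1.L.Mor_iff V2.L.Mor_iff E)
  note F = E t[unfolded V1.V'.L.Mor_iff]
  have Rg1: "R g1 \<cdot>\<^bsub>L12\<^esub> Q12 u = Q12 s'"
  proof -
    have "R (g1 \<cdot>\<^bsub>L1\<^esub> Q1 u) = R (Q1 s')" using u'(3) by (simp add: g1_def E)
    then show ?thesis using g(1)[unfolded V1.L.Mor_iff] by (simp add: E)
  qed
  have Rg2: "R g2 \<cdot>\<^bsub>L12\<^esub> Q12 v = Q12 f'"
  proof -
    have "R (g2 \<cdot>\<^bsub>L2\<^esub> Q2 v) = R (Q2 f')" using v'(3) by (simp add: g2_def E)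
    then show ?thesis using g(3)[unfolded V2.L.Mor_iff] by (simp add: E)
  qed
  note G = g(1,2)[unfolded V1.L.Mor_iff] g(3,4)[unfolded V2.L.Mor_iff] F
  \<comment> \<open>The arrow \<open>u \<cdot> k\<close>, equal to \<open>v \<cdot> l\<close>, is
    inverted in \<open>L12\<close>. After composition with it both sides become
    \<open>Q12 f\<close>.\<close>
  have "(t \<cdot>\<^bsub>L12\<^esub> R g1) \<cdot>\<^bsub>L12\<^esub> Q12 (u \<cdot> k) = t \<cdot>\<^bsub>L12\<^esub> Q12 s"
    unfolding k(4) by (simp add: G V1.V'.L.comp_eq_arr[OF Rg1])
  also have "\<dots> = R g2 \<cdot>\<^bsub>L12\<^esub> Q12 (u \<cdot> k)"
    unfolding s(4) l(4) b(3) by (simp add: G V1.V'.L.comp_eq_arr[OF Rg2])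
  finally have "t \<cdot>\<^bsub>L12\<^esub> R g1 = R g2"
  proof (rule V1.V'.Q_epi)
    show "u \<cdot> k \<in> V1.V'.S"
      using V1.V'.S_comp[of k u] V1.S_mono[OF u(1)] V2.S_mono[OF k(1)] by (simp add: B)
    show "t \<cdot>\<^bsub>L12\<^esub> R g1 \<in> Mor L12 (tgt C (u \<cdot> k)) a2" "R g2 \<in> Mor L12 (tgt C (u \<cdot> k)) a2"
      by (simp_all add: V1.V'.L.Mor_iff G)
  qed
  moreover have "h1 \<cdot>\<^bsub>L1\<^esub> g1 = ident L1 b" "g1 \<cdot>\<^bsub>L1\<^esub> h1 = ident L1 a1"
    using u'(2) r1(2)
    by (simp_all add: g1_def h1_def E V1.L.comp_eq_arr[OF r1(3)] V1.L.comp_eq_arr[OF u'(3)])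
  moreover have "h2 \<cdot>\<^bsub>L2\<^esub> g2 = ident L2 b" "g2 \<cdot>\<^bsub>L2\<^esub> h2 = ident L2 a2"
    using v'(2) r2(2)
    by (simp_all add: g2_def h2_def E V2.L.comp_eq_arr[OF r2(3)] V2.L.comp_eq_arr[OF v'(3)])
  ultimately show ?thesis using that g B(7) by blast
qed

text \<open>Any common lift \<open>e\<close> satisfies \<open>e \<cdot> e = e\<close> in both
  quotients, so its defect \<open>n\<close> has square zero and commutes with \<open>e\<close>. A
  polynomial in \<open>e\<close> then repairs the lift without changing its images.\<close>

lemma lift_idempotent:
  assumes b: "b \<in> obj C"
    and x: "x1 \<in> Mor L1 b b" "x1 \<cdot>\<^bsub>L1\<^esub> x1 = x1" "x2 \<in> Mor L2 b b" "x2 \<cdot>\<^bsub>L2\<^esub> x2 = x2"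
      "R x1 = R x2"
  obtains e where "e \<in> Mor C b b" "e \<cdot> e = e" "Q1 e = x1" "Q2 e = x2"
proof -
  obtain e where e: "e \<in> Mor C b b" "Q1 e = x1" "Q2 e = x2" by (rule lift_arrow[OF x(1,3,5)])
  note D = e(1)[unfolded Mor_iff] b x(1)[unfolded V1.L.Mor_iff] x(3)[unfolded V2.L.Mor_iff]
  define n where "n = e \<cdot> e \<oplus> \<ominus> e"
  have n: "n \<in> arr C" "src C n = b" "tgt C n = b" by (simp_all add: n_def D)
  have Qn: "Q1 n = mzero L1 b b" "Q2 n = mzero L2 b b" by (simp_all add: n_def D e(2,3) x(2,4))
  then have "factors_through C J1 n" "factors_through C J2 n"
    using V1.Q_zero_iff[of n] V2.Q_zero_iff[of n] n by simp_all
  then have nn: "n \<cdot> n = mzero C b b" using orth_comp[of n n] n by simp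
  have en: "n \<cdot> e = e \<cdot> n" by (simp add: n_def D)
  have ee: "e \<cdot> e = e \<oplus> n" by (simp add: n_def D)
  define m where "m = e \<cdot> n"
  have m: "m \<in> arr C" "src C m = b" "tgt C m = b" by (simp_all add: m_def D n)
  have mm: "n \<cdot> m = mzero C b b" "m \<cdot> n = mzero C b b" "m \<cdot> m = mzero C b b" "e \<cdot> m = m" "m \<cdot> e = m"
  proof -
    show 1: "m \<cdot> n = mzero C b b" by (simp add: m_def D n nn)
    show 2: "n \<cdot> m = mzero C b b"
      using comp_eq_comp[OF en, of n] by (simp add: m_def D n nn)
    have "m \<cdot> m = e \<cdot> (n \<cdot> m)" by (simp add: m_def D n)
    then show "m \<cdot> m = mzero C b b" using 2 D by simp
    show 3: "e \<cdot> m = m" using comp_eq_arr[OF ee, of n] by (simp add: m_def D n nn)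
    show "m \<cdot> e = m" using 3 by (simp add: m_def D n en)
  qed
  \<comment> \<open>Since \<open>m = e n\<close> and \<open>n = e^2 - e\<close>, this is
    \<open>3 e^2 - 2 e^3\<close>, the classical polynomial for lifting idempotents modulo a
    square-zero error.\<close>
  define f where "f = e \<oplus> (n \<oplus> (\<ominus> m \<oplus> \<ominus> m))"
  have f: "f \<in> Mor C b b" by (simp add: Mor_iff f_def D n m)
  have ef: "e \<cdot> f = e \<oplus> (n \<oplus> \<ominus> m)" by (simp add: f_def D n m mm ee m_def[symmetric])
  have nf: "n \<cdot> f = m" by (simp add: f_def D n m mm nn en m_def[symmetric])
  have mf: "m \<cdot> f = m" by (simp add: f_def D n m mm)
  have "f \<cdot> f = e \<cdot> f \<oplus> (n \<cdot> f \<oplus> (\<ominus> (m \<cdot> f) \<oplus> \<ominus> (m \<cdot> f)))"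
    by (subst (1) f_def) (use f in \<open>simp add: D n m Mor_iff\<close>)
  also have "\<dots> = f" unfolding ef nf mf by (simp add: f_def D n m)
  finally have "f \<cdot> f = f" .
  moreover have "Q1 m = mzero L1 b b" "Q2 m = mzero L2 b b" by (simp_all add: m_def D n Qn)
  then have "Q1 f = x1" "Q2 f = x2" by (simp_all add: f_def D n m Qn e(2,3))
  ultimately show ?thesis using that f by blast
qed

end
lemma (in category) absorb_idempotents:
  assumes "e' \<cdot> s \<cdot> e = s" "s \<in> Mor C x y" "e \<in> Mor C x x" "e \<cdot> e = e" "e' \<in> Mor C y y" "e' \<cdot> e' = e'"
  shows "s \<cdot> e = s" "e' \<cdot> s = s"
proof -
  note D = assms(2,3,5)[unfolded Mor_iff]
  have "(e' \<cdot> s \<cdot> e) \<cdot> e = e' \<cdot> s \<cdot> e" by (simp add: D assms(4))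
  then show "s \<cdot> e = s" unfolding assms(1) .
  have "e' \<cdot> (e' \<cdot> s \<cdot> e) = e' \<cdot> s \<cdot> e" by (simp add: D comp_eq_arr[OF assms(6)])
  then show "e' \<cdot> s = s" unfolding assms(1) .
qed

section \<open>Gluing direct summands, and uniqueness of gluings\<close>

context gluing_data
begin

theorem glue_local_summands:
  assumes o: "c1 \<in> obj C" "c2 \<in> obj C"
    and e1: "e1 \<in> Mor L1 c1 c1" "e1 \<cdot>\<^bsub>L1\<^esub> e1 = e1"
    and e2: "e2 \<in> Mor L2 c2 c2" "e2 \<cdot>\<^bsub>L2\<^esub> e2 = e2"
    and s: "s \<in> Mor L12 c1 c2" "R e2 \<cdot>\<^bsub>L12\<^esub> s \<cdot>\<^bsub>L12\<^esub> R e1 = s"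
    and r: "r \<in> Mor L12 c2 c1" "R e1 \<cdot>\<^bsub>L12\<^esub> r \<cdot>\<^bsub>L12\<^esub> R e2 = r"
    and inv: "r \<cdot>\<^bsub>L12\<^esub> s = R e1" "s \<cdot>\<^bsub>L12\<^esub> r = R e2"
  obtains a f1 h1 f2 h2 where "a \<in> obj C"
    "f1 \<in> Mor L1 a c1" "h1 \<in> Mor L1 c1 a" "h1 \<cdot>\<^bsub>L1\<^esub> f1 = ident L1 a" "f1 \<cdot>\<^bsub>L1\<^esub> h1 = e1"
    "f2 \<in> Mor L2 a c2" "h2 \<in> Mor L2 c2 a" "h2 \<cdot>\<^bsub>L2\<^esub> f2 = ident L2 a" "f2 \<cdot>\<^bsub>L2\<^esub> h2 = e2"
    "s \<cdot>\<^bsub>L12\<^esub> R f1 = R f2"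
proof -
  obtain c where "is_direct_sum C c1 c2 c" using ex_direct_sum[OF o] by blast
  then obtain i j p q where c: "c \<in> obj C" "i \<in> Mor C c1 c" "j \<in> Mor C c2 c" "p \<in> Mor C c c1"
      "q \<in> Mor C c c2" "p \<cdot> i = ident C c1" "q \<cdot> j = ident C c2"
      "p \<cdot> j = mzero C c2 c1" "q \<cdot> i = mzero C c1 c2" "i \<cdot> p \<oplus> j \<cdot> q = ident C c"
    unfolding is_direct_sum_def by (elim conjE bexE) (rule that)
  note D = o c(1) c(2-5)[unfolded Mor_iff] e1(1)[unfolded V1.L.Mor_iff] e2(1)[unfolded V2.L.Mor_iff]
    s(1)[unfolded V1.V'.L.Mor_iff] r(1)[unfolded V1.V'.L.Mor_iff]
  let ?i = "Q12 i" and ?j = "Q12 j" and ?p = "Q12 p" and ?q = "Q12 q"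
  have T: "?i \<in> Mor L12 c1 c" "?j \<in> Mor L12 c2 c" "?p \<in> Mor L12 c c1" "?q \<in> Mor L12 c c2"
      "R e1 \<in> Mor L12 c1 c1" "R e2 \<in> Mor L12 c2 c2"
    by (simp_all add: V1.V'.L.Mor_iff D)
  have E1: "R e1 \<cdot>\<^bsub>L12\<^esub> R e1 = R e1" using arg_cong[OF e1(2), of R] by (simp add: D)
  have E2: "R e2 \<cdot>\<^bsub>L12\<^esub> R e2 = R e2" using arg_cong[OF e2(2), of R] by (simp add: D)
  have sE: "s \<cdot>\<^bsub>L12\<^esub> R e1 = s" "R e2 \<cdot>\<^bsub>L12\<^esub> s = s"
    by (rule V1.V'.L.absorb_idempotents[OF s(2) s(1) T(5) E1 T(6) E2])+
  have rE: "r \<cdot>\<^bsub>L12\<^esub> R e2 = r" "R e1 \<cdot>\<^bsub>L12\<^esub> r = r"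
    by (rule V1.V'.L.absorb_idempotents[OF r(2) r(1) T(6) E2 T(5) E1])+
  let ?d = "ident L12 c2 \<oplus>\<^bsub>L12\<^esub> \<ominus>\<^bsub>L12\<^esub> (R e2)"
  have Q12: "?p \<cdot>\<^bsub>L12\<^esub> ?i = ident L12 c1" "?q \<cdot>\<^bsub>L12\<^esub> ?j = ident L12 c2"
      "?p \<cdot>\<^bsub>L12\<^esub> ?j = mzero L12 c2 c1" "?q \<cdot>\<^bsub>L12\<^esub> ?i = mzero L12 c1 c2"
      "?i \<cdot>\<^bsub>L12\<^esub> ?p \<oplus>\<^bsub>L12\<^esub> ?j \<cdot>\<^bsub>L12\<^esub> ?q = ident L12 c"
    using c(6-10)[THEN arg_cong, of Q12] by (simp_all add: D)
  obtain t where t: "t \<in> Mor L12 c c" "t \<cdot>\<^bsub>L12\<^esub> t = ident L12 c"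
      "?q \<cdot>\<^bsub>L12\<^esub> t = s \<cdot>\<^bsub>L12\<^esub> ?p \<oplus>\<^bsub>L12\<^esub> ?d \<cdot>\<^bsub>L12\<^esub> ?q"
      "t \<cdot>\<^bsub>L12\<^esub> ?j = ?i \<cdot>\<^bsub>L12\<^esub> r \<oplus>\<^bsub>L12\<^esub> ?j \<cdot>\<^bsub>L12\<^esub> ?d"
    by (rule V1.V'.L.exchange_involution[OF T(1-4) Q12 T(5,6) E1 E2 s(1) r(1) inv sE rE])
  \<comment> \<open>\<open>t\<close> is its own inverse and therefore serves as both arrows in
    \<open>glue_objects\<close>.\<close>
  obtain b g1 k1 g2 k2 where b: "b \<in> obj C"
    "g1 \<in> Mor L1 b c" "k1 \<in> Mor L1 c b" "k1 \<cdot>\<^bsub>L1\<^esub> g1 = ident L1 b" "g1 \<cdot>\<^bsub>L1\<^esub> k1 = ident L1 c"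
    "g2 \<in> Mor L2 b c" "k2 \<in> Mor L2 c b" "k2 \<cdot>\<^bsub>L2\<^esub> g2 = ident L2 b" "g2 \<cdot>\<^bsub>L2\<^esub> k2 = ident L2 c"
    "t \<cdot>\<^bsub>L12\<^esub> R g1 = R g2"
    by (rule glue_objects[OF t(1,1,2,2)])
  note D = D b(1) b(2,3)[unfolded V1.L.Mor_iff] b(6,7)[unfolded V2.L.Mor_iff] t(1)[unfolded V1.V'.L.Mor_iff]
  have pi: "Q1 p \<cdot>\<^bsub>L1\<^esub> Q1 i = ident L1 c1" using arg_cong[OF c(6), of Q1] by (simp add: D)
  have qj: "Q2 q \<cdot>\<^bsub>L2\<^esub> Q2 j = ident L2 c2" using arg_cong[OF c(7), of Q2] by (simp add: D)
  \<comment> \<open>In \<open>L1\<close> the summand is read off through the first factor by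
    \<open>p\<close>, in \<open>L2\<close> through the second by \<open>q\<close>; the involution
    \<open>t\<close> matches the two.\<close>
  define f1 where "f1 = e1 \<cdot>\<^bsub>L1\<^esub> Q1 p \<cdot>\<^bsub>L1\<^esub> g1"
  define h1 where "h1 = k1 \<cdot>\<^bsub>L1\<^esub> Q1 i \<cdot>\<^bsub>L1\<^esub> e1"
  define f2 where "f2 = e2 \<cdot>\<^bsub>L2\<^esub> Q2 q \<cdot>\<^bsub>L2\<^esub> g2"
  define h2 where "h2 = k2 \<cdot>\<^bsub>L2\<^esub> Q2 j \<cdot>\<^bsub>L2\<^esub> e2"
  have F1: "f1 \<in> arr L1" "src L1 f1 = b" "tgt L1 f1 = c1" "h1 \<in> arr L1" "src L1 h1 = c1" "tgt L1 h1 = b"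
    by (simp_all add: f1_def h1_def D)
  have F2: "f2 \<in> arr L2" "src L2 f2 = b" "tgt L2 f2 = c2" "h2 \<in> arr L2" "src L2 h2 = c2" "tgt L2 h2 = b"
    by (simp_all add: f2_def h2_def D)
  have fh1: "f1 \<cdot>\<^bsub>L1\<^esub> h1 = e1"
    by (simp add: f1_def h1_def D V1.L.comp_eq_arr[OF b(5)] V1.L.comp_eq_arr[OF pi] e1(2))
  have fh2: "f2 \<cdot>\<^bsub>L2\<^esub> h2 = e2"
    by (simp add: f2_def h2_def D V2.L.comp_eq_arr[OF b(9)] V2.L.comp_eq_arr[OF qj] e2(2))
  have ef1: "e1 \<cdot>\<^bsub>L1\<^esub> f1 = f1" by (simp add: f1_def D V1.L.comp_eq_arr[OF e1(2)])
  have ef2: "e2 \<cdot>\<^bsub>L2\<^esub> f2 = f2" by (simp add: f2_def D V2.L.comp_eq_arr[OF e2(2)])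
  have he1: "h1 \<cdot>\<^bsub>L1\<^esub> e1 = h1" by (simp add: h1_def D e1(2))
  have he2: "h2 \<cdot>\<^bsub>L2\<^esub> e2 = h2" by (simp add: h2_def D e2(2))
  have Rgk1: "R g1 \<cdot>\<^bsub>L12\<^esub> R k1 = ident L12 c" using arg_cong[OF b(5), of R] by (simp add: D)
  have Rkg2: "R k2 \<cdot>\<^bsub>L12\<^esub> R g2 = ident L12 b" using arg_cong[OF b(8), of R] by (simp add: D)
  have Rk2: "R k2 = R k1 \<cdot>\<^bsub>L12\<^esub> t"
  proof -
    have "R k2 \<cdot>\<^bsub>L12\<^esub> t \<cdot>\<^bsub>L12\<^esub> R g1 = ident L12 b" unfolding b(10) by (rule Rkg2)
    then have "(R k2 \<cdot>\<^bsub>L12\<^esub> t \<cdot>\<^bsub>L12\<^esub> R g1) \<cdot>\<^bsub>L12\<^esub> R k1 \<cdot>\<^bsub>L12\<^esub> t = R k1 \<cdot>\<^bsub>L12\<^esub> t" by (simp add: D)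
    then show ?thesis by (simp add: D V1.V'.L.comp_eq_arr[OF Rgk1] t(2))
  qed
  have Rf: "s \<cdot>\<^bsub>L12\<^esub> R f1 = R f2"
  proof -
    \<comment> \<open>The row \<open>?q \<cdot> t\<close> has a second term with the factor
      \<open>1 - e2\<close>, which composition with \<open>R e2\<close> kills. The column
      \<open>t \<cdot> ?j\<close> is treated in the same way in \<open>Rh\<close>.\<close>
    have "R f2 = R e2 \<cdot>\<^bsub>L12\<^esub> (?q \<cdot>\<^bsub>L12\<^esub> t) \<cdot>\<^bsub>L12\<^esub> R g1" by (simp add: f2_def D b(10)[symmetric])
    also have "\<dots> = s \<cdot>\<^bsub>L12\<^esub> ?p \<cdot>\<^bsub>L12\<^esub> R g1"
      unfolding t(3) by (simp add: D V1.V'.L.comp_eq_arr[OF sE(2)] V1.V'.L.comp_eq_arr[OF E2])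
    also have "\<dots> = s \<cdot>\<^bsub>L12\<^esub> R f1" by (simp add: f1_def D V1.V'.L.comp_eq_arr[OF sE(1)])
    finally show ?thesis ..
  qed
  have Rh: "R h2 = R h1 \<cdot>\<^bsub>L12\<^esub> r"
  proof -
    have "R h2 = R k1 \<cdot>\<^bsub>L12\<^esub> (t \<cdot>\<^bsub>L12\<^esub> ?j) \<cdot>\<^bsub>L12\<^esub> R e2" by (simp add: h2_def D Rk2)
    also have "\<dots> = R h1 \<cdot>\<^bsub>L12\<^esub> r" unfolding t(4) by (simp add: h1_def D rE E2)
    finally show ?thesis .
  qed
  \<comment> \<open>The endomorphisms \<open>h1 f1\<close> and \<open>h2 f2\<close> of
    \<open>b\<close> are idempotents in their quotients; as \<open>r\<close> after \<open>s\<close>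
    is \<open>R e1\<close>, they agree in \<open>L12\<close> and lift to one idempotent. Its image
    is the glued object.\<close>
  have "R (h2 \<cdot>\<^bsub>L2\<^esub> f2) = R h1 \<cdot>\<^bsub>L12\<^esub> R (e1 \<cdot>\<^bsub>L1\<^esub> f1)"
    by (simp add: F1 F2 D Rh Rf[symmetric] V1.V'.L.comp_eq_arr[OF inv(1)])
  then have Re: "R (h1 \<cdot>\<^bsub>L1\<^esub> f1) = R (h2 \<cdot>\<^bsub>L2\<^esub> f2)" unfolding ef1 by (simp add: F1)
  have x1: "h1 \<cdot>\<^bsub>L1\<^esub> f1 \<in> Mor L1 b b" "(h1 \<cdot>\<^bsub>L1\<^esub> f1) \<cdot>\<^bsub>L1\<^esub> (h1 \<cdot>\<^bsub>L1\<^esub> f1) = h1 \<cdot>\<^bsub>L1\<^esub> f1"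
    by (simp_all add: V1.L.Mor_iff F1 V1.L.comp_eq_arr[OF fh1] ef1)
  have x2: "h2 \<cdot>\<^bsub>L2\<^esub> f2 \<in> Mor L2 b b" "(h2 \<cdot>\<^bsub>L2\<^esub> f2) \<cdot>\<^bsub>L2\<^esub> (h2 \<cdot>\<^bsub>L2\<^esub> f2) = h2 \<cdot>\<^bsub>L2\<^esub> f2"
    by (simp_all add: V2.L.Mor_iff F2 V2.L.comp_eq_arr[OF fh2] ef2)
  obtain e where e: "e \<in> Mor C b b" "e \<cdot> e = e" "Q1 e = h1 \<cdot>\<^bsub>L1\<^esub> f1" "Q2 e = h2 \<cdot>\<^bsub>L2\<^esub> f2"
    by (rule lift_idempotent[OF b(1) x1 x2 Re])
  obtain a u v where a: "a \<in> obj C" "u \<in> Mor C b a" "v \<in> Mor C a b" "v \<cdot> u = e" "u \<cdot> v = ident C a"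
    using idempotent_complete b(1) e(1,2) unfolding idempotent_complete_def by blast
  note G = F1 F2 D a(1) a(2,3)[unfolded Mor_iff]
  have vu1: "Q1 v \<cdot>\<^bsub>L1\<^esub> Q1 u = h1 \<cdot>\<^bsub>L1\<^esub> f1" using arg_cong[OF a(4), of Q1] e(3) by (simp add: G)
  have vu2: "Q2 v \<cdot>\<^bsub>L2\<^esub> Q2 u = h2 \<cdot>\<^bsub>L2\<^esub> f2" using arg_cong[OF a(4), of Q2] e(4) by (simp add: G)
  have uv1: "Q1 u \<cdot>\<^bsub>L1\<^esub> Q1 v = ident L1 a" using arg_cong[OF a(5), of Q1] by (simp add: G)
  have uv2: "Q2 u \<cdot>\<^bsub>L2\<^esub> Q2 v = ident L2 a" using arg_cong[OF a(5), of Q2] by (simp add: G)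
  show ?thesis
  proof (rule that[OF a(1)])
    show "f1 \<cdot>\<^bsub>L1\<^esub> Q1 v \<in> Mor L1 a c1" "Q1 u \<cdot>\<^bsub>L1\<^esub> h1 \<in> Mor L1 c1 a" by (simp_all add: V1.L.Mor_iff G)
    show "f2 \<cdot>\<^bsub>L2\<^esub> Q2 v \<in> Mor L2 a c2" "Q2 u \<cdot>\<^bsub>L2\<^esub> h2 \<in> Mor L2 c2 a" by (simp_all add: V2.L.Mor_iff G)
    show "(Q1 u \<cdot>\<^bsub>L1\<^esub> h1) \<cdot>\<^bsub>L1\<^esub> f1 \<cdot>\<^bsub>L1\<^esub> Q1 v = ident L1 a"
      by (simp add: G V1.L.comp_eq_comp[OF vu1[symmetric]] uv1)
    show "(Q2 u \<cdot>\<^bsub>L2\<^esub> h2) \<cdot>\<^bsub>L2\<^esub> f2 \<cdot>\<^bsub>L2\<^esub> Q2 v = ident L2 a"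
      by (simp add: G V2.L.comp_eq_comp[OF vu2[symmetric]] uv2)
    show "(f1 \<cdot>\<^bsub>L1\<^esub> Q1 v) \<cdot>\<^bsub>L1\<^esub> Q1 u \<cdot>\<^bsub>L1\<^esub> h1 = e1"
      by (simp add: G V1.L.comp_eq_comp[OF vu1] fh1 e1(2) V1.L.comp_eq_arr[OF fh1] he1)
    show "(f2 \<cdot>\<^bsub>L2\<^esub> Q2 v) \<cdot>\<^bsub>L2\<^esub> Q2 u \<cdot>\<^bsub>L2\<^esub> h2 = e2"
      by (simp add: G V2.L.comp_eq_comp[OF vu2] fh2 e2(2) V2.L.comp_eq_arr[OF fh2] he2)
    show "s \<cdot>\<^bsub>L12\<^esub> R (f1 \<cdot>\<^bsub>L1\<^esub> Q1 v) = R (f2 \<cdot>\<^bsub>L2\<^esub> Q2 v)"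
      by (simp add: G Rf[symmetric])
  qed
qed

text \<open>The comparison arrows \<open>h1' f1\<close> and \<open>h2' f2\<close> agree in
  \<open>L12\<close> and lift to one arrow. Lifting in the opposite direction as well gives arrows
  that are mutually inverse in both quotients, though perhaps not before localization.\<close>

theorem gluing_unique:
  assumes s: "s \<in> Mor L12 c1 c2" "s \<cdot>\<^bsub>L12\<^esub> R e1 = s"
    and f1: "f1 \<in> Mor L1 a c1" "h1 \<in> Mor L1 c1 a" "h1 \<cdot>\<^bsub>L1\<^esub> f1 = ident L1 a" "f1 \<cdot>\<^bsub>L1\<^esub> h1 = e1"
    and f2: "f2 \<in> Mor L2 a c2" "h2 \<in> Mor L2 c2 a" "h2 \<cdot>\<^bsub>L2\<^esub> f2 = ident L2 a" "f2 \<cdot>\<^bsub>L2\<^esub> h2 = e2"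
    and sf: "s \<cdot>\<^bsub>L12\<^esub> R f1 = R f2"
    and f1': "f1' \<in> Mor L1 a' c1" "h1' \<in> Mor L1 c1 a'" "h1' \<cdot>\<^bsub>L1\<^esub> f1' = ident L1 a'" "f1' \<cdot>\<^bsub>L1\<^esub> h1' = e1"
    and f2': "f2' \<in> Mor L2 a' c2" "h2' \<in> Mor L2 c2 a'" "h2' \<cdot>\<^bsub>L2\<^esub> f2' = ident L2 a'" "f2' \<cdot>\<^bsub>L2\<^esub> h2' = e2"
    and sf': "s \<cdot>\<^bsub>L12\<^esub> R f1' = R f2'"
  obtains g where "g \<in> Iso C a a'" "f1' \<cdot>\<^bsub>L1\<^esub> Q1 g = f1" "f2' \<cdot>\<^bsub>L2\<^esub> Q2 g = f2"
proof -
  \<comment> \<open>The point is that \<open>s\<close> can be recovered from a gluing as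
    \<open>R l'\<close> after \<open>R h'\<close>. The claim is kept general in both gluings so as
    to serve both directions.\<close>
  have compatible: "R (h' \<cdot>\<^bsub>L1\<^esub> f) = R (k' \<cdot>\<^bsub>L2\<^esub> l)"
    if "f \<in> Mor L1 x c1" "l \<in> Mor L2 x c2" "f' \<in> Mor L1 y c1" "l' \<in> Mor L2 y c2"
      "h' \<in> Mor L1 c1 y" "k' \<in> Mor L2 c2 y" "k' \<cdot>\<^bsub>L2\<^esub> l' = ident L2 y" "f' \<cdot>\<^bsub>L1\<^esub> h' = e1"
      "s \<cdot>\<^bsub>L12\<^esub> R f = R l" "s \<cdot>\<^bsub>L12\<^esub> R f' = R l'"
    for f l f' l' h' k' x y
  proof -
    note D = that(1,3,5)[unfolded V1.L.Mor_iff] that(2,4,6)[unfolded V2.L.Mor_iff]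
      s(1)[unfolded V1.V'.L.Mor_iff] V1.L.Mor_obj[OF that(3), unfolded V1.obj_L]
    have 1: "R k' \<cdot>\<^bsub>L12\<^esub> R l' = ident L12 y" using arg_cong[OF that(7), of R] by (simp add: D)
    have "R f' \<cdot>\<^bsub>L12\<^esub> R h' = R e1" using arg_cong[OF that(8), of R] by (simp add: D)
    then have "s = s \<cdot>\<^bsub>L12\<^esub> R f' \<cdot>\<^bsub>L12\<^esub> R h'" using s(2) by simp
    also have "\<dots> = R l' \<cdot>\<^bsub>L12\<^esub> R h'" by (simp add: D V1.V'.L.comp_eq_arr[OF that(10)])
    finally have 2: "R l' \<cdot>\<^bsub>L12\<^esub> R h' = s" by simp
    have "R (k' \<cdot>\<^bsub>L2\<^esub> l) = R k' \<cdot>\<^bsub>L12\<^esub> (R l' \<cdot>\<^bsub>L12\<^esub> R h') \<cdot>\<^bsub>L12\<^esub> R f"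
      unfolding 2 by (simp add: D that(9))
    also have "\<dots> = R (h' \<cdot>\<^bsub>L1\<^esub> f)" by (simp add: D V1.V'.L.comp_eq_arr[OF 1])
    finally show ?thesis ..
  qed
  note D = f1(1,2)[unfolded V1.L.Mor_iff] f1'(1,2)[unfolded V1.L.Mor_iff]
    f2(1,2)[unfolded V2.L.Mor_iff] f2'(1,2)[unfolded V2.L.Mor_iff]
  have ef: "e1 \<cdot>\<^bsub>L1\<^esub> f1 = f1" "e2 \<cdot>\<^bsub>L2\<^esub> f2 = f2"
    unfolding f1(4)[symmetric] f2(4)[symmetric] by (simp_all add: D f1(3) f2(3))
  have ef': "e1 \<cdot>\<^bsub>L1\<^esub> f1' = f1'" "e2 \<cdot>\<^bsub>L2\<^esub> f2' = f2'"
    unfolding f1'(4)[symmetric] f2'(4)[symmetric] by (simp_all add: D f1'(3) f2'(3))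
  obtain g where g: "g \<in> Mor C a a'" "Q1 g = h1' \<cdot>\<^bsub>L1\<^esub> f1" "Q2 g = h2' \<cdot>\<^bsub>L2\<^esub> f2"
    by (rule lift_arrow[of "h1' \<cdot>\<^bsub>L1\<^esub> f1" a a' "h2' \<cdot>\<^bsub>L2\<^esub> f2"])
      (use compatible[OF f1(1) f2(1) f1'(1) f2'(1) f1'(2) f2'(2) f2'(3) f1'(4) sf sf'] in
        \<open>simp_all add: V1.L.Mor_iff V2.L.Mor_iff D\<close>)
  obtain g' where g': "g' \<in> Mor C a' a" "Q1 g' = h1 \<cdot>\<^bsub>L1\<^esub> f1'" "Q2 g' = h2 \<cdot>\<^bsub>L2\<^esub> f2'"
    by (rule lift_arrow[of "h1 \<cdot>\<^bsub>L1\<^esub> f1'" a' a "h2 \<cdot>\<^bsub>L2\<^esub> f2'"])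
      (use compatible[OF f1'(1) f2'(1) f1(1) f2(1) f1(2) f2(2) f2(3) f1(4) sf' sf] in
        \<open>simp_all add: V1.L.Mor_iff V2.L.Mor_iff D\<close>)
  have "g \<in> Iso C a a'"
    by (rule Iso_of_local_inverses[OF g(1) g'(1)])
      (simp_all add: g g' D ef ef' f1(3) f2(3) f1'(3) f2'(3) V1.L.comp_eq_arr[OF f1(4)]
        V1.L.comp_eq_arr[OF f1'(4)] V2.L.comp_eq_arr[OF f2(4)] V2.L.comp_eq_arr[OF f2'(4)])
  moreover have "f1' \<cdot>\<^bsub>L1\<^esub> Q1 g = f1" "f2' \<cdot>\<^bsub>L2\<^esub> Q2 g = f2"
    by (simp_all add: g D ef V1.L.comp_eq_arr[OF f1'(4)] V2.L.comp_eq_arr[OF f2'(4)])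
  ultimately show ?thesis by (rule that)
qed

end
section \<open>Thick tensor ideals and primes\<close>

lemma (in triangulated_category) thick_subcategoryI:
  assumes "J \<subseteq> obj C" "\<And>z. is_zero_object C z \<Longrightarrow> z \<in> J"
    and "\<And>a. a \<in> J \<Longrightarrow> T a \<in> J" "\<And>a. a \<in> obj C \<Longrightarrow> T a \<in> J \<Longrightarrow> a \<in> J"
    and cone: "\<And>f g h x y z. tri C f g h x y z \<Longrightarrow> x \<in> J \<Longrightarrow> y \<in> J \<Longrightarrow> z \<in> J"
    and retract: "\<And>a b i p. b \<in> J \<Longrightarrow> i \<in> Mor C a b \<Longrightarrow> p \<in> Mor C b a \<Longrightarrow> p \<cdot> i = ident C a \<Longrightarrow> a \<in> J"
  shows "thick_subcategory C J"
proof -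
  have iso: "b \<in> J" if ab: "a \<in> J" "Iso C a b \<noteq> {}" for a b
  proof -
    obtain f g where "f \<in> Mor C a b" "g \<in> Mor C b a" "f \<cdot> g = ident C b"
      using ab(2) by (auto simp: Iso_iff)
    then show ?thesis using retract[OF ab(1)] by blast
  qed
  have susp: "T a \<in> J \<longleftrightarrow> a \<in> J" if "a \<in> obj C" for a using assms(3,4) that by blast
  have dist: "tgt C g \<in> J" if "(f, g, h) \<in> dist C" "src C f \<in> J" "tgt C f \<in> J" for f g h
    using cone[OF dist_tri[OF that(1)] that(2,3)] .
  have "triangulated_subcategory C J"
    unfolding triangulated_subcategory_def
    by (intro conjI ballI allI impI) (rule assms(1) assms(2) iso susp dist; assumption)+
  then show ?thesis unfolding thick_subcategory_def using retract by blast
qed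

lemma (in triangulated_category) verdierI: "thick_subcategory C J \<Longrightarrow> verdier C J"
  by (intro verdier.intro triangulated_category_axioms verdier_axioms.intro)

text \<open>The cone \<open>w\<close> of the inclusion \<open>i\<close> is a retract of
  \<open>b\<close>: as \<open>i\<close> is split, the connecting arrow vanishes, so an endomorphism
  of \<open>w\<close> that is zero after \<open>g\<close> is zero.\<close>

lemma (in verdier) J_direct_sum:
  assumes "is_direct_sum C a b c" "a \<in> J" "b \<in> J"
  shows "c \<in> J"
proof -
  obtain i j p q where c: "c \<in> obj C" "i \<in> Mor C a c" "j \<in> Mor C b c" "p \<in> Mor C c a"
      "q \<in> Mor C c b" "p \<cdot> i = ident C a" "q \<cdot> j = ident C b"
      "p \<cdot> j = mzero C b a" "q \<cdot> i = mzero C a b" "i \<cdot> p \<oplus> j \<cdot> q = ident C c"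
    using assms(1) unfolding is_direct_sum_def by (elim conjE bexE) (rule that)
  obtain w g h where t: "tri C i g h a c w" by (rule ex_cone[OF c(2)])
  note D = triD[OF t] c(3-5)[unfolded Mor_iff] J_obj[OF assms(3)]
  obtain q' where q': "q' \<in> Mor C w b" "q' \<cdot> g = q" by (rule tri_extend[OF t c(5) c(9)])
  note D = D q'(1)[unfolded Mor_iff]
  have Tp: "Tm p \<cdot> Tm i = ident C (T a)" using arg_cong[OF c(6), of Tm] D by simp
  have h: "h = mzero C w (T a)" using comp_eq_arr[OF Tp, of h] tri_comp(3)[OF t] D by simp
  have "g = g \<cdot> (i \<cdot> p \<oplus> j \<cdot> q)" using c(10) D by simp
  then have "g = (g \<cdot> j \<cdot> q') \<cdot> g"
    using D q'(2) zero_comp_cong[of g i p] tri_comp(1)[OF t] by simp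
  then have "(g \<cdot> j \<cdot> q' \<oplus> \<ominus> (ident C w)) \<cdot> g = mzero C c w" using D by simp
  moreover have "g \<cdot> j \<cdot> q' \<oplus> \<ominus> (ident C w) \<in> Mor C w w" using D by (simp add: Mor_iff)
  ultimately obtain l where "l \<in> Mor C (T a) w" "l \<cdot> h = g \<cdot> j \<cdot> q' \<oplus> \<ominus> (ident C w)"
    using tri_extend2[OF t] by blast
  then have z: "g \<cdot> j \<cdot> q' \<oplus> \<ominus> (ident C w) = mzero C w w" using h D by (simp add: Mor_iff)
  have "g \<cdot> j \<cdot> q' = ident C w" by (rule diff_eq_zero) (simp_all add: D z)
  then have "(g \<cdot> j) \<cdot> q' = ident C w" by (simp add: D)
  then have "w \<in> J" by (rule J_retract[OF assms(3), rotated 2]) (simp_all add: Mor_iff D)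
  then show ?thesis using J_middle[OF t assms(2)] by blast
qed

section \<open>Thick tensor ideals and the duality splitting\<close>

context tensor_triangulated_category
begin

lemma tensor_obj' [simp]: "a \<in> obj K \<Longrightarrow> b \<in> obj K \<Longrightarrow> a \<otimes> b \<in> obj K"
  by (rule tensor_obj)

lemma tensorm_arr [simp]:
  assumes "f \<in> arr K" "g \<in> arr K"
  shows "f \<boxtimes> g \<in> arr K" "src K (f \<boxtimes> g) = src K f \<otimes> src K g" "tgt K (f \<boxtimes> g) = tgt K f \<otimes> tgt K g"
  using tensorm_Mor[of f "src K f" "tgt K f" g "src K g" "tgt K g"] assms by (auto simp: Mor_iff)

lemma tensorm_comp_arr:
  assumes "f \<in> arr K" "f' \<in> arr K" "g \<in> arr K" "g' \<in> arr K" "src K f' = tgt K f" "src K g' = tgt K g"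
  shows "(f' \<boxtimes> g') \<cdot> (f \<boxtimes> g) = (f' \<cdot> f) \<boxtimes> (g' \<cdot> g)"
  using tensorm_comp[of f "src K f" "tgt K f" f' "tgt K f'" g "src K g" "tgt K g" g' "tgt K g'"] assms
  by (simp add: Mor_iff)

lemma exact_left:
  assumes "b \<in> obj K"
  shows "additive_on_Mor K K (\<lambda>f. f \<boxtimes> ident K b)"
    and "a \<in> obj K \<Longrightarrow> suspl K a b \<in> Iso K (T a \<otimes> b) (T (a \<otimes> b))"
    and "(f, g, h) \<in> dist K \<Longrightarrow>
      (f \<boxtimes> ident K b, g \<boxtimes> ident K b, suspl K (src K f) b \<cdot> (h \<boxtimes> ident K b)) \<in> dist K"
proof -
  have e: "exact_functor K K (\<lambda>a. a \<otimes> b) (\<lambda>f. f \<boxtimes> ident K b) (\<lambda>a. suspl K a b)"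
    by (rule tensor_exact_left[OF assms])
  show "additive_on_Mor K K (\<lambda>f. f \<boxtimes> ident K b)" using e unfolding exact_functor_def by (elim conjE)
  show "suspl K a b \<in> Iso K (T a \<otimes> b) (T (a \<otimes> b))" if "a \<in> obj K"
    using e that unfolding exact_functor_def by blast
  show "(f \<boxtimes> ident K b, g \<boxtimes> ident K b, suspl K (src K f) b \<cdot> (h \<boxtimes> ident K b)) \<in> dist K"
    if "(f, g, h) \<in> dist K"
    using e that unfolding exact_functor_def by blast
qed

lemma tensorm_madd_left:
  assumes "f \<in> Mor K x y" "g \<in> Mor K x y" "b \<in> obj K"
  shows "(f \<oplus> g) \<boxtimes> ident K b = f \<boxtimes> ident K b \<oplus> g \<boxtimes> ident K b"
  using exact_left(1)[OF assms(3)] assms unfolding additive_on_Mor_def by blast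

lemma zero_object_tensor:
  assumes "is_zero_object K z" "b \<in> obj K"
  shows "is_zero_object K (z \<otimes> b)"
proof -
  have z: "z \<in> obj K" "ident K z = mzero K z z" using assms(1) by (simp_all add: zero_object_iff)
  let ?f = "ident K z \<boxtimes> ident K b"
  have "ident K z \<oplus> ident K z = ident K z" using z by simp
  then have f: "?f \<oplus> ?f = ?f"
    using tensorm_madd_left[of "ident K z" z z "ident K z" b] z(1) assms(2) by (simp add: Mor_iff)
  have "?f = \<ominus> ?f \<oplus> (?f \<oplus> ?f)" using z(1) assms(2) by simp
  also have "\<dots> = mzero K (z \<otimes> b) (z \<otimes> b)" unfolding f using z(1) assms(2) by simp
  finally show ?thesis using z(1) assms(2) tensorm_ident by (simp add: zero_object_iff)
qed

lemma Iso_tensor: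
  assumes "f \<in> Iso K a b" "g \<in> Iso K c d"
  shows "f \<boxtimes> g \<in> Iso K (a \<otimes> c) (b \<otimes> d)"
proof -
  obtain f' where f: "f \<in> Mor K a b" "f' \<in> Mor K b a" "f' \<cdot> f = ident K a" "f \<cdot> f' = ident K b"
    using assms(1) unfolding Iso_iff by blast
  obtain g' where g: "g \<in> Mor K c d" "g' \<in> Mor K d c" "g' \<cdot> g = ident K c" "g \<cdot> g' = ident K d"
    using assms(2) unfolding Iso_iff by blast
  note D = f(1,2)[unfolded Mor_iff] g(1,2)[unfolded Mor_iff] Mor_obj[OF f(1)] Mor_obj[OF g(1)]
  have "(f' \<boxtimes> g') \<cdot> (f \<boxtimes> g) = ident K (a \<otimes> c)" "(f \<boxtimes> g) \<cdot> (f' \<boxtimes> g') = ident K (b \<otimes> d)"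
    using f(3,4) g(3,4) by (simp_all add: D tensorm_comp_arr tensorm_ident)
  then show ?thesis unfolding Iso_iff using D by (auto simp: Mor_iff intro!: bexI[of _ "f' \<boxtimes> g'"])
qed

lemma braid_Iso: "a \<in> obj K \<Longrightarrow> b \<in> obj K \<Longrightarrow> braid K a b \<in> Iso K (a \<otimes> b) (b \<otimes> a)"
  unfolding Iso_iff using braid_Mor braid_symmetry by blast

definition thick_ideal :: "'o set \<Rightarrow> bool" where
  "thick_ideal J \<longleftrightarrow> thick_subcategory K J \<and> (\<forall>a \<in> J. \<forall>b \<in> obj K. a \<otimes> b \<in> J)"

lemma thick_ideal_verdier: "thick_ideal J \<Longrightarrow> verdier K J"
  by (simp add: thick_ideal_def verdierI)

lemma thick_ideal_obj: "thick_ideal J \<Longrightarrow> a \<in> J \<Longrightarrow> a \<in> obj K"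
  using verdier.J_obj[OF thick_ideal_verdier] by blast

lemma thick_ideal_iso: "thick_ideal J \<Longrightarrow> a \<in> J \<Longrightarrow> f \<in> Iso K a b \<Longrightarrow> b \<in> J"
  using verdier.J_iso[OF thick_ideal_verdier] by blast

lemma thick_ideal_retract:
  "thick_ideal J \<Longrightarrow> b \<in> J \<Longrightarrow> i \<in> Mor K a b \<Longrightarrow> p \<in> Mor K b a \<Longrightarrow> p \<cdot> i = ident K a \<Longrightarrow> a \<in> J"
  using verdier.J_retract[OF thick_ideal_verdier] by blast

lemma thick_ideal_tensor: "thick_ideal J \<Longrightarrow> a \<in> J \<Longrightarrow> b \<in> obj K \<Longrightarrow> a \<otimes> b \<in> J"
  by (simp add: thick_ideal_def)

lemma thick_ideal_commute: "thick_ideal J \<Longrightarrow> a \<otimes> b \<in> J \<Longrightarrow> a \<in> obj K \<Longrightarrow> b \<in> obj K \<Longrightarrow> b \<otimes> a \<in> J"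
  by (rule thick_ideal_iso[OF _ _ braid_Iso])

lemma thick_ideal_assoc:
  assumes "thick_ideal J" "a \<in> obj K" "b \<in> obj K" "c \<in> obj K"
  shows "(a \<otimes> b) \<otimes> c \<in> J \<longleftrightarrow> a \<otimes> (b \<otimes> c) \<in> J"
  using thick_ideal_iso[OF assms(1)] assoc_Iso[OF assms(2-4)] Iso_sym by blast

text \<open>The ideal quotient of \<open>J\<close> by \<open>b\<close>. Exactness of the tensor
  product makes it thick, and shuffling factors by associativity and braiding makes it an ideal. It
  drives the primality argument in \<open>ex_prime_ideal\<close>.\<close>

lemma thick_ideal_colon:
  assumes J: "thick_ideal J" and b: "b \<in> obj K"
  shows "thick_ideal {x \<in> obj K. x \<otimes> b \<in> J}"
proof -
  interpret verdier K J by (rule thick_ideal_verdier[OF J])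
  have susp: "T a \<otimes> b \<in> J \<longleftrightarrow> a \<otimes> b \<in> J" if a: "a \<in> obj K" for a
  proof -
    have "suspl K a b \<in> Iso K (T a \<otimes> b) (T (a \<otimes> b))" by (rule exact_left(2)[OF b a])
    then have "T a \<otimes> b \<in> J \<longleftrightarrow> T (a \<otimes> b) \<in> J" using J_iso Iso_sym by blast
    then show ?thesis using J_susp[of "a \<otimes> b"] a b by simp
  qed
  have "thick_subcategory K {x \<in> obj K. x \<otimes> b \<in> J}"
  proof (rule thick_subcategoryI)
    show "z \<in> {x \<in> obj K. x \<otimes> b \<in> J}" if "is_zero_object K z" for z
      using J_zero[OF zero_object_tensor[OF that b]] that by (simp add: zero_object_iff)
    show "z \<in> {x \<in> obj K. x \<otimes> b \<in> J}"
      if t: "tri K f g h x y z" "x \<in> {x \<in> obj K. x \<otimes> b \<in> J}" "y \<in> {x \<in> obj K. x \<otimes> b \<in> J}"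
      for f g h x y z
    proof -
      note D = triD[OF t(1)]
      have "tri K (f \<boxtimes> ident K b) (g \<boxtimes> ident K b) (suspl K (src K f) b \<cdot> (h \<boxtimes> ident K b))
          (x \<otimes> b) (y \<otimes> b) (z \<otimes> b)"
        using dist_tri[OF exact_left(3)[OF b D(13)]] D b by simp
      then show ?thesis using J_cone t D by blast
    qed
    show "a \<in> {x \<in> obj K. x \<otimes> b \<in> J}"
      if t: "y \<in> {x \<in> obj K. x \<otimes> b \<in> J}" "i \<in> Mor K a y" "p \<in> Mor K y a" "p \<cdot> i = ident K a" for a y i p
    proof -
      note D = t(2,3)[unfolded Mor_iff] Mor_obj[OF t(2)] b
      have "(p \<boxtimes> ident K b) \<cdot> (i \<boxtimes> ident K b) = ident K (a \<otimes> b)"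
        using t(4) by (simp add: D tensorm_comp_arr tensorm_ident)
      then have "a \<otimes> b \<in> J"
        by (rule J_retract[rotated 3]) (use t(1) in \<open>simp_all add: D Mor_iff\<close>)
      then show ?thesis using D by simp
    qed
  qed (use susp in auto)
  moreover have "(x \<otimes> y) \<otimes> b \<in> J" if "x \<in> obj K" "x \<otimes> b \<in> J" "y \<in> obj K" for x y
  proof -
    have "(x \<otimes> b) \<otimes> y \<in> J" using thick_ideal_tensor[OF J] that by blast
    then have "x \<otimes> (b \<otimes> y) \<in> J" using thick_ideal_assoc[OF J] that b by blast
    then have "(b \<otimes> y) \<otimes> x \<in> J" using thick_ideal_commute[OF J] that b by simp
    then have "b \<otimes> (y \<otimes> x) \<in> J" using thick_ideal_assoc[OF J] that b by blast
    then have "(y \<otimes> x) \<otimes> b \<in> J" using thick_ideal_commute[OF J] that b by simp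
    then have "y \<otimes> (x \<otimes> b) \<in> J" using thick_ideal_assoc[OF J] that b by blast
    moreover have "(braid K x y \<boxtimes> ident K b) \<in> Iso K ((x \<otimes> y) \<otimes> b) ((y \<otimes> x) \<otimes> b)"
      using Iso_tensor[OF braid_Iso Iso_ident] that b by blast
    ultimately show ?thesis
      using \<open>(y \<otimes> x) \<otimes> b \<in> J\<close> thick_ideal_iso[OF J] Iso_sym by blast
  qed
  ultimately show ?thesis unfolding thick_ideal_def by auto
qed

text \<open>Only one half of the duality between \<open>a\<close> and \<open>D a\<close> is needed, namely that the evaluation
  splits after tensoring with \<open>a\<close>. It follows from the adjunction without any coherence computation.\<close>

lemma strongly_closed_evaluation:
  assumes "strongly_closed K" "a \<in> obj K"
  obtains d v r where "d \<in> obj K" "v \<in> Mor K (d \<otimes> a) (tunit K)"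
    "r \<in> Mor K (tunit K \<otimes> a) ((d \<otimes> a) \<otimes> a)"
    "lunit K a \<cdot> (v \<boxtimes> ident K a) \<cdot> r = lunit K a"
proof -
  obtain H Hm \<Phi> where H: "internal_hom_functor K H Hm" and adj: "tensor_hom_adjunction K H Hm \<Phi>"
    and iso: "\<forall>a \<in> obj K. \<forall>b \<in> obj K.
           dual_tensor_to_hom K H \<Phi> a b \<in> Iso K (H a (tunit K) \<otimes> b) (H a b)"
    using assms(1) unfolding strongly_closed_def by blast
  have bij: "bij_betw (\<Phi> x y z) (Mor K (x \<otimes> y) z) (Mor K x (H y z))"
    if "x \<in> obj K" "y \<in> obj K" "z \<in> obj K" for x y z
    using adj that unfolding tensor_hom_adjunction_def by blast
  have nat: "\<Phi> x' y' z' (w \<cdot> f \<cdot> (u \<boxtimes> v)) = Hm v w \<cdot> \<Phi> x y z f \<cdot> u"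
    if "u \<in> Mor K x' x" "v \<in> Mor K y' y" "w \<in> Mor K z z'" "f \<in> Mor K (x \<otimes> y) z"
    for x x' y y' z z' u v w f
    using adj that unfolding tensor_hom_adjunction_def by blast
  let ?o = "tunit K"
  define d where "d = H a ?o"
  have H_obj: "H x y \<in> obj K" "Hm (ident K x) (ident K y) = ident K (H x y)"
    if "x \<in> obj K" "y \<in> obj K" for x y
    using H that unfolding internal_hom_functor_def by blast+
  have o: "?o \<in> obj K" "d \<in> obj K" "H a a \<in> obj K" "a \<in> obj K"
    using tunit_obj H_obj assms(2) by (auto simp: d_def)
  define v where "v = evaluation K H \<Phi> a"
  have v: "v \<in> Mor K (d \<otimes> a) ?o"
  proof -
    have "ident K d \<in> Mor K d (H a ?o)" using o unfolding d_def by (simp add: Mor_iff)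
    then show ?thesis
      using the_inv_into_into[of "\<Phi> d a ?o" "Mor K (d \<otimes> a) ?o" "ident K d"] bij[of d a ?o] o
      unfolding v_def evaluation_def d_def bij_betw_def by blast
  qed
  obtain k where as: "assoc K d a a \<in> Mor K ((d \<otimes> a) \<otimes> a) (d \<otimes> (a \<otimes> a))"
      "k \<in> Mor K (d \<otimes> (a \<otimes> a)) ((d \<otimes> a) \<otimes> a)"
      "k \<cdot> assoc K d a a = ident K ((d \<otimes> a) \<otimes> a)" "assoc K d a a \<cdot> k = ident K (d \<otimes> (a \<otimes> a))"
    using assoc_Iso[of d a a] o unfolding Iso_iff by blast
  have inv: "inverse_arr K (assoc K d a a) = k"
    unfolding inverse_arr_def
  proof (rule the_equality)
    note A = as(1,2)[unfolded Mor_iff]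
    show "k \<in> Mor K (tgt K (assoc K d a a)) (src K (assoc K d a a)) \<and>
      k \<cdot> assoc K d a a = ident K (src K (assoc K d a a)) \<and>
      assoc K d a a \<cdot> k = ident K (tgt K (assoc K d a a))"
      using as A by simp
    fix g assume g: "g \<in> Mor K (tgt K (assoc K d a a)) (src K (assoc K d a a)) \<and>
      g \<cdot> assoc K d a a = ident K (src K (assoc K d a a)) \<and>
      assoc K d a a \<cdot> g = ident K (tgt K (assoc K d a a))"
    then have g': "g \<in> arr K" "src K g = d \<otimes> (a \<otimes> a)" "tgt K g = (d \<otimes> a) \<otimes> a"
        "assoc K d a a \<cdot> g = ident K (d \<otimes> (a \<otimes> a))"
      using A by (simp_all add: Mor_iff)
    show "g = k" using comp_eq_arr[OF as(3), of g] g' A o by simp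
  qed
  define m where "m = k \<cdot> (ident K d \<boxtimes> braid K a a) \<cdot> assoc K d a a"
  have m: "m \<in> Mor K ((d \<otimes> a) \<otimes> a) ((d \<otimes> a) \<otimes> a)"
    using as(1,2) braid_Mor[of a a] o by (simp add: m_def Mor_iff)
  have l: "lunit K a \<in> Mor K (?o \<otimes> a) a" using lunit_Iso[OF o(4)] by (simp add: Iso_iff)
  define \<phi> where "\<phi> = lunit K a \<cdot> (v \<boxtimes> ident K a) \<cdot> m"
  have \<phi>: "\<phi> \<in> Mor K ((d \<otimes> a) \<otimes> a) a" using l v m o by (simp add: \<phi>_def Mor_iff)
  have "dual_tensor_to_hom K H \<Phi> a a = \<Phi> (d \<otimes> a) a a \<phi>"
    by (simp add: dual_tensor_to_hom_def Let_def d_def[symmetric] v_def[symmetric] inv \<phi>_def m_def)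
  then have "\<Phi> (d \<otimes> a) a a \<phi> \<in> Iso K (d \<otimes> a) (H a a)" using bspec[OF bspec[OF iso o(4)] o(4)] unfolding d_def[symmetric] by simp
  then obtain n where n: "\<Phi> (d \<otimes> a) a a \<phi> \<in> Mor K (d \<otimes> a) (H a a)" "n \<in> Mor K (H a a) (d \<otimes> a)"
      "\<Phi> (d \<otimes> a) a a \<phi> \<cdot> n = ident K (H a a)"
    unfolding Iso_iff by blast
  \<comment> \<open>\<open>u\<close> is the adjoint of the unit isomorphism, and \<open>n\<close>
    inverts the natural arrow from \<open>d \<otimes> a\<close> to \<open>H a a\<close>. So
    \<open>n \<cdot> u\<close> plays the part of the coevaluation, and naturality of
    \<open>\<Phi>\<close> identifies the composite below with \<open>lunit K a\<close>.\<close>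
  define u where "u = \<Phi> ?o a a (lunit K a)"
  have u: "u \<in> Mor K ?o (H a a)"
    using bij[of ?o a a] l o unfolding u_def bij_betw_def by blast
  have nu: "n \<cdot> u \<in> Mor K ?o (d \<otimes> a)" using n(2) u by (simp add: Mor_iff)
  have ia: "ident K a \<in> Mor K a a" using o by (simp add: Mor_iff)
  have "\<Phi> ?o a a (ident K a \<cdot> \<phi> \<cdot> ((n \<cdot> u) \<boxtimes> ident K a))
      = Hm (ident K a) (ident K a) \<cdot> \<Phi> (d \<otimes> a) a a \<phi> \<cdot> (n \<cdot> u)"
    by (rule nat[OF nu ia ia \<phi>])
  also have "\<dots> = u"
    using comp_eq_arr[OF n(3), of u] n(1,2) u o H_obj by (simp add: Mor_iff)
  finally have "\<Phi> ?o a a (ident K a \<cdot> \<phi> \<cdot> ((n \<cdot> u) \<boxtimes> ident K a)) = \<Phi> ?o a a (lunit K a)"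
    unfolding u_def .
  moreover have "inj_on (\<Phi> ?o a a) (Mor K (?o \<otimes> a) a)" using bij[of ?o a a] o by (simp add: bij_betw_def)
  moreover have "ident K a \<cdot> \<phi> \<cdot> ((n \<cdot> u) \<boxtimes> ident K a) \<in> Mor K (?o \<otimes> a) a"
    using \<phi> nu o by (simp add: Mor_iff)
  ultimately have "ident K a \<cdot> \<phi> \<cdot> ((n \<cdot> u) \<boxtimes> ident K a) = lunit K a"
    using l by (blast dest: inj_onD)
  then have "lunit K a \<cdot> (v \<boxtimes> ident K a) \<cdot> m \<cdot> ((n \<cdot> u) \<boxtimes> ident K a) = lunit K a"
    using \<phi>[unfolded Mor_iff] l[unfolded Mor_iff] v[unfolded Mor_iff] m[unfolded Mor_iff]
      nu[unfolded Mor_iff] o by (simp add: \<phi>_def)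
  moreover have "m \<cdot> ((n \<cdot> u) \<boxtimes> ident K a) \<in> Mor K (?o \<otimes> a) ((d \<otimes> a) \<otimes> a)"
    using m[unfolded Mor_iff] nu[unfolded Mor_iff] o by (simp add: Mor_iff)
  ultimately show ?thesis using that o(2) v by blast
qed

end

section \<open>Radical ideals, vanishing of arrows and existence of primes\<close>

context tensor_triangulated_category
begin

text \<open>The evaluation splits after tensoring with \<open>a\<close>, so \<open>a\<close> is a
  retract of \<open>(d \<otimes> a) \<otimes> a\<close>, which belongs to \<open>J\<close> together
  with \<open>a \<otimes> a\<close>.\<close>

lemma thick_ideal_radical:
  assumes "strongly_closed K" "thick_ideal J" "a \<in> obj K" "a \<otimes> a \<in> J"
  shows "a \<in> J"
proof -
  obtain d v r where d: "d \<in> obj K" "v \<in> Mor K (d \<otimes> a) (tunit K)"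
    "r \<in> Mor K (tunit K \<otimes> a) ((d \<otimes> a) \<otimes> a)" "lunit K a \<cdot> (v \<boxtimes> ident K a) \<cdot> r = lunit K a"
    using assms(1,3) by (rule strongly_closed_evaluation)
  have "(a \<otimes> a) \<otimes> d \<in> J" using thick_ideal_tensor assms d by blast
  then have "d \<otimes> (a \<otimes> a) \<in> J" using thick_ideal_commute assms d by simp
  then have da: "(d \<otimes> a) \<otimes> a \<in> J" using thick_ideal_assoc assms d by blast
  obtain l where l: "lunit K a \<in> Mor K (tunit K \<otimes> a) a" "l \<in> Mor K a (tunit K \<otimes> a)"
      "lunit K a \<cdot> l = ident K a"
    using lunit_Iso[OF assms(3)] unfolding Iso_iff by blast
  note D = d(1) d(2,3)[unfolded Mor_iff] l(1,2)[unfolded Mor_iff] assms(3) tunit_obj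
  have "(lunit K a \<cdot> (v \<boxtimes> ident K a)) \<cdot> (r \<cdot> l) = (lunit K a \<cdot> (v \<boxtimes> ident K a) \<cdot> r) \<cdot> l"
    by (simp add: D)
  also have "\<dots> = ident K a" unfolding d(4) by (rule l(3))
  finally show ?thesis
    by (rule thick_ideal_retract[OF assms(2) da, rotated 2]) (simp_all add: Mor_iff D)
qed

text \<open>Inserting the split evaluation into the source of \<open>f\<close> and moving
  \<open>f\<close> past it by bifunctoriality makes \<open>f\<close> factor through
  \<open>(d \<otimes> x) \<otimes> y\<close>, which vanishes with
  \<open>x \<otimes> y\<close>.\<close>

lemma zero_if_tensor_zero:
  assumes "strongly_closed K" "is_zero_object K (x \<otimes> y)" "f \<in> Mor K x y"
  shows "f = mzero K x y"
proof -
  have o: "x \<in> obj K" "y \<in> obj K" using assms(3) Mor_obj by auto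
  obtain d v r where d: "d \<in> obj K" "v \<in> Mor K (d \<otimes> x) (tunit K)"
    "r \<in> Mor K (tunit K \<otimes> x) ((d \<otimes> x) \<otimes> x)" "lunit K x \<cdot> (v \<boxtimes> ident K x) \<cdot> r = lunit K x"
    using assms(1) o(1) by (rule strongly_closed_evaluation)
  obtain l where l: "lunit K x \<in> Mor K (tunit K \<otimes> x) x" "l \<in> Mor K x (tunit K \<otimes> x)"
      "lunit K x \<cdot> l = ident K x"
    using lunit_Iso[OF o(1)] unfolding Iso_iff by blast
  have ly: "lunit K y \<in> Mor K (tunit K \<otimes> y) y" using lunit_Iso[OF o(2)] by (simp add: Iso_iff)
  note D = d(1) d(2,3)[unfolded Mor_iff] l(1,2)[unfolded Mor_iff] ly[unfolded Mor_iff] o tunit_obj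
    assms(3)[unfolded Mor_iff]
  let ?g = "ident K (d \<otimes> x) \<boxtimes> f"
  have zero: "is_zero_object K ((d \<otimes> x) \<otimes> y)"
  proof -
    have 1: "is_zero_object K ((x \<otimes> y) \<otimes> d)" by (rule zero_object_tensor[OF assms(2) d(1)])
    have iso: "is_zero_object K b" if "is_zero_object K a" "h \<in> Iso K a b" for a b h
    proof -
      obtain h' where h: "h \<in> Mor K a b" "h' \<in> Mor K b a" "h \<cdot> h' = ident K b"
        using \<open>h \<in> Iso K a b\<close> unfolding Iso_iff by blast
      have "h = mzero K a b" using zero_object_Mor[OF that(1), of h b] h(1) by (simp add: Mor_iff)
      then have "ident K b = mzero K b b" using h Mor_obj[OF h(1)] by (simp add: Mor_iff)
      then show ?thesis using Mor_obj[OF h(1)] by (simp add: zero_object_iff)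
    qed
    have 2: "is_zero_object K (d \<otimes> (x \<otimes> y))" using iso[OF 1 braid_Iso] d(1) o by simp
    show ?thesis using iso[OF 2] assoc_Iso[OF d(1) o] Iso_sym by blast
  qed
  have g0: "?g = mzero K ((d \<otimes> x) \<otimes> x) ((d \<otimes> x) \<otimes> y)"
    using zero_object_Mor[OF zero, of ?g "(d \<otimes> x) \<otimes> x"] D by (simp add: Mor_iff)
  have "f \<cdot> lunit K x = f \<cdot> lunit K x \<cdot> (v \<boxtimes> ident K x) \<cdot> r" using d(4) by simp
  also have "\<dots> = lunit K y \<cdot> ((ident K (tunit K) \<boxtimes> f) \<cdot> (v \<boxtimes> ident K x)) \<cdot> r"
    using comp_eq_comp[OF lunit_natural[OF assms(3)], of "(v \<boxtimes> ident K x) \<cdot> r"] by (simp add: D)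
  also have "(ident K (tunit K) \<boxtimes> f) \<cdot> (v \<boxtimes> ident K x) = (v \<boxtimes> ident K y) \<cdot> ?g"
    by (simp add: D tensorm_comp_arr)
  also have "lunit K y \<cdot> ((v \<boxtimes> ident K y) \<cdot> ?g) \<cdot> r = mzero K (tunit K \<otimes> x) y"
    unfolding g0 by (simp add: D)
  finally have "(f \<cdot> lunit K x) \<cdot> l = mzero K x y" by (simp add: D)
  then show ?thesis using l(3) by (simp add: D)
qed

text \<open>The smallest thick ideal. Fed to \<open>ex_prime_ideal\<close>, it shows that an object
  lying in every prime is zero.\<close>

lemma thick_ideal_zero_objects: "thick_ideal {z. is_zero_object K z}"
proof -
  have "thick_subcategory K {z. is_zero_object K z}"
  proof (rule thick_subcategoryI)
    show "a \<in> {z. is_zero_object K z}" if "a \<in> obj K" "T a \<in> {z. is_zero_object K z}" for a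
    proof -
      have "Tm (ident K a) = Tm (mzero K a a)" using that by (simp add: zero_object_iff)
      then have "ident K a = mzero K a a" by (rule suspm_inj) (use that(1) in \<open>simp_all add: Mor_iff\<close>)
      then show ?thesis using that(1) by (simp add: zero_object_iff)
    qed
    show "z \<in> {z. is_zero_object K z}"
      if t: "tri K f g h x y z" and xy: "x \<in> {z. is_zero_object K z}" "y \<in> {z. is_zero_object K z}"
      for f g h x y z
    proof -
      note D = triD[OF t]
      have "g = mzero K y z" "h = mzero K z (T x)"
        using zero_object_Mor[of y g z] zero_object_Mor[OF zero_object_susp, of x h z] xy D
        by (simp_all add: Mor_iff)
      then obtain l where "l \<in> Mor K z y" "g \<cdot> l = ident K z"
        using tri_lift2[OF t, of "ident K z" z] D by (auto simp: Mor_iff)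
      then have "ident K z = mzero K z z" using \<open>g = mzero K y z\<close> D by (simp add: Mor_iff)
      then show ?thesis using D by (simp add: zero_object_iff)
    qed
    show "a \<in> {z. is_zero_object K z}"
      if b: "b \<in> {z. is_zero_object K z}" "i \<in> Mor K a b" "p \<in> Mor K b a" "p \<cdot> i = ident K a" for a b i p
    proof -
      have o: "a \<in> obj K" "b \<in> obj K" using Mor_obj[OF b(2)] by auto
      have "i = mzero K a b" using zero_object_Mor[of b i a] b(1,2) by (simp add: Mor_iff)
      then have "ident K a = mzero K a a" using b(3,4) o by (simp add: Mor_iff)
      then show ?thesis using o by (simp add: zero_object_iff)
    qed
  qed (use zero_object_susp in \<open>auto simp: zero_object_iff\<close>)
  then show ?thesis unfolding thick_ideal_def using zero_object_tensor by simp
qed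

text \<open>The bound \<open>obj K\<close> makes the empty intersection all of the category, as
  required for an open set that contains no prime.\<close>

lemma thick_ideal_Inter:
  assumes "\<And>J. J \<in> \<J> \<Longrightarrow> thick_ideal J"
  shows "thick_ideal {a \<in> obj K. \<forall>J \<in> \<J>. a \<in> J}"
proof -
  have V: "verdier K J" if "J \<in> \<J>" for J using thick_ideal_verdier[OF assms[OF that]] .
  have "thick_subcategory K {a \<in> obj K. \<forall>J \<in> \<J>. a \<in> J}"
  proof (rule thick_subcategoryI)
    show "z \<in> {a \<in> obj K. \<forall>J \<in> \<J>. a \<in> J}" if "is_zero_object K z" for z
      using verdier.J_zero[OF V] that by (simp add: zero_object_iff)
    show "z \<in> {a \<in> obj K. \<forall>J \<in> \<J>. a \<in> J}"
      if "tri K f g h x y z" "x \<in> {a \<in> obj K. \<forall>J \<in> \<J>. a \<in> J}" "y \<in> {a \<in> obj K. \<forall>J \<in> \<J>. a \<in> J}"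
      for f g h x y z
      using verdier.J_cone[OF V that(1)] that(2,3) triD(12)[OF that(1)] by blast
    show "a \<in> {a \<in> obj K. \<forall>J \<in> \<J>. a \<in> J}"
      if "b \<in> {a \<in> obj K. \<forall>J \<in> \<J>. a \<in> J}" "i \<in> Mor K a b" "p \<in> Mor K b a" "p \<cdot> i = ident K a"
      for a b i p
      using verdier.J_retract[OF V _ that(2-4)] that(1) Mor_obj[OF that(2)] by blast
  qed (use verdier.J_susp[OF V] in auto)
  then show ?thesis unfolding thick_ideal_def using assms thick_ideal_tensor by auto
qed

lemma thick_ideal_Union_chain:
  assumes "\<J> \<noteq> {}" "\<And>J. J \<in> \<J> \<Longrightarrow> thick_ideal J" "\<And>I J. I \<in> \<J> \<Longrightarrow> J \<in> \<J> \<Longrightarrow> I \<subseteq> J \<or> J \<subseteq> I"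
  shows "thick_ideal (\<Union>\<J>)"
proof -
  have V: "verdier K J" if "J \<in> \<J>" for J using thick_ideal_verdier[OF assms(2)[OF that]] .
  have "thick_subcategory K (\<Union>\<J>)"
  proof (rule thick_subcategoryI)
    show "\<Union>\<J> \<subseteq> obj K" using assms(2) thick_ideal_obj by blast
    show "z \<in> \<Union>\<J>" if "is_zero_object K z" for z
      using verdier.J_zero[OF V that] assms(1) by blast
    show "z \<in> \<Union>\<J>" if t: "tri K f g h x y z" and xy: "x \<in> \<Union>\<J>" "y \<in> \<Union>\<J>" for f g h x y z
    proof -
      obtain I J where "I \<in> \<J>" "J \<in> \<J>" "x \<in> I" "y \<in> J" using xy by blast
      then obtain M where "M \<in> \<J>" "x \<in> M" "y \<in> M" using assms(3) by blast
      then show ?thesis using verdier.J_cone[OF V t] by blast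
    qed
    show "a \<in> \<Union>\<J>" if "b \<in> \<Union>\<J>" "i \<in> Mor K a b" "p \<in> Mor K b a" "p \<cdot> i = ident K a" for a b i p
      using verdier.J_retract[OF V _ that(2-4)] that(1) by blast
    show "T a \<in> \<Union>\<J>" if "a \<in> \<Union>\<J>" for a
      using verdier.J_susp[OF V] verdier.J_obj[OF V] that by blast
    show "a \<in> \<Union>\<J>" if "a \<in> obj K" "T a \<in> \<Union>\<J>" for a
      using verdier.J_susp[OF V] that by blast
  qed
  then show ?thesis unfolding thick_ideal_def using assms(2) thick_ideal_tensor by blast
qed

lemma prime_ideal_thick:
  assumes "idempotent_complete K" "prime_ideal K P"
  shows "thick_ideal P"
proof -
  have P: "triangulated_subcategory K P"
    "\<And>a b c. is_direct_sum K a b c \<Longrightarrow> c \<in> P \<Longrightarrow> a \<in> P"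
    "\<And>a b. a \<in> P \<Longrightarrow> b \<in> obj K \<Longrightarrow> a \<otimes> b \<in> P"
    using assms(2) unfolding prime_ideal_def by blast+
  have "a \<in> P" if "b \<in> P" "i \<in> Mor K a b" "p \<in> Mor K b a" "p \<cdot> i = ident K a" for a b i p
    using split_mono_direct_sum[OF assms(1) that(2-4)] P(2) that(1) by blast
  then show ?thesis unfolding thick_ideal_def thick_subcategory_def using P(1,3) by blast
qed

text \<open>A thick ideal \<open>P\<close> maximal among those containing \<open>I\<close> and
  avoiding \<open>c\<close> is prime. If \<open>a \<otimes> b\<close> is in \<open>P\<close> and
  \<open>a\<close> is not, the ideal quotient of \<open>P\<close> by \<open>b\<close> exceeds
  \<open>P\<close> and so contains \<open>c\<close>. Doing this for both factors puts
  \<open>c \<otimes> c\<close> into \<open>P\<close>, and radicality gives the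
  contradiction.\<close>

lemma ex_prime_ideal:
  assumes sc: "strongly_closed K" and I: "thick_ideal I" "c \<in> obj K" "c \<notin> I"
  obtains P where "prime_ideal K P" "I \<subseteq> P" "c \<notin> P"
proof -
  let ?A = "{J. thick_ideal J \<and> I \<subseteq> J \<and> c \<notin> J}"
  have "\<exists>P \<in> ?A. \<forall>J \<in> ?A. P \<subseteq> J \<longrightarrow> J = P"
  proof (rule subset_Zorn_nonempty)
    show "?A \<noteq> {}" using I by blast
    show "\<Union>\<C> \<in> ?A" if "\<C> \<noteq> {}" "subset.chain ?A \<C>" for \<C>
    proof -
      have "thick_ideal (\<Union>\<C>)"
        by (rule thick_ideal_Union_chain) (use that in \<open>auto simp: subset.chain_def\<close>)
      then show ?thesis using that by (auto simp: subset.chain_def)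
    qed
  qed
  then obtain P where P: "thick_ideal P" "I \<subseteq> P" "c \<notin> P"
      and max: "\<And>J. thick_ideal J \<Longrightarrow> P \<subseteq> J \<Longrightarrow> c \<notin> J \<Longrightarrow> J = P"
    by (smt (verit) mem_Collect_eq order_trans)
  have colon: "c \<otimes> b \<in> P" if ab: "a \<otimes> b \<in> P" "a \<notin> P" "a \<in> obj K" "b \<in> obj K" for a b
  proof (rule ccontr)
    assume "c \<otimes> b \<notin> P"
    let ?J = "{x \<in> obj K. x \<otimes> b \<in> P}"
    have "P \<subseteq> ?J" using thick_ideal_tensor[OF P(1)] thick_ideal_obj[OF P(1)] ab by blast
    then have "?J = P" using max[OF thick_ideal_colon[OF P(1) ab(4)]] \<open>c \<otimes> b \<notin> P\<close> by blast
    then show False using ab by blast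
  qed
  have prime: "a \<in> P \<or> b \<in> P" if ab: "a \<otimes> b \<in> P" "a \<in> obj K" "b \<in> obj K" for a b
  proof (rule ccontr)
    assume n: "\<not> (a \<in> P \<or> b \<in> P)"
    then have "c \<otimes> b \<in> P" using colon ab by blast
    then have "b \<otimes> c \<in> P" using thick_ideal_commute[OF P(1)] ab I by blast
    then have "c \<otimes> c \<in> P" using colon n ab I by blast
    then show False using thick_ideal_radical[OF sc P(1) I(2)] P(3) by blast
  qed
  have "a \<in> P \<and> b \<in> P" if ds: "is_direct_sum K a b x" "x \<in> P" for a b x
  proof -
    obtain i j p q where "i \<in> Mor K a x" "j \<in> Mor K b x" "p \<in> Mor K x a"
        "q \<in> Mor K x b" "p \<cdot> i = ident K a" "q \<cdot> j = ident K b"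
      using ds(1) unfolding is_direct_sum_def by (elim conjE bexE) (rule that)
    then show ?thesis using thick_ideal_retract[OF P(1) ds(2)] by blast
  qed
  moreover have "triangulated_subcategory K P" "\<forall>a \<in> P. \<forall>b \<in> obj K. a \<otimes> b \<in> P"
    using P(1) by (simp_all add: thick_ideal_def thick_subcategory_def)
  moreover have "P \<noteq> obj K" using P(3) I(2) by blast
  ultimately have "prime_ideal K P" unfolding prime_ideal_def using prime by blast
  then show ?thesis using that P by blast
qed

end

section \<open>Decomposition of objects with disconnected support\<close>

text \<open>The equations \<open>eq\<close> say that \<open>f\<close> is compatible with the
  endomorphisms \<open>i p\<close> and \<open>i' p'\<close>. Fill-ins are not functorial, so
  \<open>v \<cdot> u\<close> need not be idempotent on \<open>z\<close>; it is controlled only after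
  \<open>g\<close> and before \<open>h\<close>.\<close>

lemma (in verdier) cone_of_summand:
  assumes t: "tri C f g h x y z" and a: "a \<in> J" "a' \<in> J"
    and ip: "i \<in> Mor C a x" "p \<in> Mor C x a" "i' \<in> Mor C a' y" "p' \<in> Mor C y a'"
    and eq: "(p' \<cdot> f \<cdot> i) \<cdot> p = p' \<cdot> f" "i' \<cdot> (p' \<cdot> f \<cdot> i) = f \<cdot> i"
  obtains c u v where "c \<in> J" "u \<in> Mor C z c" "v \<in> Mor C c z" "v \<cdot> u \<cdot> g = g \<cdot> i' \<cdot> p'"
    "h \<cdot> v \<cdot> u = Tm (i \<cdot> p) \<cdot> h"
proof -
  note D = triD[OF t] ip[unfolded Mor_iff]
  have "p' \<cdot> f \<cdot> i \<in> Mor C a a'" by (simp add: Mor_iff D)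
  then obtain c g1 h1 where t1: "tri C (p' \<cdot> f \<cdot> i) g1 h1 a a' c" by (rule ex_cone)
  obtain u where u: "u \<in> Mor C z c" "u \<cdot> g = g1 \<cdot> p'" "Tm p \<cdot> h = h1 \<cdot> u"
    by (rule tri_map[OF t t1 ip(2,4) eq(1)[symmetric]])
  obtain v where v: "v \<in> Mor C c z" "v \<cdot> g1 = g \<cdot> i'" "Tm i \<cdot> h1 = h \<cdot> v"
    by (rule tri_map[OF t1 t ip(1,3) eq(2)])
  note D = D triD[OF t1] u(1)[unfolded Mor_iff] v(1)[unfolded Mor_iff]
  have "v \<cdot> u \<cdot> g = g \<cdot> i' \<cdot> p'" unfolding u(2) by (simp add: D comp_eq_comp[OF v(2)])
  moreover have "h \<cdot> v \<cdot> u = Tm (i \<cdot> p) \<cdot> h"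
    by (simp add: D u(3) comp_eq_comp[OF v(3)[symmetric]])
  moreover have "c \<in> J" using J_cone[OF t1 a] .
  ultimately show ?thesis using that u(1) v(1) by blast
qed

text \<open>An object of \<open>J\<close> between two copies of \<open>T a\<close> need not be a
  suspension. It is replaced by an isomorphic one, after which fullness desuspends both
  factors.\<close>

lemma (in verdier) desuspend_factorization:
  assumes x: "x \<in> J" "i \<in> Mor C x (T a)" "p \<in> Mor C (T a) x" and a: "a \<in> obj C"
  obtains x' i' p' where "x' \<in> J" "i' \<in> Mor C x' a" "p' \<in> Mor C a x'" "Tm (i' \<cdot> p') = i \<cdot> p"
proof -
  obtain x' where x': "x' \<in> obj C" "Iso C (T x') x \<noteq> {}" using susp_ess_surj J_obj[OF x(1)] by blast
  then obtain k l where k: "k \<in> Mor C (T x') x" "l \<in> Mor C x (T x')" "k \<cdot> l = ident C x"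
    unfolding Iso_iff by (auto simp: Iso_iff)
  have "T x' \<in> J" using x'(2) Iso_sym J_iso[OF x(1)] by blast
  then have "x' \<in> J" using J_susp x'(1) by blast
  note D = x(2,3)[unfolded Mor_iff] k(1,2)[unfolded Mor_iff]
  have "i \<cdot> k \<in> Mor C (T x') (T a)" "l \<cdot> p \<in> Mor C (T a) (T x')" by (simp_all add: Mor_iff D)
  then obtain i' p' where i': "i' \<in> Mor C x' a" "Tm i' = i \<cdot> k" and p': "p' \<in> Mor C a x'" "Tm p' = l \<cdot> p"
    using suspm_full x'(1) a by metis
  have "Tm (i' \<cdot> p') = i \<cdot> p"
    using i'(1) p'(1) by (simp add: Mor_iff i'(2) p'(2) D comp_eq_arr[OF k(3)])
  then show ?thesis using that \<open>x' \<in> J\<close> i'(1) p'(1) by blast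
qed

context tensor_triangulated_category
begin

text \<open>The delicate point is closure under cones. An arrow between two such sums is diagonal by
  orthogonality, but the arrows to and from the cones of its components split the cone only up to an
  error of square zero.\<close>

lemma thick_ideal_orthogonal_sum:
  assumes J1: "thick_ideal J1" and J2: "thick_ideal J2"
    and orth: "\<And>x y f. x \<in> J1 \<Longrightarrow> y \<in> J2 \<Longrightarrow> f \<in> Mor K x y \<Longrightarrow> f = mzero K x y"
    and orth': "\<And>x y f. x \<in> J1 \<Longrightarrow> y \<in> J2 \<Longrightarrow> f \<in> Mor K y x \<Longrightarrow> f = mzero K y x"
  shows "thick_ideal {z \<in> obj K. \<exists>x \<in> J1. \<exists>y \<in> J2. \<exists>i \<in> Mor K x z. \<exists>p \<in> Mor K z x.
    \<exists>j \<in> Mor K y z. \<exists>q \<in> Mor K z y. i \<cdot> p \<oplus> j \<cdot> q = ident K z}"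
    (is "thick_ideal ?I")
proof -
  interpret V1: verdier K J1 by (rule thick_ideal_verdier[OF J1])
  interpret V2: verdier K J2 by (rule thick_ideal_verdier[OF J2])
  have I_I: "z \<in> ?I" if "x \<in> J1" "y \<in> J2" "i \<in> Mor K x z" "p \<in> Mor K z x" "j \<in> Mor K y z" "q \<in> Mor K z y"
    "i \<cdot> p \<oplus> j \<cdot> q = ident K z" for x y z i p j q
    using that Mor_obj[OF that(3)] by blast
  have I_E: thesis if "z \<in> ?I" "\<And>x y i p j q. x \<in> J1 \<Longrightarrow> y \<in> J2 \<Longrightarrow> i \<in> Mor K x z \<Longrightarrow> p \<in> Mor K z x \<Longrightarrow>
      j \<in> Mor K y z \<Longrightarrow> q \<in> Mor K z y \<Longrightarrow> i \<cdot> p \<oplus> j \<cdot> q = ident K z \<Longrightarrow> thesis" for z thesis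
    using that by blast
  have "thick_subcategory K ?I"
  proof (rule thick_subcategoryI)
    show "?I \<subseteq> obj K" by blast
    show "z \<in> ?I" if z: "is_zero_object K z" for z
    proof -
      have "z \<in> obj K" "ident K z = mzero K z z" using z by (simp_all add: zero_object_iff)
      then show ?thesis using V1.J_zero[OF z] V2.J_zero[OF z]
        by (intro I_I[of z z "mzero K z z" z "mzero K z z" "mzero K z z" "mzero K z z"])
          (simp_all add: Mor_iff)
    qed
    show "T a \<in> ?I" if "a \<in> ?I" for a
    proof (rule I_E[OF that])
      fix x y i p j q
      assume z: "x \<in> J1" "y \<in> J2" "i \<in> Mor K x a" "p \<in> Mor K a x" "j \<in> Mor K y a" "q \<in> Mor K a y"
        "i \<cdot> p \<oplus> j \<cdot> q = ident K a"
      note D = z(3-6)[unfolded Mor_iff] V1.J_obj[OF z(1)] V2.J_obj[OF z(2)] Mor_obj[OF z(3)]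
      have "Tm i \<cdot> Tm p \<oplus> Tm j \<cdot> Tm q = ident K (T a)"
        using arg_cong[OF z(7), of Tm] by (simp add: D)
      then show ?thesis
        by (rule I_I[rotated 6]) (use V1.J_susp V2.J_susp z(1,2) D in \<open>simp_all add: Mor_iff\<close>)
    qed
    show "a \<in> ?I" if a: "a \<in> obj K" "T a \<in> ?I" for a
    proof (rule I_E[OF a(2)])
      fix x y i p j q
      assume z: "x \<in> J1" "y \<in> J2" "i \<in> Mor K x (T a)" "p \<in> Mor K (T a) x" "j \<in> Mor K y (T a)"
        "q \<in> Mor K (T a) y" "i \<cdot> p \<oplus> j \<cdot> q = ident K (T a)"
      obtain x' i' p' where x: "x' \<in> J1" "i' \<in> Mor K x' a" "p' \<in> Mor K a x'" "Tm (i' \<cdot> p') = i \<cdot> p"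
        by (rule V1.desuspend_factorization[OF z(1,3,4) a(1)])
      obtain y' j' q' where y: "y' \<in> J2" "j' \<in> Mor K y' a" "q' \<in> Mor K a y'" "Tm (j' \<cdot> q') = j \<cdot> q"
        by (rule V2.desuspend_factorization[OF z(2,5,6) a(1)])
      note D = x(2,3)[unfolded Mor_iff] y(2,3)[unfolded Mor_iff] a(1)
      have "Tm (i' \<cdot> p' \<oplus> j' \<cdot> q') = Tm (i' \<cdot> p') \<oplus> Tm (j' \<cdot> q')" by (simp add: D)
      also have "\<dots> = Tm (ident K a)" unfolding x(4) y(4) z(7) by (simp add: a(1))
      finally have "i' \<cdot> p' \<oplus> j' \<cdot> q' = ident K a" by (rule suspm_inj) (simp_all add: Mor_iff D)
      then show ?thesis using x y by (intro I_I)
    qed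
    show "a \<in> ?I" if r: "b \<in> ?I" "k \<in> Mor K a b" "l \<in> Mor K b a" "l \<cdot> k = ident K a" for a b k l
    proof (rule I_E[OF r(1)])
      fix x y i p j q
      assume z: "x \<in> J1" "y \<in> J2" "i \<in> Mor K x b" "p \<in> Mor K b x" "j \<in> Mor K y b" "q \<in> Mor K b y"
        "i \<cdot> p \<oplus> j \<cdot> q = ident K b"
      note D = z(3-6)[unfolded Mor_iff] r(2,3)[unfolded Mor_iff] Mor_obj[OF z(3)]
      have "(l \<cdot> i) \<cdot> (p \<cdot> k) \<oplus> (l \<cdot> j) \<cdot> (q \<cdot> k) = l \<cdot> (i \<cdot> p \<oplus> j \<cdot> q) \<cdot> k" by (simp add: D)
      also have "\<dots> = ident K a" unfolding z(7) using r(4) by (simp add: D)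
      finally show ?thesis by (rule I_I[OF z(1,2), rotated 4]) (simp_all add: D Mor_iff)
    qed
    show "z \<in> ?I" if t: "tri K f g h x y z" and xy: "x \<in> ?I" "y \<in> ?I" for f g h x y z
    proof (rule I_E[OF xy(1)], rule I_E[OF xy(2)])
      fix a b i p j q a' b' i' p' j' q'
      assume x: "a \<in> J1" "b \<in> J2" "i \<in> Mor K a x" "p \<in> Mor K x a" "j \<in> Mor K b x" "q \<in> Mor K x b"
          "i \<cdot> p \<oplus> j \<cdot> q = ident K x"
        and y: "a' \<in> J1" "b' \<in> J2" "i' \<in> Mor K a' y" "p' \<in> Mor K y a'" "j' \<in> Mor K b' y" "q' \<in> Mor K y b'"
          "i' \<cdot> p' \<oplus> j' \<cdot> q' = ident K y"
      note D = triD[OF t] x(3-6)[unfolded Mor_iff] y(3-6)[unfolded Mor_iff]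
        V1.J_obj[OF x(1)] V2.J_obj[OF x(2)] V1.J_obj[OF y(1)] V2.J_obj[OF y(2)]
      \<comment> \<open>With respect to the decompositions of \<open>x\<close> and \<open>y\<close>,
        the off-diagonal entries of \<open>f\<close> run between the two ideals and vanish. Then
        \<open>e1\<close> to \<open>e4\<close> say that \<open>f\<close> respects each
        component.\<close>
      have off: "p' \<cdot> f \<cdot> j = mzero K b a'" "q' \<cdot> f \<cdot> i = mzero K a b'"
        by (rule orth'[OF y(1) x(2)] orth[OF x(1) y(2)]; simp add: Mor_iff D)+
      have fx: "f = f \<cdot> i \<cdot> p \<oplus> f \<cdot> j \<cdot> q"
        using arg_cong[OF x(7), of "\<lambda>u. f \<cdot> u"] by (simp add: D)
      have fy: "f = i' \<cdot> p' \<cdot> f \<oplus> j' \<cdot> q' \<cdot> f"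
        using arg_cong[OF y(7), of "\<lambda>u. u \<cdot> f"] by (simp add: D)
      have e1: "(p' \<cdot> f \<cdot> i) \<cdot> p = p' \<cdot> f"
      proof -
        have "p' \<cdot> f = p' \<cdot> (f \<cdot> i \<cdot> p \<oplus> f \<cdot> j \<cdot> q)" using fx by simp
        also have "\<dots> = (p' \<cdot> f \<cdot> i) \<cdot> p \<oplus> (p' \<cdot> f \<cdot> j) \<cdot> q" by (simp add: D)
        finally show ?thesis unfolding off by (simp add: D)
      qed
      have e2: "(q' \<cdot> f \<cdot> j) \<cdot> q = q' \<cdot> f"
      proof -
        have "q' \<cdot> f = q' \<cdot> (f \<cdot> i \<cdot> p \<oplus> f \<cdot> j \<cdot> q)" using fx by simp
        also have "\<dots> = (q' \<cdot> f \<cdot> i) \<cdot> p \<oplus> (q' \<cdot> f \<cdot> j) \<cdot> q" by (simp add: D)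
        finally show ?thesis unfolding off by (simp add: D)
      qed
      have e3: "i' \<cdot> (p' \<cdot> f \<cdot> i) = f \<cdot> i"
      proof -
        have "f \<cdot> i = (i' \<cdot> p' \<cdot> f \<oplus> j' \<cdot> q' \<cdot> f) \<cdot> i" using fy by simp
        also have "\<dots> = i' \<cdot> (p' \<cdot> f \<cdot> i) \<oplus> j' \<cdot> (q' \<cdot> f \<cdot> i)" by (simp add: D)
        finally show ?thesis unfolding off by (simp add: D)
      qed
      have e4: "j' \<cdot> (q' \<cdot> f \<cdot> j) = f \<cdot> j"
      proof -
        have "f \<cdot> j = (i' \<cdot> p' \<cdot> f \<oplus> j' \<cdot> q' \<cdot> f) \<cdot> j" using fy by simp
        also have "\<dots> = i' \<cdot> (p' \<cdot> f \<cdot> j) \<oplus> j' \<cdot> (q' \<cdot> f \<cdot> j)" by (simp add: D)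
        finally show ?thesis unfolding off by (simp add: D)
      qed
      obtain c u v where c: "c \<in> J1" "u \<in> Mor K z c" "v \<in> Mor K c z" "v \<cdot> u \<cdot> g = g \<cdot> i' \<cdot> p'"
          "h \<cdot> v \<cdot> u = Tm (i \<cdot> p) \<cdot> h"
        by (rule V1.cone_of_summand[OF t x(1) y(1) x(3,4) y(3,4) e1 e3])
      obtain c' u' v' where c': "c' \<in> J2" "u' \<in> Mor K z c'" "v' \<in> Mor K c' z" "v' \<cdot> u' \<cdot> g = g \<cdot> j' \<cdot> q'"
          "h \<cdot> v' \<cdot> u' = Tm (j \<cdot> q) \<cdot> h"
        by (rule V2.cone_of_summand[OF t x(2) y(2) x(5,6) y(5,6) e2 e4])
      note E = D c(2,3)[unfolded Mor_iff] c'(2,3)[unfolded Mor_iff]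
      \<comment> \<open>\<open>n\<close> measures how far the chosen fill-ins are from decomposing
        \<open>z\<close>. It vanishes on \<open>g\<close>, so it is of the form
        \<open>m \<cdot> h\<close>; as \<open>h \<cdot> n\<close> vanishes too, its square is
        zero.\<close>
      define n where "n = v \<cdot> u \<oplus> (v' \<cdot> u' \<oplus> \<ominus> (ident K z))"
      have n: "n \<in> Mor K z z" by (simp add: n_def Mor_iff E)
      have "n \<cdot> g = g \<cdot> i' \<cdot> p' \<oplus> (g \<cdot> j' \<cdot> q' \<oplus> \<ominus> g)" by (simp add: n_def E c(4) c'(4))
      also have "\<dots> = g \<cdot> (i' \<cdot> p' \<oplus> j' \<cdot> q') \<oplus> \<ominus> g" by (simp add: E)
      also have "\<dots> = mzero K y z" unfolding y(7) by (simp add: E)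
      finally obtain m where m: "m \<in> Mor K (T x) z" "m \<cdot> h = n" using tri_extend2[OF t n] by blast
      have "h \<cdot> n = Tm (i \<cdot> p) \<cdot> h \<oplus> (Tm (j \<cdot> q) \<cdot> h \<oplus> \<ominus> h)"
        by (simp add: n_def E c(5)[symmetric] c'(5)[symmetric] del: suspm_comp)
      also have "\<dots> = Tm (i \<cdot> p \<oplus> j \<cdot> q) \<cdot> h \<oplus> \<ominus> h" by (simp add: E)
      also have "\<dots> = mzero K z (T x)" unfolding x(7) by (simp add: E)
      finally have "m \<cdot> h \<cdot> n = mzero K z z" using m(1) by (simp add: Mor_iff E)
      then have "n \<cdot> n = mzero K z z"
        using comp_eq_arr[OF m(2), of n] m(1) n by (simp add: Mor_iff E)
      \<comment> \<open>The inverse of \<open>1 + n\<close> is absorbed into \<open>u\<close> and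
        \<open>u'\<close>, which makes the decomposition of \<open>z\<close> exact.\<close>
      from invertible_one_plus_square_zero(1)[OF n this]
      have "(v \<cdot> u \<oplus> v' \<cdot> u') \<cdot> (ident K z \<oplus> \<ominus> n) = ident K z"
        by (simp add: n_def E madd_left_commute[of "ident K z"])
      then have "v \<cdot> (u \<cdot> (ident K z \<oplus> \<ominus> n)) \<oplus> v' \<cdot> (u' \<cdot> (ident K z \<oplus> \<ominus> n)) = ident K z"
        using n by (simp add: E Mor_iff madd_left_commute[of "v' \<cdot> u'"])
      then show "z \<in> ?I"
        by (rule I_I[OF c(1) c'(1), rotated 4]) (use n in \<open>simp_all add: E Mor_iff\<close>)
    qed
  qed
  moreover have "a \<otimes> b \<in> ?I" if "a \<in> ?I" "b \<in> obj K" for a b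
  proof (rule I_E[OF that(1)])
    fix x y i p j q
    assume z: "x \<in> J1" "y \<in> J2" "i \<in> Mor K x a" "p \<in> Mor K a x" "j \<in> Mor K y a" "q \<in> Mor K a y"
      "i \<cdot> p \<oplus> j \<cdot> q = ident K a"
    note D = z(3-6)[unfolded Mor_iff] Mor_obj[OF z(3)] that(2)
    let ?b = "ident K b"
    have "(i \<boxtimes> ?b) \<cdot> (p \<boxtimes> ?b) \<oplus> (j \<boxtimes> ?b) \<cdot> (q \<boxtimes> ?b) = (i \<cdot> p) \<boxtimes> ?b \<oplus> (j \<cdot> q) \<boxtimes> ?b"
      by (simp add: D tensorm_comp_arr)
    also have "\<dots> = (i \<cdot> p \<oplus> j \<cdot> q) \<boxtimes> ?b"
      by (rule tensorm_madd_left[symmetric, of _ a a]) (simp_all add: D Mor_iff)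
    also have "\<dots> = ident K (a \<otimes> b)" unfolding z(7) by (simp add: D tensorm_ident)
    finally show ?thesis
      by (rule I_I[OF thick_ideal_tensor[OF J1 z(1) that(2)] thick_ideal_tensor[OF J2 z(2) that(2)], rotated 4])
        (simp_all add: D Mor_iff)
  qed
  ultimately show ?thesis unfolding thick_ideal_def by blast
qed

end

section \<open>Supports, quasi-compact open sets and the ideals attached to them\<close>

context tensor_triangulated_category
begin

lemma mem_ideal_off: "a \<in> ideal_off K U \<longleftrightarrow> a \<in> obj K \<and> (\<forall>P \<in> Spc K \<inter> U. a \<in> P)"
  unfolding ideal_off_def supported_on_def supp_def by blast

lemma thick_ideal_ideal_off:
  assumes "idempotent_complete K"
  shows "thick_ideal (ideal_off K U)"
proof -
  have "ideal_off K U = {a \<in> obj K. \<forall>P \<in> Spc K \<inter> U. a \<in> P}" using mem_ideal_off by blast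
  moreover have "thick_ideal {a \<in> obj K. \<forall>P \<in> Spc K \<inter> U. a \<in> P}"
    by (rule thick_ideal_Inter) (use prime_ideal_thick[OF assms] in \<open>auto simp: Spc_def\<close>)
  ultimately show ?thesis by simp
qed

lemma tensor_zero_of_disjoint_support:
  assumes "idempotent_complete K" "strongly_closed K" "Spc K = U \<union> V"
    and x: "x \<in> ideal_off K U" and y: "y \<in> ideal_off K V"
  shows "is_zero_object K (x \<otimes> y)"
proof (rule ccontr)
  assume n: "\<not> is_zero_object K (x \<otimes> y)"
  have o: "x \<in> obj K" "y \<in> obj K" using x y mem_ideal_off by auto
  obtain P where P: "prime_ideal K P" "x \<otimes> y \<notin> P"
    using ex_prime_ideal[OF assms(2) thick_ideal_zero_objects, of "x \<otimes> y"] o n by auto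
  have t: "thick_ideal P" by (rule prime_ideal_thick[OF assms(1) P(1)])
  have S: "P \<in> Spc K" using P by (simp add: Spc_def)
  then have "x \<in> P \<or> y \<in> P" using x y assms(3) by (auto simp: mem_ideal_off)
  then have "x \<otimes> y \<in> P" using thick_ideal_tensor[OF t] thick_ideal_commute[OF t] o by blast
  then show False using P(2) by blast
qed

lemma supp_direct_sum:
  assumes "idempotent_complete K" "is_direct_sum K a b c"
  shows "supp K c = supp K a \<union> supp K b"
proof -
  have "c \<in> P \<longleftrightarrow> a \<in> P \<and> b \<in> P" if P: "prime_ideal K P" for P
  proof -
    interpret verdier K P by (rule thick_ideal_verdier[OF prime_ideal_thick[OF assms(1) P]])
    show ?thesis using J_direct_sum[OF assms(2)] P assms(2) unfolding prime_ideal_def by blast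
  qed
  then show ?thesis unfolding supp_def Spc_def by blast
qed

lemma supp_tensor:
  assumes "idempotent_complete K" "a \<in> obj K" "b \<in> obj K"
  shows "supp K (a \<otimes> b) = supp K a \<inter> supp K b"
proof -
  have "a \<otimes> b \<in> P \<longleftrightarrow> a \<in> P \<or> b \<in> P" if P: "prime_ideal K P" for P
  proof -
    have t: "thick_ideal P" by (rule prime_ideal_thick[OF assms(1) P])
    show ?thesis
      using thick_ideal_tensor[OF t] thick_ideal_commute[OF t] P assms(2,3)
      unfolding prime_ideal_def by blast
  qed
  then show ?thesis unfolding supp_def Spc_def by blast
qed

lemma supp_tunit:
  assumes "idempotent_complete K"
  shows "supp K (tunit K) = Spc K"
proof -
  have False if P: "prime_ideal K P" "tunit K \<in> P" for P
  proof -
    have t: "thick_ideal P" by (rule prime_ideal_thick[OF assms P(1)])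
    have "a \<in> P" if "a \<in> obj K" for a
      using thick_ideal_iso[OF t thick_ideal_tensor[OF t P(2) that] lunit_Iso[OF that]] .
    then show False using P(1) thick_ideal_obj[OF t] unfolding prime_ideal_def by blast
  qed
  then show ?thesis unfolding supp_def Spc_def by blast
qed

lemma basic_open_neighbourhood:
  assumes "idempotent_complete K" "openin (Spc_topology K) U" "P \<in> U"
  obtains a where "a \<in> obj K" "P \<in> Spc K - supp K a" "Spc K - supp K a \<subseteq> U"
proof -
  have "generate_topology_on {Spc K - supp K a |a. a \<in> obj K} U"
    using assms(2) by (simp add: Spc_topology_def openin_topology_generated_by_iff)
  then have "\<forall>P \<in> U. \<exists>a \<in> obj K. P \<in> Spc K - supp K a \<and> Spc K - supp K a \<subseteq> U"
  proof (induction rule: generate_topology_on.induct)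
    case (Int U V)
    show ?case
    proof
      fix P assume "P \<in> U \<inter> V"
      then obtain a b where a: "a \<in> obj K" "P \<in> Spc K - supp K a" "Spc K - supp K a \<subseteq> U"
        and b: "b \<in> obj K" "P \<in> Spc K - supp K b" "Spc K - supp K b \<subseteq> V"
        using Int.IH by blast
      obtain c where c: "is_direct_sum K a b c" using ex_direct_sum a(1) b(1) by blast
      then have "c \<in> obj K" by (simp add: is_direct_sum_def)
      moreover have "supp K c = supp K a \<union> supp K b" by (rule supp_direct_sum[OF assms(1) c])
      ultimately show "\<exists>a \<in> obj K. P \<in> Spc K - supp K a \<and> Spc K - supp K a \<subseteq> U \<inter> V"
        using a b by (intro bexI[of _ c]) auto
    qed
  next
    case (UN \<U>)
    then show ?case by (meson Union_iff Union_upper order_trans)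
  qed auto
  then show ?thesis using that assms(3) by blast
qed

text \<open>Quasi-compactness leaves finitely many basic open sets covering \<open>U\<close>. Their
  union is basic again, since supports intersect under tensor products; the empty union is covered
  by the unit, whose support is everything.\<close>

lemma complement_is_support:
  assumes ic: "idempotent_complete K" and U: "quasi_compact_open K U"
  obtains x where "x \<in> obj K" "supp K x = Spc K - U" "U \<subseteq> Spc K"
proof -
  have op: "openin (Spc_topology K) U" and cp: "compactin (Spc_topology K) U"
    using U by (simp_all add: quasi_compact_open_def)
  let ?B = "{Spc K - supp K a |a. a \<in> obj K \<and> Spc K - supp K a \<subseteq> U}"
  have "U \<subseteq> \<Union>?B"
  proof
    fix P assume "P \<in> U"
    then obtain a where "a \<in> obj K" "P \<in> Spc K - supp K a" "Spc K - supp K a \<subseteq> U"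
      by (rule basic_open_neighbourhood[OF ic op])
    then show "P \<in> \<Union>?B" by (intro UnionI[of "Spc K - supp K a"]) auto
  qed
  moreover have "openin (Spc_topology K) V" if "V \<in> ?B" for V
    using that unfolding Spc_topology_def by (auto intro: topology_generated_by_Basis)
  ultimately obtain \<F> where F: "finite \<F>" "\<F> \<subseteq> ?B" "U \<subseteq> \<Union>\<F>"
    using cp unfolding compactin_def by meson
  have fin: "\<exists>x \<in> obj K. Spc K - supp K x = \<Union>\<F>"
    if "finite \<F>" "\<F> \<subseteq> {Spc K - supp K a |a. a \<in> obj K}" for \<F>
    using that
  proof (induction rule: finite_induct)
    case empty
    show ?case using tunit_obj supp_tunit[OF ic] by (intro bexI[of _ "tunit K"]) auto
  next
    case (insert V \<F>)
    then obtain x where x: "x \<in> obj K" "Spc K - supp K x = \<Union>\<F>" by auto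
    obtain a where a: "a \<in> obj K" "V = Spc K - supp K a" using insert by auto
    have "Spc K - supp K (a \<otimes> x) = \<Union>(insert V \<F>)" using supp_tensor[OF ic a(1) x(1)] a(2) x(2) by auto
    then show ?case using a(1) x(1) by (intro bexI[of _ "a \<otimes> x"]) auto
  qed
  obtain x where x: "x \<in> obj K" "Spc K - supp K x = \<Union>\<F>" using fin[OF F(1)] F(2) by blast
  have "\<Union>\<F> = U" using F by blast
  then have "supp K x = Spc K - U" "U \<subseteq> Spc K" using x(2) by (auto simp: supp_def)
  then show ?thesis using that x(1) by blast
qed

lemma gluing_data_ideal_off:
  assumes ic: "idempotent_complete K" and sc: "strongly_closed K"
    and U: "quasi_compact_open K U\<^sub>1" "quasi_compact_open K U\<^sub>2" "Spc K = U\<^sub>1 \<union> U\<^sub>2"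
  shows "gluing_data K (ideal_off K U\<^sub>1) (ideal_off K U\<^sub>2) (ideal_off K (U\<^sub>1 \<inter> U\<^sub>2))"
proof -
  let ?J1 = "ideal_off K U\<^sub>1" and ?J2 = "ideal_off K U\<^sub>2" and ?J12 = "ideal_off K (U\<^sub>1 \<inter> U\<^sub>2)"
  note T = thick_ideal_ideal_off[OF ic]
  interpret V1: verdier K ?J1 by (rule thick_ideal_verdier[OF T])
  interpret V2: verdier K ?J2 by (rule thick_ideal_verdier[OF T])
  interpret V12: verdier K ?J12 by (rule thick_ideal_verdier[OF T])
  have orth: "f = mzero K x y" if "x \<in> ?J1" "y \<in> ?J2" "f \<in> Mor K x y" for x y f
    by (rule zero_if_tensor_zero[OF sc tensor_zero_of_disjoint_support[OF ic sc U(3) that(1,2)] that(3)])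
  have U': "Spc K = U\<^sub>2 \<union> U\<^sub>1" using U(3) by blast
  have orth': "f = mzero K y x" if "x \<in> ?J1" "y \<in> ?J2" "f \<in> Mor K y x" for x y f
    by (rule zero_if_tensor_zero[OF sc tensor_zero_of_disjoint_support[OF ic sc U' that(2,1)] that(3)])
  let ?I = "{z \<in> obj K. \<exists>x \<in> ?J1. \<exists>y \<in> ?J2. \<exists>i \<in> Mor K x z. \<exists>p \<in> Mor K z x.
    \<exists>j \<in> Mor K y z. \<exists>q \<in> Mor K z y. i \<cdot> p \<oplus> j \<cdot> q = ident K z}"
  have I: "thick_ideal ?I" by (rule thick_ideal_orthogonal_sum[OF T T]) (rule orth orth'; assumption)+
  obtain o' where o': "is_zero_object K o'" "o' \<in> obj K" by (rule ex_zero_obj)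
  have J1I: "x \<in> ?I" if "x \<in> ?J1" for x
  proof -
    have "x \<in> obj K" "o' \<in> ?J2" using V1.J_obj that V2.J_zero o' by auto
    then show ?thesis using that o'
      by (intro CollectI conjI bexI[of _ x] bexI[of _ o'] bexI[of _ "ident K x"]
          bexI[of _ "mzero K o' x"] bexI[of _ "mzero K x o'"]) (simp_all add: Mor_iff)
  qed
  have J2I: "x \<in> ?I" if "x \<in> ?J2" for x
  proof -
    have "x \<in> obj K" "o' \<in> ?J1" using V2.J_obj that V1.J_zero o' by auto
    then show ?thesis using that o'
      by (intro CollectI conjI bexI[of _ x] bexI[of _ o'] bexI[of _ "ident K x"]
          bexI[of _ "mzero K o' x"] bexI[of _ "mzero K x o'"]) (simp_all add: Mor_iff)
  qed
  obtain x where x: "x \<in> obj K" "supp K x = Spc K - U\<^sub>1" by (rule complement_is_support[OF ic U(1)])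
  obtain y where y: "y \<in> obj K" "supp K y = Spc K - U\<^sub>2" by (rule complement_is_support[OF ic U(2)])
  have xy: "x \<in> ?J1" "y \<in> ?J2" using x y by (simp_all add: ideal_off_def supported_on_def)
  have sub: "?J12 \<subseteq> ?I"
  proof (rule subsetI, rule ccontr)
    fix z assume z: "z \<in> ?J12" "z \<notin> ?I"
    \<comment> \<open>A prime containing \<open>?I\<close> contains \<open>x\<close> and
      \<open>y\<close>, so it avoids both complements and lies in the intersection of the open sets,
      where it would have to contain \<open>z\<close>.\<close>
    obtain P where P: "prime_ideal K P" "?I \<subseteq> P" "z \<notin> P"
      by (rule ex_prime_ideal[OF sc I V12.J_obj[OF z(1)] z(2)])
    have S: "P \<in> Spc K" using P(1) by (simp add: Spc_def)
    have "P \<notin> U\<^sub>1 \<inter> U\<^sub>2" using z(1) P(3) S by (auto simp: mem_ideal_off)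
    then have "P \<in> supp K x \<or> P \<in> supp K y" using x(2) y(2) S by blast
    then have "x \<notin> P \<or> y \<notin> P" by (auto simp: supp_def)
    moreover have "x \<in> P" "y \<in> P" using J1I[OF xy(1)] J2I[OF xy(2)] P(2) by blast+
    ultimately show False by blast
  qed
  have "?J1 \<subseteq> ?J12" "?J2 \<subseteq> ?J12" by (auto simp: mem_ideal_off)
  then have "verdier_inclusion K ?J1 ?J12" "verdier_inclusion K ?J2 ?J12"
    by (auto intro!: verdier_inclusion.intro verdier_inclusion_axioms.intro V1.verdier_axioms
        V2.verdier_axioms V12.verdier_axioms)
  moreover have "gluing_data_axioms K ?J1 ?J2 ?J12"
    by (rule gluing_data_axioms.intro) (use orth orth' sub ic in blast)+
  ultimately show ?thesis by (intro gluing_data.intro triangulated_category_axioms)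
qed

end

section \<open>Idempotent completions\<close>

lemma idempotent_completion_simps:
  "x \<in> obj (idempotent_completion D) \<longleftrightarrow>
     fst x \<in> obj D \<and> snd x \<in> Mor D (fst x) (fst x) \<and> snd x \<cdot>\<^bsub>D\<^esub> snd x = snd x"
  "(y', z, g) \<cdot>\<^bsub>idempotent_completion D\<^esub> (x, y, f) = (x, z, g \<cdot>\<^bsub>D\<^esub> f)"
  "ident (idempotent_completion D) x = (x, x, snd x)"
  "F \<in> Mor (idempotent_completion D) x y \<longleftrightarrow>
     x \<in> obj (idempotent_completion D) \<and> y \<in> obj (idempotent_completion D) \<and>
     (\<exists>f \<in> Mor D (fst x) (fst y). F = (x, y, f) \<and> snd y \<cdot>\<^bsub>D\<^esub> f \<cdot>\<^bsub>D\<^esub> snd x = f)"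
  by (auto simp: idempotent_completion_def Let_def Mor_def split: prod.splits)

lemma Iso_idempotent_completion:
  assumes "F \<in> Iso (idempotent_completion D) x y"
  obtains f g where "F = (x, y, f)" "f \<in> Mor D (fst x) (fst y)" "g \<in> Mor D (fst y) (fst x)"
    "snd y \<cdot>\<^bsub>D\<^esub> f \<cdot>\<^bsub>D\<^esub> snd x = f" "snd x \<cdot>\<^bsub>D\<^esub> g \<cdot>\<^bsub>D\<^esub> snd y = g"
    "g \<cdot>\<^bsub>D\<^esub> f = snd x" "f \<cdot>\<^bsub>D\<^esub> g = snd y"
proof -
  obtain G where G: "F \<in> Mor (idempotent_completion D) x y" "G \<in> Mor (idempotent_completion D) y x"
      "G \<cdot>\<^bsub>idempotent_completion D\<^esub> F = ident (idempotent_completion D) x"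
      "F \<cdot>\<^bsub>idempotent_completion D\<^esub> G = ident (idempotent_completion D) y"
    using assms unfolding Iso_def by blast
  obtain f where f: "f \<in> Mor D (fst x) (fst y)" "F = (x, y, f)" "snd y \<cdot>\<^bsub>D\<^esub> f \<cdot>\<^bsub>D\<^esub> snd x = f"
    using G(1) unfolding idempotent_completion_simps by blast
  obtain g where g: "g \<in> Mor D (fst y) (fst x)" "G = (y, x, g)" "snd x \<cdot>\<^bsub>D\<^esub> g \<cdot>\<^bsub>D\<^esub> snd y = g"
    using G(2) unfolding idempotent_completion_simps by blast
  show ?thesis
    by (rule that[OF f(2,1) g(1) f(3) g(3)])
      (use G(3,4) in \<open>simp_all add: f(2) g(2) idempotent_completion_simps(2,3)\<close>)
qed

lemma Iso_idempotent_completionI: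
  assumes "x \<in> obj (idempotent_completion D)" "y \<in> obj (idempotent_completion D)"
    "f \<in> Mor D (fst x) (fst y)" "g \<in> Mor D (fst y) (fst x)"
    "snd y \<cdot>\<^bsub>D\<^esub> f \<cdot>\<^bsub>D\<^esub> snd x = f" "snd x \<cdot>\<^bsub>D\<^esub> g \<cdot>\<^bsub>D\<^esub> snd y = g"
    "g \<cdot>\<^bsub>D\<^esub> f = snd x" "f \<cdot>\<^bsub>D\<^esub> g = snd y"
  shows "(x, y, f) \<in> Iso (idempotent_completion D) x y"
  unfolding Iso_def
proof (intro CollectI conjI bexI[of _ "(y, x, g)"])
  show "(x, y, f) \<in> Mor (idempotent_completion D) x y" "(y, x, g) \<in> Mor (idempotent_completion D) y x"
    unfolding idempotent_completion_simps(4) using assms by blast+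
qed (simp_all add: idempotent_completion_simps(2,3) assms)

lemma verdier_additive_simps:
  "obj (verdier_additive K J) = obj (verdier_quotient K J)"
  "Mor (verdier_additive K J) = Mor (verdier_quotient K J)"
  "ident (verdier_additive K J) = ident (verdier_quotient K J)"
  "comp (verdier_additive K J) = comp (verdier_quotient K J)"
  by (auto simp: verdier_additive_def Mor_def fun_eq_iff)

theorem theorem3p3:
  fixes K :: "('o, 'm, 'x) tt_cat_scheme"
    and U\<^sub>1 U\<^sub>2 :: "'o set set"
    and a\<^sub>1 a\<^sub>2 :: "('o, 'm) local_obj"
    and \<sigma> :: "('o, 'm) local_arr"
  assumes "tensor_triangulated_category K"
    and "idempotent_complete K"
    and "strongly_closed K"
    and "quasi_compact_open K U\<^sub>1" and "quasi_compact_open K U\<^sub>2"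
    and "Spc K = U\<^sub>1 \<union> U\<^sub>2"
    and "a\<^sub>1 \<in> obj (K_on K U\<^sub>1)" and "a\<^sub>2 \<in> obj (K_on K U\<^sub>2)"
    and "\<sigma> \<in> Iso (K_on K (U\<^sub>1 \<inter> U\<^sub>2)) (res_obj K (U\<^sub>1 \<inter> U\<^sub>2) a\<^sub>1) (res_obj K (U\<^sub>1 \<inter> U\<^sub>2) a\<^sub>2)"
  shows "(\<exists>a f\<^sub>1 f\<^sub>2. is_gluing K U\<^sub>1 U\<^sub>2 a\<^sub>1 a\<^sub>2 \<sigma> a f\<^sub>1 f\<^sub>2) \<and>
    (\<forall>a f\<^sub>1 f\<^sub>2 a' f\<^sub>1' f\<^sub>2'.
       is_gluing K U\<^sub>1 U\<^sub>2 a\<^sub>1 a\<^sub>2 \<sigma> a f\<^sub>1 f\<^sub>2 \<longrightarrow> is_gluing K U\<^sub>1 U\<^sub>2 a\<^sub>1 a\<^sub>2 \<sigma> a' f\<^sub>1' f\<^sub>2' \<longrightarrow>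
       (\<exists>f \<in> Iso K a a'.
          f\<^sub>1' \<cdot>\<^bsub>K_on K U\<^sub>1\<^esub> rho_arr K U\<^sub>1 f = f\<^sub>1 \<and>
          f\<^sub>2' \<cdot>\<^bsub>K_on K U\<^sub>2\<^esub> rho_arr K U\<^sub>2 f = f\<^sub>2))"
proof -
  interpret tensor_triangulated_category K by (rule assms(1))
  interpret G: gluing_data K "ideal_off K U\<^sub>1" "ideal_off K U\<^sub>2" "ideal_off K (U\<^sub>1 \<inter> U\<^sub>2)"
    by (rule gluing_data_ideal_off[OF assms(2-6)])
  let ?L1 = "verdier_additive K (ideal_off K U\<^sub>1)" and ?L2 = "verdier_additive K (ideal_off K U\<^sub>2)"
    and ?L12 = "verdier_additive K (ideal_off K (U\<^sub>1 \<inter> U\<^sub>2))"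
  let ?R = "further_localize_arr K (ideal_off K (U\<^sub>1 \<inter> U\<^sub>2))"
  have L: "obj (L_on K U) = obj (verdier_additive K (ideal_off K U))"
    "Mor (L_on K U) = Mor (verdier_additive K (ideal_off K U))"
    "ident (L_on K U) = ident (verdier_additive K (ideal_off K U))"
    "comp (L_on K U) = comp (verdier_additive K (ideal_off K U))" for U
    by (simp_all add: L_on_def verdier_additive_simps)
  obtain c1 e1 where a1: "a\<^sub>1 = (c1, e1)" by (cases a\<^sub>1)
  obtain c2 e2 where a2: "a\<^sub>2 = (c2, e2)" by (cases a\<^sub>2)
  have e1: "c1 \<in> obj K" "e1 \<in> Mor ?L1 c1 c1" "e1 \<cdot>\<^bsub>?L1\<^esub> e1 = e1"
    using assms(7) by (simp_all add: K_on_def idempotent_completion_simps(1) L a1)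
  have e2: "c2 \<in> obj K" "e2 \<in> Mor ?L2 c2 c2" "e2 \<cdot>\<^bsub>?L2\<^esub> e2 = e2"
    using assms(8) by (simp_all add: K_on_def idempotent_completion_simps(1) L a2)
  obtain s r where s: "\<sigma> = (res_obj K (U\<^sub>1 \<inter> U\<^sub>2) a\<^sub>1, res_obj K (U\<^sub>1 \<inter> U\<^sub>2) a\<^sub>2, s)"
      "s \<in> Mor ?L12 c1 c2" "r \<in> Mor ?L12 c2 c1" "?R e2 \<cdot>\<^bsub>?L12\<^esub> s \<cdot>\<^bsub>?L12\<^esub> ?R e1 = s"
      "?R e1 \<cdot>\<^bsub>?L12\<^esub> r \<cdot>\<^bsub>?L12\<^esub> ?R e2 = r" "r \<cdot>\<^bsub>?L12\<^esub> s = ?R e1" "s \<cdot>\<^bsub>?L12\<^esub> r = ?R e2"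
    using Iso_idempotent_completion[OF assms(9)[unfolded K_on_def]]
    unfolding L by (simp add: res_obj_def a1 a2) metis
  have rho: "rho_obj K U a = (a, ident (verdier_additive K (ideal_off K U)) a)" for U a
    by (simp add: rho_obj_def L)
  \<comment> \<open>The idempotent of \<open>rho_obj\<close> is an identity, so an isomorphism to
    \<open>(c1, e1)\<close> amounts to a pair with \<open>h1 f1 = 1\<close> and
    \<open>f1 h1 = e1\<close>; absorption of \<open>e1\<close> is then automatic. This removes the
    idempotent completions from the problem.\<close>
  have gluing_iff: "is_gluing K U\<^sub>1 U\<^sub>2 a\<^sub>1 a\<^sub>2 \<sigma> a F1 F2 \<longleftrightarrow> a \<in> obj K \<and>
      (\<exists>f1 h1 f2 h2. F1 = (rho_obj K U\<^sub>1 a, a\<^sub>1, f1) \<and> F2 = (rho_obj K U\<^sub>2 a, a\<^sub>2, f2) \<and>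
        f1 \<in> Mor ?L1 a c1 \<and> h1 \<in> Mor ?L1 c1 a \<and> h1 \<cdot>\<^bsub>?L1\<^esub> f1 = ident ?L1 a \<and> f1 \<cdot>\<^bsub>?L1\<^esub> h1 = e1 \<and>
        f2 \<in> Mor ?L2 a c2 \<and> h2 \<in> Mor ?L2 c2 a \<and> h2 \<cdot>\<^bsub>?L2\<^esub> f2 = ident ?L2 a \<and> f2 \<cdot>\<^bsub>?L2\<^esub> h2 = e2 \<and>
        s \<cdot>\<^bsub>?L12\<^esub> ?R f1 = ?R f2)" (is "?l \<longleftrightarrow> ?r") for a F1 F2
  proof
    assume l: ?l
    then have o: "a \<in> obj K" and I: "F1 \<in> Iso (idempotent_completion (L_on K U\<^sub>1)) (rho_obj K U\<^sub>1 a) a\<^sub>1"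
        "F2 \<in> Iso (idempotent_completion (L_on K U\<^sub>2)) (rho_obj K U\<^sub>2 a) a\<^sub>2"
      and c: "\<sigma> \<cdot>\<^bsub>K_on K (U\<^sub>1 \<inter> U\<^sub>2)\<^esub> res_arr K (U\<^sub>1 \<inter> U\<^sub>2) F1 = res_arr K (U\<^sub>1 \<inter> U\<^sub>2) F2"
      unfolding is_gluing_def K_on_def by blast+
    obtain f1 h1 where f1: "F1 = (rho_obj K U\<^sub>1 a, a\<^sub>1, f1)" "f1 \<in> Mor ?L1 a c1" "h1 \<in> Mor ?L1 c1 a"
        "h1 \<cdot>\<^bsub>?L1\<^esub> f1 = ident ?L1 a" "f1 \<cdot>\<^bsub>?L1\<^esub> h1 = e1"
      by (rule Iso_idempotent_completion[OF I(1)]) (simp add: L rho a1)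
    obtain f2 h2 where f2: "F2 = (rho_obj K U\<^sub>2 a, a\<^sub>2, f2)" "f2 \<in> Mor ?L2 a c2" "h2 \<in> Mor ?L2 c2 a"
        "h2 \<cdot>\<^bsub>?L2\<^esub> f2 = ident ?L2 a" "f2 \<cdot>\<^bsub>?L2\<^esub> h2 = e2"
      by (rule Iso_idempotent_completion[OF I(2)]) (simp add: L rho a2)
    have "s \<cdot>\<^bsub>?L12\<^esub> ?R f1 = ?R f2"
      using c unfolding K_on_def s(1) f1(1) f2(1)
      by (simp add: res_arr_def idempotent_completion_simps(2) L)
    then show ?r using o f1 f2 by blast
  next
    assume r: ?r
    then obtain f1 h1 f2 h2 where o: "a \<in> obj K"
      and F: "F1 = (rho_obj K U\<^sub>1 a, a\<^sub>1, f1)" "F2 = (rho_obj K U\<^sub>2 a, a\<^sub>2, f2)"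
      and f1: "f1 \<in> Mor ?L1 a c1" "h1 \<in> Mor ?L1 c1 a" "h1 \<cdot>\<^bsub>?L1\<^esub> f1 = ident ?L1 a" "f1 \<cdot>\<^bsub>?L1\<^esub> h1 = e1"
      and f2: "f2 \<in> Mor ?L2 a c2" "h2 \<in> Mor ?L2 c2 a" "h2 \<cdot>\<^bsub>?L2\<^esub> f2 = ident ?L2 a" "f2 \<cdot>\<^bsub>?L2\<^esub> h2 = e2"
      and c: "s \<cdot>\<^bsub>?L12\<^esub> ?R f1 = ?R f2"
      by (elim conjE exE) (rule that)
    note D1 = f1(1,2)[unfolded G.V1.L.Mor_iff] o
    note D2 = f2(1,2)[unfolded G.V2.L.Mor_iff] o
    have "F1 \<in> Iso (idempotent_completion (L_on K U\<^sub>1)) (rho_obj K U\<^sub>1 a) a\<^sub>1"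
      unfolding F(1)
    proof (rule Iso_idempotent_completionI[where g = h1])
      show "a\<^sub>1 \<in> obj (idempotent_completion (L_on K U\<^sub>1))" using assms(7) by (simp add: K_on_def)
      show "snd a\<^sub>1 \<cdot>\<^bsub>L_on K U\<^sub>1\<^esub> f1 \<cdot>\<^bsub>L_on K U\<^sub>1\<^esub> snd (rho_obj K U\<^sub>1 a) = f1"
        by (simp add: L rho a1 D1 f1(3) f1(4)[symmetric])
      show "snd (rho_obj K U\<^sub>1 a) \<cdot>\<^bsub>L_on K U\<^sub>1\<^esub> h1 \<cdot>\<^bsub>L_on K U\<^sub>1\<^esub> snd a\<^sub>1 = h1"
        by (simp add: L rho a1 D1 f1(4)[symmetric] G.V1.L.comp_eq_arr[OF f1(3)])
    qed (simp_all add: L rho a1 f1 o idempotent_completion_simps(1) G.V1.L.ident_Mor)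
    moreover have "F2 \<in> Iso (idempotent_completion (L_on K U\<^sub>2)) (rho_obj K U\<^sub>2 a) a\<^sub>2"
      unfolding F(2)
    proof (rule Iso_idempotent_completionI[where g = h2])
      show "a\<^sub>2 \<in> obj (idempotent_completion (L_on K U\<^sub>2))" using assms(8) by (simp add: K_on_def)
      show "snd a\<^sub>2 \<cdot>\<^bsub>L_on K U\<^sub>2\<^esub> f2 \<cdot>\<^bsub>L_on K U\<^sub>2\<^esub> snd (rho_obj K U\<^sub>2 a) = f2"
        by (simp add: L rho a2 D2 f2(3) f2(4)[symmetric])
      show "snd (rho_obj K U\<^sub>2 a) \<cdot>\<^bsub>L_on K U\<^sub>2\<^esub> h2 \<cdot>\<^bsub>L_on K U\<^sub>2\<^esub> snd a\<^sub>2 = h2"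
        by (simp add: L rho a2 D2 f2(4)[symmetric] G.V2.L.comp_eq_arr[OF f2(3)])
    qed (simp_all add: L rho a2 f2 o idempotent_completion_simps(1) G.V2.L.ident_Mor)
    \<comment> \<open>Arrows of the completion carry their endpoints, so the compatibility equation
      also requires the two restrictions of \<open>a\<close> to coincide; both carry an identity as
      idempotent.\<close>
    moreover have "res_obj K (U\<^sub>1 \<inter> U\<^sub>2) (rho_obj K U\<^sub>1 a) = res_obj K (U\<^sub>1 \<inter> U\<^sub>2) (rho_obj K U\<^sub>2 a)"
      by (simp add: res_obj_def rho o)
    then have "\<sigma> \<cdot>\<^bsub>K_on K (U\<^sub>1 \<inter> U\<^sub>2)\<^esub> res_arr K (U\<^sub>1 \<inter> U\<^sub>2) F1 = res_arr K (U\<^sub>1 \<inter> U\<^sub>2) F2"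
      unfolding K_on_def s(1) F using c by (simp add: res_arr_def idempotent_completion_simps(2) L)
    ultimately show ?l unfolding is_gluing_def K_on_def using o by blast
  qed
  have R1: "?R e1 \<in> Mor ?L12 c1 c1" "?R e1 \<cdot>\<^bsub>?L12\<^esub> ?R e1 = ?R e1"
    using e1(2)[unfolded G.V1.L.Mor_iff] arg_cong[OF e1(3), of ?R]
    by (simp_all add: G.V1.V'.L.Mor_iff)
  have R2: "?R e2 \<in> Mor ?L12 c2 c2" "?R e2 \<cdot>\<^bsub>?L12\<^esub> ?R e2 = ?R e2"
    using e2(2)[unfolded G.V2.L.Mor_iff] arg_cong[OF e2(3), of ?R]
    by (simp_all add: G.V1.V'.L.Mor_iff)
  have se: "s \<cdot>\<^bsub>?L12\<^esub> ?R e1 = s"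
    by (rule G.V1.V'.L.absorb_idempotents(1)[OF s(4,2) R1 R2])
  show ?thesis
  proof (intro conjI allI impI)
    obtain a f1 h1 f2 h2 where "a \<in> obj K"
      "f1 \<in> Mor ?L1 a c1" "h1 \<in> Mor ?L1 c1 a" "h1 \<cdot>\<^bsub>?L1\<^esub> f1 = ident ?L1 a" "f1 \<cdot>\<^bsub>?L1\<^esub> h1 = e1"
      "f2 \<in> Mor ?L2 a c2" "h2 \<in> Mor ?L2 c2 a" "h2 \<cdot>\<^bsub>?L2\<^esub> f2 = ident ?L2 a" "f2 \<cdot>\<^bsub>?L2\<^esub> h2 = e2"
      "s \<cdot>\<^bsub>?L12\<^esub> ?R f1 = ?R f2"
      by (rule G.glue_local_summands[OF e1(1) e2(1) e1(2,3) e2(2,3) s(2,4,3,5,6,7)])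
    then show "\<exists>a f1 f2. is_gluing K U\<^sub>1 U\<^sub>2 a\<^sub>1 a\<^sub>2 \<sigma> a f1 f2"
      unfolding gluing_iff by blast
  next
    fix a F1 F2 a' F1' F2'
    assume "is_gluing K U\<^sub>1 U\<^sub>2 a\<^sub>1 a\<^sub>2 \<sigma> a F1 F2" "is_gluing K U\<^sub>1 U\<^sub>2 a\<^sub>1 a\<^sub>2 \<sigma> a' F1' F2'"
    then obtain f1 h1 f2 h2 f1' h1' f2' h2' where
      F: "F1 = (rho_obj K U\<^sub>1 a, a\<^sub>1, f1)" "F2 = (rho_obj K U\<^sub>2 a, a\<^sub>2, f2)"
        "F1' = (rho_obj K U\<^sub>1 a', a\<^sub>1, f1')" "F2' = (rho_obj K U\<^sub>2 a', a\<^sub>2, f2')"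
      and f1: "f1 \<in> Mor ?L1 a c1" "h1 \<in> Mor ?L1 c1 a" "h1 \<cdot>\<^bsub>?L1\<^esub> f1 = ident ?L1 a" "f1 \<cdot>\<^bsub>?L1\<^esub> h1 = e1"
      and f2: "f2 \<in> Mor ?L2 a c2" "h2 \<in> Mor ?L2 c2 a" "h2 \<cdot>\<^bsub>?L2\<^esub> f2 = ident ?L2 a" "f2 \<cdot>\<^bsub>?L2\<^esub> h2 = e2"
        "s \<cdot>\<^bsub>?L12\<^esub> ?R f1 = ?R f2"
      and f1': "f1' \<in> Mor ?L1 a' c1" "h1' \<in> Mor ?L1 c1 a'" "h1' \<cdot>\<^bsub>?L1\<^esub> f1' = ident ?L1 a'"
        "f1' \<cdot>\<^bsub>?L1\<^esub> h1' = e1"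
      and f2': "f2' \<in> Mor ?L2 a' c2" "h2' \<in> Mor ?L2 c2 a'" "h2' \<cdot>\<^bsub>?L2\<^esub> f2' = ident ?L2 a'"
        "f2' \<cdot>\<^bsub>?L2\<^esub> h2' = e2" "s \<cdot>\<^bsub>?L12\<^esub> ?R f1' = ?R f2'"
      unfolding gluing_iff by (elim conjE exE) (rule that)
    obtain g where g: "g \<in> Iso K a a'" "f1' \<cdot>\<^bsub>?L1\<^esub> localize_arr K (ideal_off K U\<^sub>1) g = f1"
        "f2' \<cdot>\<^bsub>?L2\<^esub> localize_arr K (ideal_off K U\<^sub>2) g = f2"
      by (rule G.gluing_unique[OF s(2) se f1 f2 f1' f2'])
    have ga: "src K g = a" "tgt K g = a'" using g(1) by (simp_all add: Iso_iff Mor_iff)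
    show "\<exists>f \<in> Iso K a a'. F1' \<cdot>\<^bsub>K_on K U\<^sub>1\<^esub> rho_arr K U\<^sub>1 f = F1 \<and> F2' \<cdot>\<^bsub>K_on K U\<^sub>2\<^esub> rho_arr K U\<^sub>2 f = F2"
      using g by (intro bexI[OF _ g(1)])
        (simp add: F rho_arr_def ga K_on_def idempotent_completion_simps(2) L)
  qed
qed

end
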